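(* Let $R$ be a regular complete local domain of dimension $2$ with $\mathbb{Q}\subset R$ (equivalently, by the Cohen structure theorem, a power series ring in two variables over a field of characteristic zero). Then $R^+$ is intersection flat and Ohm-Rush as an $R$-module.
   Context: For an integral domain $R$, the absolute integral closure $R^+$ is the integral closure of $R$ in an algebraic closure of its fraction field. All rings are commutative with identity. An $R$-module $S$ is intersection flat if it is $R$-flat and, for every finitely generated $R$-module $M$ and every (possibly infinite) family $\{N_\lambda\}_{\lambda\in\Lambda}$ of submodules of $M$, one has $S\otimes_R\left(\bigcap_\lambda N_\lambda\right)=\bigcap_\lambda (S\otimes_R N_\lambda)$ as submodules of $S\otimes_R M$. An $R$-module $S$ is Ohm-Rush if for every $x\in S$ one has $x\in c(x)S$, where $c(x)=\bigcap\{I : I \text{ an ideal of } R \text{ with } x\in IS\}$. *)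

theory Defs
  imports "HOL-Algebra.Algebra" "HOL-Algebra.Algebraic_Closure_Type" "HOL-Library.Extended_Nat"
begin

section \<open>Regular complete local rings\<close>

text \<open>The supremum of the lengths n of strict chains of prime ideals P 0 < ... < P n.\<close>

definition krull_dim :: "('a, 'r) ring_scheme \<Rightarrow> enat" where
  "krull_dim R = Sup {enat n | n. \<exists>P :: nat \<Rightarrow> 'a set.
     (\<forall>i\<le>n. primeideal (P i) R) \<and> (\<forall>i<n. P i \<subset> P (Suc i))}"

definition local_ring :: "('a, 'r) ring_scheme \<Rightarrow> 'a set \<Rightarrow> bool" where
  "local_ring R m \<longleftrightarrow> cring R \<and> maximalideal m R \<and> (\<forall>m'. maximalideal m' R \<longrightarrow> m' = m)"

definition regular_local_ring :: "('a, 'r) ring_scheme \<Rightarrow> 'a set \<Rightarrow> bool" where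
  "regular_local_ring R m \<longleftrightarrow> local_ring R m \<and> noetherian_ring R \<and>
     (\<exists>A \<subseteq> carrier R. finite A \<and> enat (card A) = krull_dim R \<and> m = genideal R A)"

text \<open>Bijectivity of the canonical map from R to the inverse limit of the R/I^n: x represents a
  compatible system of residues (x n modulo I^n), and y is its unique preimage. Powers of ideals
  are taken in the multiplicative monoid of ideals.\<close>

definition adically_complete :: "('a, 'r) ring_scheme \<Rightarrow> 'a set \<Rightarrow> bool" where
  "adically_complete R I \<longleftrightarrow>
     (\<forall>x :: nat \<Rightarrow> 'a.
        (\<forall>n. x n \<in> carrier R \<and> x (Suc n) \<ominus>\<^bsub>R\<^esub> x n \<in> I [^]\<^bsub>ideals_set R\<^esub> n) \<longrightarrow>
        (\<exists>!y. y \<in> carrier R \<and> (\<forall>n. y \<ominus>\<^bsub>R\<^esub> x n \<in> I [^]\<^bsub>ideals_set R\<^esub> n)))"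

definition contains_rationals :: "('a, 'r) ring_scheme \<Rightarrow> bool" where
  "contains_rationals R \<longleftrightarrow>
     (\<exists>\<psi>. \<psi> \<in> ring_hom (ring_of_type_algebra :: rat ring) R \<and> inj \<psi>)"


section \<open>The absolute integral closure\<close>

text \<open>Via the embedding \<open>\<phi>\<close>, the field L is an algebraic closure of the fraction field of R; the
  fraction field is realised as the subfield of L generated by the image of R.\<close>

definition alg_closure_of_fractions ::
  "('a, 'r) ring_scheme \<Rightarrow> ('a \<Rightarrow> 'l) \<Rightarrow> ('l, 'k) ring_scheme \<Rightarrow> bool" where
  "alg_closure_of_fractions R \<phi> L \<longleftrightarrow>
     \<phi> \<in> ring_hom R L \<and> inj_on \<phi> (carrier R) \<and>
     algebraic_closure L (generate_field L (\<phi> ` carrier R))"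

definition integral_closure :: "('l, 'k) ring_scheme \<Rightarrow> 'l set \<Rightarrow> 'l set" where
  "integral_closure L A =
     {x \<in> carrier L. \<exists>p \<in> carrier (univ_poly L A).
        p \<noteq> [] \<and> hd p = \<one>\<^bsub>L\<^esub> \<and> ring.eval L p x = \<zero>\<^bsub>L\<^esub>}"

text \<open>The integral closure of R in L as an R-algebra; when L is an algebraic closure of the
  fraction field of R, this is the absolute integral closure of R.\<close>

definition integral_closure_module ::
  "('a, 'r) ring_scheme \<Rightarrow> ('a \<Rightarrow> 'l) \<Rightarrow> ('l, 'k) ring_scheme \<Rightarrow> ('a, 'l) module" where
  "integral_closure_module R \<phi> L =
     \<lparr>carrier = integral_closure L (\<phi> ` carrier R), monoid.mult = monoid.mult L, one = \<one>\<^bsub>L\<^esub>,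
      ring.zero = \<zero>\<^bsub>L\<^esub>, add = add L, module.smult = (\<lambda>r x. \<phi> r \<otimes>\<^bsub>L\<^esub> x)\<rparr>"


section \<open>Tensor products and flatness\<close>

text \<open>The underlying abelian group of the tensor product of S and M over R: the free abelian group
  on the pairs (s, m) modulo the subgroup of bilinear relations. Its R-module structure is not
  needed, since injectivity of maps and equality of subsets do not depend on it.\<close>

definition tensor_relations ::
  "('a, 'r) ring_scheme \<Rightarrow> ('a, 's) module \<Rightarrow> ('a, 'm) module \<Rightarrow> ('s \<times> 'm \<Rightarrow>\<^sub>0 int) set" where
  "tensor_relations R S M = generate (free_Abelian_group (carrier S \<times> carrier M))
     ({frag_of (s \<oplus>\<^bsub>S\<^esub> t, x) - frag_of (s, x) - frag_of (t, x) | s t x.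
         s \<in> carrier S \<and> t \<in> carrier S \<and> x \<in> carrier M} \<union>
      {frag_of (s, x \<oplus>\<^bsub>M\<^esub> y) - frag_of (s, x) - frag_of (s, y) | s x y.
         s \<in> carrier S \<and> x \<in> carrier M \<and> y \<in> carrier M} \<union>
      {frag_of (r \<odot>\<^bsub>S\<^esub> s, x) - frag_of (s, r \<odot>\<^bsub>M\<^esub> x) | r s x.
         r \<in> carrier R \<and> s \<in> carrier S \<and> x \<in> carrier M})"

definition tensor ::
  "('a, 'r) ring_scheme \<Rightarrow> ('a, 's) module \<Rightarrow> ('a, 'm) module \<Rightarrow> ('s \<times> 'm \<Rightarrow>\<^sub>0 int) set monoid" where
  "tensor R S M = free_Abelian_group (carrier S \<times> carrier M) Mod tensor_relations R S M"

definition module_homs ::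
  "('a, 'r) ring_scheme \<Rightarrow> ('a, 'm) module \<Rightarrow> ('a, 'n) module \<Rightarrow> ('m \<Rightarrow> 'n) set" where
  "module_homs R M N = {f \<in> hom (add_monoid M) (add_monoid N).
     \<forall>r \<in> carrier R. \<forall>x \<in> carrier M. f (r \<odot>\<^bsub>M\<^esub> x) = r \<odot>\<^bsub>N\<^esub> f x}"

text \<open>The map induced by f on tensor products with S, sending the class of (s, x) to the class of
  (s, f x). All cosets in the union coincide when f is linear.\<close>

definition tensor_map ::
  "('a, 'r) ring_scheme \<Rightarrow> ('a, 's) module \<Rightarrow> ('a, 'm) module \<Rightarrow> ('a, 'n) module \<Rightarrow> ('m \<Rightarrow> 'n) \<Rightarrow>
     ('s \<times> 'm \<Rightarrow>\<^sub>0 int) set \<Rightarrow> ('s \<times> 'n \<Rightarrow>\<^sub>0 int) set" where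
  "tensor_map R S M N f Z =
     (\<Union>c\<in>Z. tensor_relations R S N #>\<^bsub>free_Abelian_group (carrier S \<times> carrier N)\<^esub>
        frag_extend (\<lambda>(s, x). frag_of (s, f x)) c)"

text \<open>A definition cannot quantify over types, so the modules tested against have their carriers in
  a type \<open>'m\<close>, passed as an argument; a statement that is polymorphic in \<open>'m\<close> covers all modules.\<close>

definition flat_module ::
  "'m itself \<Rightarrow> ('a, 'r) ring_scheme \<Rightarrow> ('a, 's) module \<Rightarrow> bool" where
  "flat_module T R S \<longleftrightarrow> module R S \<and>
     (\<forall>(M :: ('a, 'm) module) (N :: ('a, 'm) module) f.
        module R M \<and> module R N \<and> f \<in> module_homs R M N \<and> inj_on f (carrier M) \<longrightarrow>
        inj_on (tensor_map R S M N f) (carrier (tensor R S M)))"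

definition finitely_generated :: "('a, 'r) ring_scheme \<Rightarrow> ('a, 'm) module \<Rightarrow> bool" where
  "finitely_generated R M \<longleftrightarrow>
     (\<exists>B \<subseteq> carrier M. finite B \<and>
        (\<forall>x \<in> carrier M. \<exists>c \<in> B \<rightarrow> carrier R. x = (\<Oplus>\<^bsub>M\<^esub>b\<in>B. c b \<odot>\<^bsub>M\<^esub> b)))"

text \<open>The image in the tensor product of S and M of the tensor product of S and the submodule N.\<close>

definition tensor_submodule ::
  "('a, 'r) ring_scheme \<Rightarrow> ('a, 's) module \<Rightarrow> ('a, 'm) module \<Rightarrow> 'm set \<Rightarrow>
     ('s \<times> 'm \<Rightarrow>\<^sub>0 int) set set" where
  "tensor_submodule R S M N =
     tensor_map R S (M\<lparr>carrier := N\<rparr>) M (\<lambda>x. x) ` carrier (tensor R S (M\<lparr>carrier := N\<rparr>))"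

text \<open>For the empty family both intersections are the ambient module.\<close>

definition intersection_flat ::
  "'m itself \<Rightarrow> ('a, 'r) ring_scheme \<Rightarrow> ('a, 's) module \<Rightarrow> bool" where
  "intersection_flat T R S \<longleftrightarrow> flat_module T R S \<and>
     (\<forall>(M :: ('a, 'm) module) \<N>.
        module R M \<and> finitely_generated R M \<and> (\<forall>N\<in>\<N>. submodule N R M) \<longrightarrow>
        tensor_submodule R S M (carrier M \<inter> \<Inter>\<N>) =
          carrier (tensor R S M) \<inter> (\<Inter>N\<in>\<N>. tensor_submodule R S M N))"


section \<open>Ohm-Rush modules\<close>

definition ideal_smult :: "'a set \<Rightarrow> ('a, 's) module \<Rightarrow> 's set" where
  "ideal_smult I S = generate (add_monoid S) {a \<odot>\<^bsub>S\<^esub> s | a s. a \<in> I \<and> s \<in> carrier S}"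

definition content_ideal :: "('a, 'r) ring_scheme \<Rightarrow> ('a, 's) module \<Rightarrow> 's \<Rightarrow> 'a set" where
  "content_ideal R S x = \<Inter>{I. ideal I R \<and> x \<in> ideal_smult I S}"

definition ohm_rush :: "('a, 'r) ring_scheme \<Rightarrow> ('a, 's) module \<Rightarrow> bool" where
  "ohm_rush R S \<longleftrightarrow> module R S \<and> (\<forall>x \<in> carrier S. x \<in> ideal_smult (content_ideal R S x) S)"

end

theory Submission
  imports Defs
begin

text \<open>Write \<open>R\<^sup>+\<close> for the absolute integral closure. Everything rests on one property of it, called
  \<^emph>\<open>local projectivity\<close> below: every \<open>x\<close> in \<open>R\<^sup>+\<close> can be written as \<open>f\<^sub>1(x) e\<^sub>1 + \<dots> + f\<^sub>n(x) e\<^sub>n\<close> with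
  elements \<open>e\<^sub>i\<close> of \<open>R\<^sup>+\<close> and \<open>R\<close>-linear forms \<open>f\<^sub>i : R\<^sup>+ \<rightarrow> R\<close>. Local projectivity passes from one
  element to finitely many, and then it controls tensor products: a linear form \<open>f\<close> contracts
  \<open>R\<^sup>+ \<otimes> M\<close> to \<open>M\<close>, and an element \<open>z\<close> of \<open>R\<^sup>+ \<otimes> M\<close> lies in the image of \<open>R\<^sup>+ \<otimes> N\<close> if and only if all its
  contractions lie in \<open>N\<close>. This membership test commutes with intersections, and with \<open>N = 0\<close> it
  yields flatness; applied to ideals it says that the content of \<open>x\<close> contains all \<open>f(x)\<close>, hence
  \<open>x = f\<^sub>1(x) e\<^sub>1 + \<dots> + f\<^sub>n(x) e\<^sub>n\<close> is in the content times \<open>R\<^sup>+\<close>.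

  To prove local projectivity, let \<open>A\<close> be the image of \<open>R\<close> in the algebraically closed field \<open>L\<close>, let \<open>K\<close> be
  the fraction field of \<open>A\<close>, and let \<open>a, b\<close> generate the maximal ideal. Three things are needed.

  \<^item> \<^emph>\<open>Depth two means free.\<close> The pair \<open>a, b\<close> is a regular sequence in \<open>A\<close> (\<open>regular_sequence\<close>). Let \<open>M\<close>
    be a finitely generated \<open>A\<close>-submodule of \<open>L\<close> in which \<open>b u = a v\<close> forces \<open>u \<in> a M\<close>. Then \<open>M\<close> is free
    (\<open>basis_of_regular\<close>): the relations among a minimal number of generators have coefficients in the
    maximal ideal, and regularity divides them by \<open>a\<close> and \<open>b\<close> again and again, so that they lie in all
    powers of the maximal ideal and vanish. In rank one this shows that \<open>A\<close> is integrally closed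
    (\<open>normal\<close>).

  \<^item> \<^emph>\<open>Normalised traces.\<close> In characteristic zero an element of \<open>L\<close> that is fixed by all automorphisms
    over \<open>K\<close> is in \<open>K\<close> (\<open>exists_moving_aut\<close>). Averaging over the finite orbits of a group \<open>H\<close> of
    automorphisms is a linear projection of \<open>L\<close> onto the fixed field of \<open>H\<close>, and as \<open>A\<close> contains the
    rationals, it maps \<open>R\<^sup>+\<close> to itself.

  \<^item> \<^emph>\<open>Finiteness.\<close> Let \<open>H\<close> be the stabiliser of \<open>x \<in> R\<^sup>+\<close>, and let \<open>S\<close> be the set of all \<open>y\<close> in the fixed
    field of \<open>H\<close> that are multiplied into \<open>R\<^sup>+\<close> by a power of \<open>a\<close> and by a power of \<open>b\<close>. The forms
    \<open>y \<mapsto> trace(y x\<^sup>j)\<close> embed \<open>S\<close> in a finite power of \<open>A\<close> by a Vandermonde argument, so that the ring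
    \<open>S\<close> is a finite \<open>A\<close>-module, hence consists of integral elements, and it is free by the first point.

  The coordinates of \<open>S\<close>, composed with the projection of \<open>R\<^sup>+\<close> onto \<open>S\<close> given by the \<open>H\<close>-average, are the
  forms \<open>f\<^sub>i\<close> for \<open>x\<close>; see \<open>integral_elem_dual_basis\<close>.\<close>

section \<open>Modules whose elements are fixed by operators of finite rank\<close>

definition linear_form :: "('a, 'r) ring_scheme \<Rightarrow> ('a, 's, 't) module_scheme \<Rightarrow> ('s \<Rightarrow> 'a) \<Rightarrow> bool" where
  "linear_form R S f \<longleftrightarrow> f \<in> carrier S \<rightarrow> carrier R \<and>
     (\<forall>x\<in>carrier S. \<forall>y\<in>carrier S. f (x \<oplus>\<^bsub>S\<^esub> y) = f x \<oplus>\<^bsub>R\<^esub> f y) \<and>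
     (\<forall>r\<in>carrier R. \<forall>x\<in>carrier S. f (r \<odot>\<^bsub>S\<^esub> x) = r \<otimes>\<^bsub>R\<^esub> f x)"

text \<open>Sums of operators \<open>x \<mapsto> f x \<odot> e\<close>. Only the values on the carrier matter, so both rules admit every
  function with the right values there.\<close>

inductive finite_rank :: "('a, 'r) ring_scheme \<Rightarrow> ('a, 's, 't) module_scheme \<Rightarrow> ('s \<Rightarrow> 's) \<Rightarrow> bool"
  for R S where
  zero: "(\<And>x. x \<in> carrier S \<Longrightarrow> p x = \<zero>\<^bsub>S\<^esub>) \<Longrightarrow> finite_rank R S p"
| step: "\<lbrakk>finite_rank R S p; linear_form R S f; e \<in> carrier S;
          \<And>x. x \<in> carrier S \<Longrightarrow> q x = p x \<oplus>\<^bsub>S\<^esub> f x \<odot>\<^bsub>S\<^esub> e\<rbrakk> \<Longrightarrow> finite_rank R S q"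

text \<open>Such modules are also known as trace modules; for flat modules the property is the strict
  Mittag-Leffler condition.\<close>

definition locally_projective :: "('a, 'r) ring_scheme \<Rightarrow> ('a, 's, 't) module_scheme \<Rightarrow> bool" where
  "locally_projective R S \<longleftrightarrow> module R S \<and>
     (\<forall>x\<in>carrier S. \<exists>p. finite_rank R S p \<and> p x = x)"

context module
begin

lemma linear_formD:
  assumes "linear_form R M f"
  shows "x \<in> carrier M \<Longrightarrow> f x \<in> carrier R"
    and "x \<in> carrier M \<Longrightarrow> y \<in> carrier M \<Longrightarrow> f (x \<oplus>\<^bsub>M\<^esub> y) = f x \<oplus> f y"
    and "r \<in> carrier R \<Longrightarrow> x \<in> carrier M \<Longrightarrow> f (r \<odot>\<^bsub>M\<^esub> x) = r \<otimes> f x"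
  using assms unfolding linear_form_def by auto

lemma finite_rank_linear:
  assumes "finite_rank R M p"
  shows "(\<forall>x\<in>carrier M. p x \<in> carrier M) \<and>
     (\<forall>x\<in>carrier M. \<forall>y\<in>carrier M. p (x \<oplus>\<^bsub>M\<^esub> y) = p x \<oplus>\<^bsub>M\<^esub> p y) \<and>
     (\<forall>r\<in>carrier R. \<forall>x\<in>carrier M. p (r \<odot>\<^bsub>M\<^esub> x) = r \<odot>\<^bsub>M\<^esub> p x)"
  using assms
proof induction
  case (zero p)
  then show ?case by simp
next
  case (step p f e q)
  note f = linear_formD[OF step(2)]
  have "q x \<in> carrier M" if "x \<in> carrier M" for x
    using that step f by simp
  moreover have "q (x \<oplus>\<^bsub>M\<^esub> y) = q x \<oplus>\<^bsub>M\<^esub> q y" if "x \<in> carrier M" "y \<in> carrier M" for x y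
    using that step.IH step.hyps(3,4) f by (simp add: smult_l_distr M.a_ac)
  moreover have "q (r \<odot>\<^bsub>M\<^esub> x) = r \<odot>\<^bsub>M\<^esub> q x" if "r \<in> carrier R" "x \<in> carrier M" for r x
    using that step.IH step.hyps(3,4) f by (simp add: smult_r_distr smult_assoc1)
  ultimately show ?case by blast
qed

text \<open>If \<open>p\<close> fixes some elements and \<open>q\<close> repairs the defect \<open>x - p x\<close> of a further element \<open>x\<close>, then
  \<open>p + q (1 - p)\<close> fixes all of them. This is how one element is replaced by finitely many.\<close>

lemma finite_rank_correction:
  assumes p: "finite_rank R M p" and q: "finite_rank R M q"
  shows "finite_rank R M (\<lambda>x. p x \<oplus>\<^bsub>M\<^esub> q (x \<ominus>\<^bsub>M\<^esub> p x))"
  using q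
proof induction
  case (zero q)
  note lin = finite_rank_linear[OF p]
  have "finite_rank R M (\<lambda>x. p x)" using p by simp
  then show ?case
  proof (rule finite_rank.step[where f = "\<lambda>_. \<zero>" and e = "\<zero>\<^bsub>M\<^esub>"])
    show "linear_form R M (\<lambda>_. \<zero>)" by (simp add: linear_form_def)
  qed (use lin zero in auto)
next
  case (step q f e q')
  note lin = finite_rank_linear[OF p] and linq = finite_rank_linear[OF step.hyps(1)]
  note f = linear_formD[OF step.hyps(2)]
  have "linear_form R M (\<lambda>x. f (x \<ominus>\<^bsub>M\<^esub> p x))"
    unfolding linear_form_def
  proof (intro conjI ballI funcsetI)
    fix x assume x: "x \<in> carrier M"
    show "f (x \<ominus>\<^bsub>M\<^esub> p x) \<in> carrier R" using x lin f by simp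
    fix y assume y: "y \<in> carrier M"
    have "x \<oplus>\<^bsub>M\<^esub> y \<ominus>\<^bsub>M\<^esub> p (x \<oplus>\<^bsub>M\<^esub> y) = (x \<ominus>\<^bsub>M\<^esub> p x) \<oplus>\<^bsub>M\<^esub> (y \<ominus>\<^bsub>M\<^esub> p y)"
      using x y lin by (simp add: M.minus_eq M.minus_add M.a_ac)
    then show "f (x \<oplus>\<^bsub>M\<^esub> y \<ominus>\<^bsub>M\<^esub> p (x \<oplus>\<^bsub>M\<^esub> y)) = f (x \<ominus>\<^bsub>M\<^esub> p x) \<oplus> f (y \<ominus>\<^bsub>M\<^esub> p y)"
      using x y lin f by simp
  next
    fix r x assume r: "r \<in> carrier R" and x: "x \<in> carrier M"
    have "r \<odot>\<^bsub>M\<^esub> x \<ominus>\<^bsub>M\<^esub> p (r \<odot>\<^bsub>M\<^esub> x) = r \<odot>\<^bsub>M\<^esub> (x \<ominus>\<^bsub>M\<^esub> p x)"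
      using r x lin by (simp add: M.minus_eq smult_r_distr smult_r_minus)
    then show "f (r \<odot>\<^bsub>M\<^esub> x \<ominus>\<^bsub>M\<^esub> p (r \<odot>\<^bsub>M\<^esub> x)) = r \<otimes> f (x \<ominus>\<^bsub>M\<^esub> p x)"
      using r x lin f by simp
  qed
  from finite_rank.step[OF step.IH this step.hyps(3)] show ?case
    using lin linq f step.hyps(3,4) by (auto simp: M.a_assoc)
qed

lemma locally_projective_fixes_finite:
  assumes "locally_projective R M" "finite Y" "Y \<subseteq> carrier M"
  shows "\<exists>p. finite_rank R M p \<and> (\<forall>x\<in>Y. p x = x)"
  using assms(2,3)
proof (induction Y rule: finite_induct)
  case empty
  show ?case using finite_rank.zero[of M "\<lambda>_. \<zero>\<^bsub>M\<^esub>" R] by blast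
next
  case (insert y Y)
  then obtain p where p: "finite_rank R M p" "\<And>x. x \<in> Y \<Longrightarrow> p x = x" by auto
  note lin = finite_rank_linear[OF p(1)]
  define z where "z = y \<ominus>\<^bsub>M\<^esub> p y"
  have z: "z \<in> carrier M" using insert.prems lin unfolding z_def by simp
  then obtain q where q: "finite_rank R M q" "q z = z"
    using assms(1) unfolding locally_projective_def by blast
  note linq = finite_rank_linear[OF q(1)]
  have q0: "q \<zero>\<^bsub>M\<^esub> = \<zero>\<^bsub>M\<^esub>"
    using linq finite_rank_linear[OF q(1)] by (metis M.zero_closed R.zero_closed smult_l_null)
  let ?s = "\<lambda>x. p x \<oplus>\<^bsub>M\<^esub> q (x \<ominus>\<^bsub>M\<^esub> p x)"
  have "?s x = x" if "x \<in> Y" for x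
    using that p(2) insert.prems q0 by (auto simp: subset_iff M.minus_eq M.r_neg)
  moreover have "?s y = y"
    using q(2) insert.prems lin unfolding z_def by (simp add: M.minus_eq M.a_lcomm M.r_neg)
  ultimately show ?case using finite_rank_correction[OF p(1) q(1)] by blast
qed

end

section \<open>Intersection flatness and contents from linear forms\<close>

lemmas frag_on_induct = free_Abelian_group_induct[consumes 1, case_names zero diff of]

lemma subgroup_tensor_relations:
  assumes "module R S" "module R M"
  shows "subgroup (tensor_relations R S M) (free_Abelian_group (carrier S \<times> carrier M))"
proof -
  interpret S: module R S by fact
  interpret M: module R M by fact
  show ?thesis
    unfolding tensor_relations_def
    by (rule group.generate_is_subgroup[OF group_free_Abelian_group])
       (auto simp del: carrier_free_Abelian_group_iff simp: free_Abelian_group_def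
          dest!: subsetD[OF keys_diff])
qed

lemma tensor_relations_closed:
  assumes "module R S" "module R M"
  shows "c \<in> tensor_relations R S M \<Longrightarrow> Poly_Mapping.keys c \<subseteq> carrier S \<times> carrier M"
    and "0 \<in> tensor_relations R S M"
    and "c \<in> tensor_relations R S M \<Longrightarrow> d \<in> tensor_relations R S M \<Longrightarrow> c + d \<in> tensor_relations R S M"
    and "c \<in> tensor_relations R S M \<Longrightarrow> - c \<in> tensor_relations R S M"
    and "c \<in> tensor_relations R S M \<Longrightarrow> d \<in> tensor_relations R S M \<Longrightarrow> c - d \<in> tensor_relations R S M"
proof -
  note sg = subgroup_tensor_relations[OF assms]
  show 1: "Poly_Mapping.keys c \<subseteq> carrier S \<times> carrier M" if "c \<in> tensor_relations R S M" for c
    using subgroup.subset[OF sg] that by (auto simp: free_Abelian_group_def)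
  show "0 \<in> tensor_relations R S M"
    using subgroup.one_closed[OF sg] by simp
  show 2: "c + d \<in> tensor_relations R S M"
    if "c \<in> tensor_relations R S M" "d \<in> tensor_relations R S M" for c d
    using subgroup.m_closed[OF sg that] by simp
  show 3: "- c \<in> tensor_relations R S M" if "c \<in> tensor_relations R S M" for c
    using subgroup.m_inv_closed[OF sg that] 1[OF that] by simp
  show "c - d \<in> tensor_relations R S M"
    if "c \<in> tensor_relations R S M" "d \<in> tensor_relations R S M"
    using 2[OF that(1) 3[OF that(2)]] by simp
qed

lemma tensor_relations_gens:
  shows "s \<in> carrier S \<Longrightarrow> t \<in> carrier S \<Longrightarrow> x \<in> carrier M \<Longrightarrow>
      frag_of (s \<oplus>\<^bsub>S\<^esub> t, x) - frag_of (s, x) - frag_of (t, x) \<in> tensor_relations R S M"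
    and "s \<in> carrier S \<Longrightarrow> x \<in> carrier M \<Longrightarrow> y \<in> carrier M \<Longrightarrow>
      frag_of (s, x \<oplus>\<^bsub>M\<^esub> y) - frag_of (s, x) - frag_of (s, y) \<in> tensor_relations R S M"
    and "r \<in> carrier R \<Longrightarrow> s \<in> carrier S \<Longrightarrow> x \<in> carrier M \<Longrightarrow>
      frag_of (r \<odot>\<^bsub>S\<^esub> s, x) - frag_of (s, r \<odot>\<^bsub>M\<^esub> x) \<in> tensor_relations R S M"
  unfolding tensor_relations_def by (rule generate.incl, blast)+

lemma r_coset_free_Abelian_group:
  "H #>\<^bsub>free_Abelian_group Y\<^esub> c = (\<lambda>h. h + c) ` H"
  by (auto simp: r_coset_def)

lemma tensor_coset_eq_iff:
  assumes "module R S" "module R M"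
  shows "(\<lambda>h. h + c) ` tensor_relations R S M = (\<lambda>h. h + d) ` tensor_relations R S M \<longleftrightarrow>
     c - d \<in> tensor_relations R S M"
proof
  note cl = tensor_relations_closed[OF assms]
  assume eq: "(\<lambda>h. h + c) ` tensor_relations R S M = (\<lambda>h. h + d) ` tensor_relations R S M"
  have "0 + c \<in> (\<lambda>h. h + c) ` tensor_relations R S M" using cl(2) by (rule imageI)
  then obtain h where "h \<in> tensor_relations R S M" "c = h + d" using eq by auto
  then show "c - d \<in> tensor_relations R S M" by simp
next
  note cl = tensor_relations_closed[OF assms]
  assume cd: "c - d \<in> tensor_relations R S M"
  have "h + c \<in> (\<lambda>h. h + d) ` tensor_relations R S M" if "h \<in> tensor_relations R S M" for h
    using cl(3)[OF that cd] by (intro image_eqI[of _ _ "h + (c - d)"]) auto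
  moreover have "h + d \<in> (\<lambda>h. h + c) ` tensor_relations R S M" if "h \<in> tensor_relations R S M" for h
    using cl(5)[OF that cd] by (intro image_eqI[of _ _ "h - (c - d)"]) auto
  ultimately show "(\<lambda>h. h + c) ` tensor_relations R S M = (\<lambda>h. h + d) ` tensor_relations R S M"
    by blast
qed

lemma carrier_tensor:
  "carrier (tensor R S M) =
     (\<lambda>c. (\<lambda>h. h + c) ` tensor_relations R S M) ` {c. Poly_Mapping.keys c \<subseteq> carrier S \<times> carrier M}"
  by (simp add: tensor_def carrier_FactGroup r_coset_free_Abelian_group) (simp add: free_Abelian_group_def)

abbreviation frag_map_snd :: "('m \<Rightarrow> 'n) \<Rightarrow> ('s \<times> 'm \<Rightarrow>\<^sub>0 int) \<Rightarrow> ('s \<times> 'n \<Rightarrow>\<^sub>0 int)" where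
  "frag_map_snd f \<equiv> frag_extend (\<lambda>(s, x). frag_of (s, f x))"

lemma frag_map_tensor_relations:
  assumes S: "module R S" and N: "module R N"
    and f: "f \<in> module_homs R M N" and M: "module R M"
    and c: "c \<in> tensor_relations R S M"
  shows "frag_map_snd f c \<in> tensor_relations R S N"
  using c unfolding tensor_relations_def[of R S M]
proof (induction c rule: generate.induct)
  interpret S: module R S by fact
  interpret M: module R M by fact
  have fh: "f x \<in> carrier N" "f (x \<oplus>\<^bsub>M\<^esub> y) = f x \<oplus>\<^bsub>N\<^esub> f y" "r \<in> carrier R \<Longrightarrow> f (r \<odot>\<^bsub>M\<^esub> x) = r \<odot>\<^bsub>N\<^esub> f x"
    if "x \<in> carrier M" "y \<in> carrier M" for x y r
    using f that by (auto simp: module_homs_def hom_def)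
  note cl = tensor_relations_closed[OF S N]
  have *: "frag_map_snd f h \<in> tensor_relations R S N"
    "Poly_Mapping.keys h \<subseteq> carrier S \<times> carrier M"
    if "h \<in> {frag_of (s \<oplus>\<^bsub>S\<^esub> t, x) - frag_of (s, x) - frag_of (t, x) | s t x.
         s \<in> carrier S \<and> t \<in> carrier S \<and> x \<in> carrier M} \<union>
      {frag_of (s, x \<oplus>\<^bsub>M\<^esub> y) - frag_of (s, x) - frag_of (s, y) | s x y.
         s \<in> carrier S \<and> x \<in> carrier M \<and> y \<in> carrier M} \<union>
      {frag_of (r \<odot>\<^bsub>S\<^esub> s, x) - frag_of (s, r \<odot>\<^bsub>M\<^esub> x) | r s x.
         r \<in> carrier R \<and> s \<in> carrier S \<and> x \<in> carrier M}" for h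
    using that by (auto simp: frag_extend_diff fh tensor_relations_gens dest!: subsetD[OF keys_diff])
  {
    case one
    then show ?case using cl(2) by simp
  next
    case (incl h)
    then show ?case using *(1) by blast
  next
    case (inv h)
    then show ?case using * cl(4) by (simp add: frag_extend_minus)
  next
    case (eng h1 h2)
    then show ?case using cl(3) by (simp add: frag_extend_add)
  }
qed

text \<open>The cosets over which the induced map takes a union are all equal, so that it acts on
  representatives.\<close>

lemma tensor_map_coset:
  assumes S: "module R S" and N: "module R N"
    and f: "f \<in> module_homs R M N" and M: "module R M"
  shows "tensor_map R S M N f ((\<lambda>h. h + c) ` tensor_relations R S M) =
    (\<lambda>h. h + frag_map_snd f c) ` tensor_relations R S N"
proof -
  have "(\<lambda>k. k + frag_map_snd f (h + c)) ` tensor_relations R S N =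
     (\<lambda>k. k + frag_map_snd f c) ` tensor_relations R S N"
    if "h \<in> tensor_relations R S M" for h
    using that frag_map_tensor_relations[OF assms that]
    by (simp add: tensor_coset_eq_iff[OF S N] frag_extend_add)
  moreover have "tensor_relations R S M \<noteq> {}"
    using tensor_relations_closed(2)[OF S M] by blast
  ultimately show ?thesis
    unfolding tensor_map_def r_coset_free_Abelian_group by auto
qed

lemma contraction_exists:
  assumes S: "module R S" and M: "module R M" and f: "linear_form R S f"
  shows "\<exists>h. h \<in> hom (free_Abelian_group (carrier S \<times> carrier M)) (add_monoid M) \<and>
     (\<forall>s\<in>carrier S. \<forall>x\<in>carrier M. h (frag_of (s, x)) = f s \<odot>\<^bsub>M\<^esub> x)"
proof -
  interpret S: module R S by fact
  interpret M: module R M by fact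
  note f = S.linear_formD[OF f]
  obtain h where "h \<in> hom (free_Abelian_group (carrier S \<times> carrier M)) (add_monoid M)"
     "\<And>x. x \<in> carrier S \<times> carrier M \<Longrightarrow> h (frag_of x) = (\<lambda>(s, x). f s \<odot>\<^bsub>M\<^esub> x) x"
    by (rule comm_group.free_Abelian_group_universal[OF M.M.a_comm_group, of "\<lambda>(s, x). f s \<odot>\<^bsub>M\<^esub> x" "carrier S \<times> carrier M"])
       (use f in auto)
  then show ?thesis by auto
qed

text \<open>A lift to the free abelian group of the map from \<open>S \<otimes> M\<close> to \<open>M\<close> that sends \<open>s \<otimes> x\<close> to \<open>f s \<odot> x\<close>.\<close>

definition contraction ::
  "('a, 'r) ring_scheme \<Rightarrow> ('a, 's) module \<Rightarrow> ('a, 'm) module \<Rightarrow> ('s \<Rightarrow> 'a) \<Rightarrow> ('s \<times> 'm \<Rightarrow>\<^sub>0 int) \<Rightarrow> 'm"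
  where "contraction R S M f = (SOME h. h \<in> hom (free_Abelian_group (carrier S \<times> carrier M)) (add_monoid M) \<and>
     (\<forall>s\<in>carrier S. \<forall>x\<in>carrier M. h (frag_of (s, x)) = f s \<odot>\<^bsub>M\<^esub> x))"

lemma contraction:
  assumes S: "module R S" and M: "module R M" and f: "linear_form R S f"
  shows "contraction R S M f \<in> hom (free_Abelian_group (carrier S \<times> carrier M)) (add_monoid M)"
    and "s \<in> carrier S \<Longrightarrow> x \<in> carrier M \<Longrightarrow> contraction R S M f (frag_of (s, x)) = f s \<odot>\<^bsub>M\<^esub> x"
  using someI_ex[OF contraction_exists[OF assms]] unfolding contraction_def by blast+

lemma contraction_simps:
  assumes S: "module R S" and M: "module R M" and f: "linear_form R S f"
  shows "Poly_Mapping.keys c \<subseteq> carrier S \<times> carrier M \<Longrightarrow> contraction R S M f c \<in> carrier M"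
    and "contraction R S M f 0 = \<zero>\<^bsub>M\<^esub>"
    and "Poly_Mapping.keys c \<subseteq> carrier S \<times> carrier M \<Longrightarrow> Poly_Mapping.keys d \<subseteq> carrier S \<times> carrier M \<Longrightarrow>
      contraction R S M f (c - d) = contraction R S M f c \<ominus>\<^bsub>M\<^esub> contraction R S M f d"
proof -
  interpret M: module R M by fact
  interpret h: group_hom "free_Abelian_group (carrier S \<times> carrier M)" "add_monoid M" "contraction R S M f"
    using contraction(1)[OF S M f] M.M.a_group
    by (simp add: group_hom_def group_hom_axioms_def)
  show "contraction R S M f c \<in> carrier M"
    if "Poly_Mapping.keys c \<subseteq> carrier S \<times> carrier M" using h.hom_closed that by simp
  show "contraction R S M f 0 = \<zero>\<^bsub>M\<^esub>" using h.hom_one by simp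
  show "contraction R S M f (c - d) = contraction R S M f c \<ominus>\<^bsub>M\<^esub> contraction R S M f d"
    if "Poly_Mapping.keys c \<subseteq> carrier S \<times> carrier M" "Poly_Mapping.keys d \<subseteq> carrier S \<times> carrier M"
    using h.hom_mult[of c "- d"] h.hom_inv[of d] that
    by (simp add: a_minus_def a_inv_def)
qed

lemma contraction_tensor_relations:
  assumes S: "module R S" and M: "module R M" and f: "linear_form R S f"
    and c: "c \<in> tensor_relations R S M"
  shows "contraction R S M f c = \<zero>\<^bsub>M\<^esub>"
proof -
  interpret S: module R S by fact
  interpret M: module R M by fact
  interpret h: group_hom "free_Abelian_group (carrier S \<times> carrier M)" "add_monoid M" "contraction R S M f"
    using contraction(1)[OF S M f] M.M.a_group
    by (simp add: group_hom_def group_hom_axioms_def)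
  note lf = S.linear_formD[OF f] and sim = contraction_simps[OF S M f] contraction(2)[OF S M f]
  have cancel: "u \<oplus>\<^bsub>M\<^esub> v \<ominus>\<^bsub>M\<^esub> u \<ominus>\<^bsub>M\<^esub> v = \<zero>\<^bsub>M\<^esub>" if "u \<in> carrier M" "v \<in> carrier M" for u v
  proof -
    have "u \<oplus>\<^bsub>M\<^esub> v \<ominus>\<^bsub>M\<^esub> u \<ominus>\<^bsub>M\<^esub> v = (u \<oplus>\<^bsub>M\<^esub> \<ominus>\<^bsub>M\<^esub> u) \<oplus>\<^bsub>M\<^esub> (v \<oplus>\<^bsub>M\<^esub> \<ominus>\<^bsub>M\<^esub> v)"
      using that by (simp add: M.M.minus_eq M.M.a_ac)
    then show ?thesis using that by (simp add: M.M.r_neg)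
  qed
  have "tensor_relations R S M \<subseteq> kernel (free_Abelian_group (carrier S \<times> carrier M)) (add_monoid M) (contraction R S M f)"
    unfolding tensor_relations_def
  proof (rule group.generate_subgroup_incl[OF group_free_Abelian_group _ h.subgroup_kernel], safe)
    fix s t x assume a: "s \<in> carrier S" "t \<in> carrier S" "x \<in> carrier M"
    then have k: "Poly_Mapping.keys (frag_of (s \<oplus>\<^bsub>S\<^esub> t, x) - frag_of (s, x) - frag_of (t, x)) \<subseteq> carrier S \<times> carrier M"
      "Poly_Mapping.keys (frag_of (s \<oplus>\<^bsub>S\<^esub> t, x) - frag_of (s, x)) \<subseteq> carrier S \<times> carrier M"
      by (auto dest!: subsetD[OF keys_diff])
    show "frag_of (s \<oplus>\<^bsub>S\<^esub> t, x) - frag_of (s, x) - frag_of (t, x) \<in>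
       kernel (free_Abelian_group (carrier S \<times> carrier M)) (add_monoid M) (contraction R S M f)"
      using a k by (simp add: kernel_def sim lf M.smult_l_distr cancel)
  next
    fix s x y assume a: "s \<in> carrier S" "x \<in> carrier M" "y \<in> carrier M"
    then have k: "Poly_Mapping.keys (frag_of (s, x \<oplus>\<^bsub>M\<^esub> y) - frag_of (s, x) - frag_of (s, y)) \<subseteq> carrier S \<times> carrier M"
      "Poly_Mapping.keys (frag_of (s, x \<oplus>\<^bsub>M\<^esub> y) - frag_of (s, x)) \<subseteq> carrier S \<times> carrier M"
      by (auto dest!: subsetD[OF keys_diff])
    show "frag_of (s, x \<oplus>\<^bsub>M\<^esub> y) - frag_of (s, x) - frag_of (s, y) \<in>
       kernel (free_Abelian_group (carrier S \<times> carrier M)) (add_monoid M) (contraction R S M f)"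
      using a k by (simp add: kernel_def sim lf M.smult_r_distr cancel)
  next
    fix r s x assume a: "r \<in> carrier R" "s \<in> carrier S" "x \<in> carrier M"
    then have k: "Poly_Mapping.keys (frag_of (r \<odot>\<^bsub>S\<^esub> s, x) - frag_of (s, r \<odot>\<^bsub>M\<^esub> x)) \<subseteq> carrier S \<times> carrier M"
      by (auto dest!: subsetD[OF keys_diff])
    have "f (r \<odot>\<^bsub>S\<^esub> s) \<odot>\<^bsub>M\<^esub> x = f s \<odot>\<^bsub>M\<^esub> (r \<odot>\<^bsub>M\<^esub> x)"
      using a by (simp add: lf M.smult_assoc1[symmetric] S.R.m_comm)
    then show "frag_of (r \<odot>\<^bsub>S\<^esub> s, x) - frag_of (s, r \<odot>\<^bsub>M\<^esub> x) \<in>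
       kernel (free_Abelian_group (carrier S \<times> carrier M)) (add_monoid M) (contraction R S M f)"
      using a k by (simp add: kernel_def sim lf M.M.minus_eq M.M.r_neg)
  qed
  then show ?thesis using c by (auto simp: kernel_def)
qed

text \<open>In the tensor product, \<open>(f(-) e \<otimes> id) z = e \<otimes> (f \<otimes> id) z\<close>; the statement is this identity for the
  summand that leads from \<open>p\<close> to \<open>q\<close>, read modulo the relations.\<close>

lemma frag_of_contraction:
  assumes S: "module R S" and M: "module R M" and f: "linear_form R S f" and e: "e \<in> carrier S"
    and p: "finite_rank R S p"
    and q: "\<And>x. x \<in> carrier S \<Longrightarrow> q x = p x \<oplus>\<^bsub>S\<^esub> f x \<odot>\<^bsub>S\<^esub> e"
    and c: "Poly_Mapping.keys c \<subseteq> carrier S \<times> carrier M"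
  shows "frag_extend (\<lambda>(s, x). frag_of (q s, x)) c - frag_extend (\<lambda>(s, x). frag_of (p s, x)) c
     - frag_of (e, contraction R S M f c) \<in> tensor_relations R S M"
proof -
  interpret S: module R S by fact
  interpret M: module R M by fact
  note cl = tensor_relations_closed[OF S M]
  note lf = S.linear_formD[OF f] and sim = contraction_simps[OF S M f] contraction(2)[OF S M f]
  note lin = S.finite_rank_linear[OF p]
  have e0: "frag_of (e, \<zero>\<^bsub>M\<^esub>) \<in> tensor_relations R S M"
    using cl(4)[OF tensor_relations_gens(2)[OF e, of "\<zero>\<^bsub>M\<^esub>" M "\<zero>\<^bsub>M\<^esub>" R]] by simp
  show ?thesis using c
  proof (induction c rule: frag_on_induct)
    case zero
    then show ?case using e0 cl(4) by (simp add: sim(2))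
  next
    case (diff c d)
    let ?u = "contraction R S M f c" and ?v = "contraction R S M f d"
    have uv: "?u \<in> carrier M" "?v \<in> carrier M" using sim(1) diff by auto
    have "frag_of (e, (?u \<ominus>\<^bsub>M\<^esub> ?v) \<oplus>\<^bsub>M\<^esub> ?v) - frag_of (e, ?u \<ominus>\<^bsub>M\<^esub> ?v) - frag_of (e, ?v) \<in> tensor_relations R S M"
      using uv e by (intro tensor_relations_gens) auto
    moreover have "(?u \<ominus>\<^bsub>M\<^esub> ?v) \<oplus>\<^bsub>M\<^esub> ?v = ?u" using uv by (simp add: M.M.minus_eq M.M.a_assoc M.M.l_neg)
    ultimately have "frag_of (e, ?u) - frag_of (e, ?u \<ominus>\<^bsub>M\<^esub> ?v) - frag_of (e, ?v) \<in> tensor_relations R S M" by simp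
    from cl(3)[OF cl(5)[OF diff(3,4)] this] show ?case
      using diff(1,2) by (simp add: sim frag_extend_diff algebra_simps)
  next
    case (of a)
    obtain s x where a: "a = (s, x)" "s \<in> carrier S" "x \<in> carrier M" using of by auto
    have "frag_of (p s \<oplus>\<^bsub>S\<^esub> f s \<odot>\<^bsub>S\<^esub> e, x) - frag_of (p s, x) - frag_of (f s \<odot>\<^bsub>S\<^esub> e, x) \<in> tensor_relations R S M"
      using a lin lf e by (intro tensor_relations_gens) auto
    moreover have "frag_of (f s \<odot>\<^bsub>S\<^esub> e, x) - frag_of (e, f s \<odot>\<^bsub>M\<^esub> x) \<in> tensor_relations R S M"
      using a lf e by (intro tensor_relations_gens) auto
    ultimately have "(frag_of (p s \<oplus>\<^bsub>S\<^esub> f s \<odot>\<^bsub>S\<^esub> e, x) - frag_of (p s, x) - frag_of (f s \<odot>\<^bsub>S\<^esub> e, x))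
      + (frag_of (f s \<odot>\<^bsub>S\<^esub> e, x) - frag_of (e, f s \<odot>\<^bsub>M\<^esub> x)) \<in> tensor_relations R S M"
      by (rule cl(3))
    then show ?case using a q by (simp add: sim)
  qed
qed

text \<open>By the preceding identity, an operator of finite rank maps \<open>z\<close> to a sum of tensors \<open>e \<otimes> y\<close>, where \<open>y\<close> runs
  through contractions of \<open>z\<close>.\<close>

lemma finite_rank_tensor:
  assumes S: "module R S" and M: "module R M" and p: "finite_rank R S p"
    and c: "Poly_Mapping.keys c \<subseteq> carrier S \<times> carrier M"
    and N: "\<And>f. linear_form R S f \<Longrightarrow> contraction R S M f c \<in> N"
  shows "\<exists>d. Poly_Mapping.keys d \<subseteq> carrier S \<times> N \<and>
     frag_extend (\<lambda>(s, x). frag_of (p s, x)) c - d \<in> tensor_relations R S M"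
proof -
  interpret S: module R S by fact
  note cl = tensor_relations_closed[OF S M]
  show ?thesis using p
  proof induction
    case (zero p)
    have "frag_extend (\<lambda>(s, x). frag_of (p s, x)) c \<in> tensor_relations R S M"
      using c
    proof (induction c rule: frag_on_induct)
      case zero
      then show ?case using cl(2) by simp
    next
      case (diff c d)
      then show ?case using cl(5) by (simp add: frag_extend_diff)
    next
      case (of a)
      then obtain s x where a: "a = (s, x)" "s \<in> carrier S" "x \<in> carrier M" by auto
      show ?case
        using cl(4)[OF tensor_relations_gens(1)[of "\<zero>\<^bsub>S\<^esub>" S "\<zero>\<^bsub>S\<^esub>", OF _ _ a(3)]] a zero by simp
    qed
    then show ?case by (intro exI[of _ 0]) simp
  next
    case (step p f e q)
    then obtain d where d: "Poly_Mapping.keys d \<subseteq> carrier S \<times> N"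
       "frag_extend (\<lambda>(s, x). frag_of (p s, x)) c - d \<in> tensor_relations R S M" by blast
    let ?d = "d + frag_of (e, contraction R S M f c)"
    have "Poly_Mapping.keys ?d \<subseteq> carrier S \<times> N"
      using d(1) step.hyps(3) N[OF step.hyps(2)] by (auto dest!: subsetD[OF keys_add])
    moreover have "frag_extend (\<lambda>(s, x). frag_of (q s, x)) c - ?d \<in> tensor_relations R S M"
      using cl(3)[OF frag_of_contraction[OF S M step.hyps(2,3,1,4) c] d(2)]
      by (simp add: algebra_simps)
    ultimately show ?case by blast
  qed
qed

text \<open>An element of the tensor product involves finitely many elements of \<open>S\<close>, so that some operator of
  finite rank leaves it unchanged. Hence it is determined by its contractions, and it comes from
  \<open>S \<otimes> N\<close> as soon as they are in \<open>N\<close>.\<close>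

lemma tensor_in_submodule_if_contractions:
  assumes S: "locally_projective R S" and M: "module R M"
    and c: "Poly_Mapping.keys c \<subseteq> carrier S \<times> carrier M"
    and N: "\<And>f. linear_form R S f \<Longrightarrow> contraction R S M f c \<in> N"
  shows "\<exists>d. Poly_Mapping.keys d \<subseteq> carrier S \<times> N \<and> c - d \<in> tensor_relations R S M"
proof -
  have S': "module R S" using S by (simp add: locally_projective_def)
  have "fst ` Poly_Mapping.keys c \<subseteq> carrier S" using c by auto
  then obtain p where p: "finite_rank R S p" "\<forall>x \<in> fst ` Poly_Mapping.keys c. p x = x"
    using module.locally_projective_fixes_finite[OF S' S finite_imageI[OF finite_keys]] by blast
  have "frag_extend (\<lambda>(s, x). frag_of (p s, x)) c = frag_extend frag_of c"
    by (rule frag_extend_eq) (use p(2) in auto)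
  then have "frag_extend (\<lambda>(s, x). frag_of (p s, x)) c = c"
    using frag_expansion[of c] by simp
  with finite_rank_tensor[OF S' M p(1) c N] show ?thesis by simp
qed

text \<open>Contractions are natural in the second factor. If an injective map kills an element, it kills all
  its contractions, which therefore vanish, and then the element itself vanishes.\<close>

theorem locally_projective_imp_flat:
  assumes S: "locally_projective R S"
  shows "flat_module TYPE('m) R S"
  unfolding flat_module_def
proof (intro conjI allI impI)
  show S': "module R S" using S by (simp add: locally_projective_def)
  fix M N :: "('a, 'm) module" and g
  assume "module R M \<and> module R N \<and> g \<in> module_homs R M N \<and> inj_on g (carrier M)"
  then have M: "module R M" and N: "module R N" and g: "g \<in> module_homs R M N"
    and inj: "inj_on g (carrier M)" by auto
  interpret S: module R S by fact
  interpret M: module R M by fact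
  interpret N: module R N by fact
  interpret g: group_hom "add_monoid M" "add_monoid N" g
    using g M.M.a_group N.M.a_group by (simp add: module_homs_def group_hom_def group_hom_axioms_def)
  have nat: "contraction R S N f (frag_map_snd g c) = g (contraction R S M f c) \<and>
      Poly_Mapping.keys (frag_map_snd g c) \<subseteq> carrier S \<times> carrier N"
    if f: "linear_form R S f" and c: "Poly_Mapping.keys c \<subseteq> carrier S \<times> carrier M" for f c
    using c
  proof (induction c rule: frag_on_induct)
    case zero
    then show ?case using contraction_simps(2)[OF S' M f] contraction_simps(2)[OF S' N f] g.hom_one by simp
  next
    case (diff c d)
    have "g (contraction R S M f c \<ominus>\<^bsub>M\<^esub> contraction R S M f d) =
      g (contraction R S M f c) \<ominus>\<^bsub>N\<^esub> g (contraction R S M f d)"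
      using contraction_simps(1)[OF S' M f diff(1)] contraction_simps(1)[OF S' M f diff(2)]
        g.hom_mult g.hom_inv by (simp add: a_minus_def a_inv_def[symmetric])
    then show ?case
      using diff contraction_simps(3)[OF S' M f diff(1,2)] contraction_simps(3)[OF S' N f]
      by (auto simp: frag_extend_diff dest!: subsetD[OF keys_diff])
  next
    case (of a)
    then show ?case
      using g g.hom_closed S.linear_formD[OF f]
      by (auto simp: contraction(2)[OF S' M f] contraction(2)[OF S' N f] module_homs_def)
  qed
  have key: "c \<in> tensor_relations R S M"
    if c: "Poly_Mapping.keys c \<subseteq> carrier S \<times> carrier M" and gc: "frag_map_snd g c \<in> tensor_relations R S N" for c
  proof -
    note cl = tensor_relations_closed[OF S' M]
    have "contraction R S M f c \<in> {\<zero>\<^bsub>M\<^esub>}" if f: "linear_form R S f" for f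
    proof -
      have "g (contraction R S M f c) = g \<zero>\<^bsub>M\<^esub>"
        using nat[OF f c] contraction_tensor_relations[OF S' N f gc] g.hom_one by simp
      then show ?thesis using inj contraction_simps(1)[OF S' M f c] by (auto simp: inj_on_def)
    qed
    then obtain d where d: "Poly_Mapping.keys d \<subseteq> carrier S \<times> {\<zero>\<^bsub>M\<^esub>}" "c - d \<in> tensor_relations R S M"
      using tensor_in_submodule_if_contractions[OF S M c] by blast
    from d(1) have "d \<in> tensor_relations R S M"
    proof (induction d rule: frag_on_induct)
      case (of a)
      then obtain s where "a = (s, \<zero>\<^bsub>M\<^esub>)" "s \<in> carrier S" by auto
      then show ?case
        using cl(4)[OF tensor_relations_gens(2)[of s S "\<zero>\<^bsub>M\<^esub>" M "\<zero>\<^bsub>M\<^esub>" R]] by simp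
    qed (use cl in auto)
    then show ?thesis using cl(3)[OF d(2), of d] by simp
  qed
  show "inj_on (tensor_map R S M N g) (carrier (tensor R S M))"
  proof (rule inj_onI)
    fix Z1 Z2 assume Z: "Z1 \<in> carrier (tensor R S M)" "Z2 \<in> carrier (tensor R S M)"
      and eq: "tensor_map R S M N g Z1 = tensor_map R S M N g Z2"
    then obtain c d where c: "Poly_Mapping.keys c \<subseteq> carrier S \<times> carrier M" "Z1 = (\<lambda>h. h + c) ` tensor_relations R S M"
      and d: "Poly_Mapping.keys d \<subseteq> carrier S \<times> carrier M" "Z2 = (\<lambda>h. h + d) ` tensor_relations R S M"
      unfolding carrier_tensor by auto
    have "frag_map_snd g (c - d) \<in> tensor_relations R S N"
      using eq unfolding c d tensor_map_coset[OF S' N g M] tensor_coset_eq_iff[OF S' N]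
      by (simp add: frag_extend_diff)
    moreover have "Poly_Mapping.keys (c - d) \<subseteq> carrier S \<times> carrier M"
      using c d by (auto dest!: subsetD[OF keys_diff])
    ultimately show "Z1 = Z2" using key unfolding c d tensor_coset_eq_iff[OF S' M] by blast
  qed
qed

lemma tensor_submodule_eq:
  fixes S :: "('a, 's) module" and M :: "('a, 'm) module"
  assumes S: "module R S" and M: "module R M" and N: "submodule N R M"
  shows "tensor_submodule R S M N =
    (\<lambda>c. (\<lambda>h. h + c) ` tensor_relations R S M) ` {c. Poly_Mapping.keys c \<subseteq> carrier S \<times> N}"
proof -
  have N': "module R (M\<lparr>carrier := N\<rparr>)"
    using submodule.submodule_is_module[OF N M] .
  have NM: "N \<subseteq> carrier M" using module.submoduleE(1)[OF M N] .
  have id: "(\<lambda>x. x) \<in> module_homs R (M\<lparr>carrier := N\<rparr>) M"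
    using NM by (auto simp: module_homs_def hom_def)
  have eta: "(\<lambda>(s, x). frag_of (s, x)) = (frag_of :: 's \<times> 'm \<Rightarrow> _)" by auto
  have "frag_map_snd (\<lambda>x. x) c = c" for c :: "'s \<times> 'm \<Rightarrow>\<^sub>0 int"
    unfolding eta by (rule frag_expansion[symmetric])
  then show ?thesis
    unfolding tensor_submodule_def carrier_tensor image_image
    by (simp add: tensor_map_coset[OF S M id N'])
qed

text \<open>Contractions of an element of \<open>S \<otimes> N\<close> are in \<open>N\<close>. An element that comes from \<open>S \<otimes> N\<close> for each \<open>N\<close> of
  the family has all its contractions in the intersection.\<close>

theorem locally_projective_imp_intersection_flat:
  assumes S: "locally_projective R S"
  shows "intersection_flat TYPE('m) R S"
  unfolding intersection_flat_def
proof (intro conjI allI impI)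
  show "flat_module TYPE('m) R S" by (rule locally_projective_imp_flat[OF S])
  have S': "module R S" using S by (simp add: locally_projective_def)
  fix M :: "('a, 'm) module" and \<N>
  assume "module R M \<and> finitely_generated R M \<and> (\<forall>N\<in>\<N>. submodule N R M)"
  then have M: "module R M" and N: "\<And>N. N \<in> \<N> \<Longrightarrow> submodule N R M" by auto
  interpret S: module R S by fact
  interpret M: module R M by fact
  note cl = tensor_relations_closed[OF S' M]
  let ?I = "carrier M \<inter> \<Inter>\<N>"
  have I: "submodule ?I R M"
    by (rule M.submoduleI) (use M.submoduleE[OF N] subgroup.one_closed[OF submodule.axioms(1)[OF N]] in auto)
  have "c \<in> Z"
    if Z: "c \<in> tensor_submodule R S M ?I" "Z = tensor_submodule R S M N" "N \<in> \<N>" for c Z N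
    using Z tensor_submodule_eq[OF S' M I] tensor_submodule_eq[OF S' M N[OF Z(3)]] by fastforce
  moreover have "c \<in> carrier (tensor R S M)" if "c \<in> tensor_submodule R S M ?I" for c
    using that tensor_submodule_eq[OF S' M I] unfolding carrier_tensor by fastforce
  moreover have "Z \<in> tensor_submodule R S M ?I"
    if Z: "Z \<in> carrier (tensor R S M)" "\<And>N. N \<in> \<N> \<Longrightarrow> Z \<in> tensor_submodule R S M N" for Z
  proof -
    obtain c where c: "Poly_Mapping.keys c \<subseteq> carrier S \<times> carrier M" "Z = (\<lambda>h. h + c) ` tensor_relations R S M"
      using Z unfolding carrier_tensor by auto
    have "contraction R S M f c \<in> ?I" if f: "linear_form R S f" for f
    proof (intro IntI InterI)
      show "contraction R S M f c \<in> carrier M" using contraction_simps(1)[OF S' M f c(1)] .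
      fix N assume N1: "N \<in> \<N>"
      note NE = M.submoduleE[OF N[OF N1]]
      obtain d where d: "Poly_Mapping.keys d \<subseteq> carrier S \<times> N" "Z = (\<lambda>h. h + d) ` tensor_relations R S M"
        using Z(2)[OF N1] tensor_submodule_eq[OF S' M N[OF N1]] by auto
      have cd: "c - d \<in> tensor_relations R S M" using c d tensor_coset_eq_iff[OF S' M] by metis
      have d': "Poly_Mapping.keys d \<subseteq> carrier S \<times> carrier M" using d NE(1) by blast
      have "contraction R S M f c \<ominus>\<^bsub>M\<^esub> contraction R S M f d = \<zero>\<^bsub>M\<^esub>"
        using contraction_tensor_relations[OF S' M f cd] contraction_simps(3)[OF S' M f c(1) d'] by simp
      moreover have "contraction R S M f c =
          (contraction R S M f c \<ominus>\<^bsub>M\<^esub> contraction R S M f d) \<oplus>\<^bsub>M\<^esub> contraction R S M f d"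
        using contraction_simps(1)[OF S' M f] c(1) d' by (simp add: M.M.minus_eq M.M.a_assoc M.M.l_neg)
      ultimately have "contraction R S M f c = contraction R S M f d"
        using contraction_simps(1)[OF S' M f] d' by simp
      moreover from d(1) have "Poly_Mapping.keys d \<subseteq> carrier S \<times> carrier M \<and> contraction R S M f d \<in> N"
      proof (induction d rule: frag_on_induct)
        case zero
        then show ?case using contraction_simps(2)[OF S' M f]
          subgroup.one_closed[OF submodule.axioms(1)[OF N[OF N1]]] by simp
      next
        case (diff x y)
        then show ?case using contraction_simps(3)[OF S' M f, of x y] NE
          by (auto simp: a_minus_def dest!: subsetD[OF keys_diff])
      next
        case (of a)
        then show ?case using NE(1,4) S.linear_formD[OF f]
          by (auto simp: contraction(2)[OF S' M f] subset_iff)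
      qed
      ultimately show "contraction R S M f c \<in> N" by simp
    qed
    then obtain d where "Poly_Mapping.keys d \<subseteq> carrier S \<times> ?I" "c - d \<in> tensor_relations R S M"
      using tensor_in_submodule_if_contractions[OF S M c(1)] by blast
    then show ?thesis
      using tensor_coset_eq_iff[OF S' M] unfolding tensor_submodule_eq[OF S' M I] c(2) by blast
  qed
  ultimately show "tensor_submodule R S M ?I =
      carrier (tensor R S M) \<inter> (\<Inter>N\<in>\<N>. tensor_submodule R S M N)"
    by blast
qed

text \<open>A linear form maps \<open>I S\<close> to \<open>I\<close>, so that \<open>f x\<close> is in the content of \<open>x\<close> for every linear form \<open>f\<close>.\<close>

theorem locally_projective_imp_ohm_rush:
  assumes S: "locally_projective R S"
  shows "ohm_rush R S"
  unfolding ohm_rush_def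
proof (intro conjI ballI)
  show S': "module R S" using S by (simp add: locally_projective_def)
  interpret S: module R S by fact
  fix x assume x: "x \<in> carrier S"
  then obtain p where p: "finite_rank R S p" "p x = x"
    using S unfolding locally_projective_def by blast
  have in_content: "f x \<in> content_ideal R S x" if f: "linear_form R S f" for f
    unfolding content_ideal_def
  proof (intro InterI, safe)
    fix I assume I: "ideal I R" and "x \<in> ideal_smult I S"
    interpret I: ideal I R by fact
    note lf = S.linear_formD[OF f]
    let ?g = "{a \<odot>\<^bsub>S\<^esub> s | a s. a \<in> I \<and> s \<in> carrier S}"
    have g: "g \<in> carrier S \<and> f g \<in> I \<and> f (\<ominus>\<^bsub>S\<^esub> g) \<in> I" if gg: "g \<in> ?g" for g
    proof -
      obtain a s where as: "g = a \<odot>\<^bsub>S\<^esub> s" "a \<in> I" "s \<in> carrier S" using gg by blast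
      then have "a \<in> carrier R" using I.Icarr by blast
      moreover have "\<ominus>\<^bsub>S\<^esub> g = (\<ominus>\<^bsub>R\<^esub> a) \<odot>\<^bsub>S\<^esub> s" using as calculation by (simp add: S.smult_l_minus)
      ultimately show ?thesis using as lf I.I_r_closed by (simp add: I.a_inv_closed)
    qed
    from \<open>x \<in> ideal_smult I S\<close> have "x \<in> carrier S \<and> f x \<in> I"
      unfolding ideal_smult_def
    proof (induction x rule: generate.induct)
      case one
      then show ?case using lf(3)[of "\<zero>\<^bsub>R\<^esub>" "\<zero>\<^bsub>S\<^esub>"] lf(1)[of "\<zero>\<^bsub>S\<^esub>"] by simp
    next
      case (incl h)
      then show ?case using g by blast
    next
      case (inv h)
      then show ?case using g[of h] by (simp add: a_inv_def[symmetric])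
    next
      case (eng h1 h2)
      then show ?case using lf(2) I.a_closed by simp
    qed
    then show "f x \<in> I" by simp
  qed
  have "p x \<in> ideal_smult (content_ideal R S x) S"
    using p(1)
  proof induction
    case (zero p)
    then show ?case using x generate.one[of "add_monoid S"] by (simp add: ideal_smult_def)
  next
    case (step p f e q)
    have "f x \<odot>\<^bsub>S\<^esub> e \<in> ideal_smult (content_ideal R S x) S"
      unfolding ideal_smult_def using in_content[OF step.hyps(2)] step.hyps(3)
      by (intro generate.incl) blast
    with step.IH have "p x \<oplus>\<^bsub>S\<^esub> f x \<odot>\<^bsub>S\<^esub> e \<in> ideal_smult (content_ideal R S x) S"
      unfolding ideal_smult_def using generate.eng[of "p x" "add_monoid S"] by simp
    then show ?case using step.hyps(4)[OF x] by simp
  qed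
  then show "x \<in> ideal_smult (content_ideal R S x) S" using p(2) by simp
qed

section \<open>Submodules over a subring\<close>

context cring
begin

text \<open>All modules below live in one ambient ring, over a subring \<open>A\<close>: a submodule contained in \<open>A\<close> is an ideal
  of \<open>A\<close>, and fractional ideals and subalgebras are submodules too.\<close>

definition lin_sub :: "'a set \<Rightarrow> 'a set \<Rightarrow> bool" where
  "lin_sub A V \<longleftrightarrow> V \<subseteq> carrier R \<and> \<zero> \<in> V \<and> (\<forall>u\<in>V. \<forall>v\<in>V. u \<oplus> v \<in> V) \<and>
     (\<forall>r\<in>A. \<forall>v\<in>V. r \<otimes> v \<in> V)"

inductive_set lin_span :: "'a set \<Rightarrow> 'a set \<Rightarrow> 'a set" for A B where
  zero: "\<zero> \<in> lin_span A B"
| add: "\<lbrakk>r \<in> A; b \<in> B; v \<in> lin_span A B\<rbrakk> \<Longrightarrow> r \<otimes> b \<oplus> v \<in> lin_span A B"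

definition fin_gen :: "'a set \<Rightarrow> 'a set \<Rightarrow> bool" where
  "fin_gen A V \<longleftrightarrow> (\<exists>B\<subseteq>V. finite B \<and> V = lin_span A B)"

lemma lin_subI:
  assumes "V \<subseteq> carrier R" "\<zero> \<in> V" "\<And>u v. u \<in> V \<Longrightarrow> v \<in> V \<Longrightarrow> u \<oplus> v \<in> V"
    "\<And>r v. r \<in> A \<Longrightarrow> v \<in> V \<Longrightarrow> r \<otimes> v \<in> V"
  shows "lin_sub A V"
  using assms by (auto simp: lin_sub_def)

lemma lin_subD:
  assumes "lin_sub A V"
  shows "V \<subseteq> carrier R" "\<zero> \<in> V" "u \<in> V \<Longrightarrow> v \<in> V \<Longrightarrow> u \<oplus> v \<in> V"
    "r \<in> A \<Longrightarrow> v \<in> V \<Longrightarrow> r \<otimes> v \<in> V"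
  using assms by (auto simp: lin_sub_def)

lemma lin_sub_minus:
  assumes A: "subring A R" and V: "lin_sub A V"
  shows "v \<in> V \<Longrightarrow> \<ominus> v \<in> V" "u \<in> V \<Longrightarrow> v \<in> V \<Longrightarrow> u \<ominus> v \<in> V"
proof -
  have 1: "\<ominus> v \<in> V" if "v \<in> V" for v
  proof -
    have "\<ominus> \<one> \<otimes> v \<in> V" using lin_subD(4)[OF V _ that] subringE(3,5)[OF A] by blast
    moreover have "v \<in> carrier R" using lin_subD(1)[OF V] that by blast
    ultimately show ?thesis by (simp add: l_minus)
  qed
  then show "v \<in> V \<Longrightarrow> \<ominus> v \<in> V" .
  show "u \<in> V \<Longrightarrow> v \<in> V \<Longrightarrow> u \<ominus> v \<in> V" using 1 lin_subD(3)[OF V] by (simp add: minus_eq)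
qed

lemma lin_span_carrier:
  assumes "A \<subseteq> carrier R" "B \<subseteq> carrier R"
  shows "lin_span A B \<subseteq> carrier R"
proof
  fix x assume "x \<in> lin_span A B"
  then show "x \<in> carrier R" by induction (use assms in auto)
qed

lemma lin_sub_lin_span:
  assumes A: "subring A R" and B: "B \<subseteq> carrier R"
  shows "lin_sub A (lin_span A B)"
proof (rule lin_subI)
  note Ac = subringE(1)[OF A]
  show c: "lin_span A B \<subseteq> carrier R" by (rule lin_span_carrier[OF Ac B])
  show "\<zero> \<in> lin_span A B" by (rule lin_span.zero)
  show "u \<oplus> v \<in> lin_span A B" if "u \<in> lin_span A B" "v \<in> lin_span A B" for u v
    using that(1)
  proof induction
    case zero
    then show ?case using that(2) c by auto
  next
    case (add r b w)
    then have "r \<in> carrier R" "b \<in> carrier R" "w \<in> carrier R" "v \<in> carrier R" using Ac B c that by auto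
    then show ?case using lin_span.add[OF add.hyps(1,2) add.IH] by (simp add: a_assoc)
  qed
  show "s \<otimes> v \<in> lin_span A B" if "s \<in> A" "v \<in> lin_span A B" for s v
    using that(2)
  proof induction
    case zero
    then show ?case using that(1) Ac lin_span.zero by auto
  next
    case (add r b w)
    then have "r \<in> carrier R" "b \<in> carrier R" "w \<in> carrier R" "s \<in> carrier R" using Ac B c that by auto
    then show ?case using lin_span.add[OF subringE(6)[OF A that(1) add.hyps(1)] add.hyps(2) add.IH]
      by (simp add: r_distr m_assoc)
  qed
qed

lemma lin_span_base:
  assumes A: "subring A R" and B: "B \<subseteq> carrier R" and b: "b \<in> B"
  shows "b \<in> lin_span A B"
  using lin_span.add[OF subringE(3)[OF A] b lin_span.zero] b B by auto

lemma lin_span_least: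
  assumes "lin_sub A V" "B \<subseteq> V"
  shows "lin_span A B \<subseteq> V"
proof
  fix x assume "x \<in> lin_span A B"
  then show "x \<in> V" by induction (use lin_subD[OF assms(1)] assms(2) in auto)
qed

lemma lin_span_mono: "B \<subseteq> C \<Longrightarrow> lin_span A B \<subseteq> lin_span A C"
proof
  fix x assume "B \<subseteq> C" "x \<in> lin_span A B"
  from this(2,1) show "x \<in> lin_span A C" by induction (auto intro: lin_span.intros)
qed

lemma lin_span_empty: "lin_span A {} = {\<zero>}"
proof -
  have "x = \<zero>" if "x \<in> lin_span A {}" for x using that by induction auto
  then show ?thesis using lin_span.zero by blast
qed

lemma lin_span_insertE:
  assumes A: "subring A R" and B: "B \<subseteq> carrier R" and b: "b \<in> carrier R"
    and x: "x \<in> lin_span A (insert b B)"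
  obtains r v where "r \<in> A" "v \<in> lin_span A B" "x = r \<otimes> b \<oplus> v"
proof -
  note Ac = subringE(1)[OF A] and S = lin_sub_lin_span[OF A B]
  let ?V = "{r \<otimes> b \<oplus> v | r v. r \<in> A \<and> v \<in> lin_span A B}"
  have "lin_sub A ?V"
  proof (rule lin_subI)
    show "?V \<subseteq> carrier R" using Ac lin_subD(1)[OF S] b by auto
    show "\<zero> \<in> ?V" using subringE(2)[OF A] lin_subD(2)[OF S] b by force
    fix u v assume "u \<in> ?V" "v \<in> ?V"
    then obtain r s w z where *: "r \<in> A" "s \<in> A" "w \<in> lin_span A B" "z \<in> lin_span A B"
      "u = r \<otimes> b \<oplus> w" "v = s \<otimes> b \<oplus> z" by blast
    then have c: "r \<in> carrier R" "s \<in> carrier R" "w \<in> carrier R" "z \<in> carrier R"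
      using Ac lin_subD(1)[OF S] by auto
    have "u \<oplus> v = (r \<oplus> s) \<otimes> b \<oplus> (w \<oplus> z)" using c b *(5,6) by (simp add: l_distr a_ac)
    then show "u \<oplus> v \<in> ?V" using subringE(7)[OF A *(1,2)] lin_subD(3)[OF S *(3,4)] by blast
  next
    fix s u assume s: "s \<in> A" and "u \<in> ?V"
    then obtain r w where *: "r \<in> A" "w \<in> lin_span A B" "u = r \<otimes> b \<oplus> w" by blast
    then have c: "r \<in> carrier R" "s \<in> carrier R" "w \<in> carrier R"
      using Ac s lin_subD(1)[OF S] by auto
    have "s \<otimes> u = (s \<otimes> r) \<otimes> b \<oplus> s \<otimes> w" using c b *(3) by (simp add: r_distr m_assoc)
    then show "s \<otimes> u \<in> ?V" using subringE(6)[OF A s *(1)] lin_subD(4)[OF S s *(2)] by blast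
  qed
  moreover have "insert b B \<subseteq> ?V"
  proof
    fix c assume c: "c \<in> insert b B"
    show "c \<in> ?V"
    proof (cases "c = b")
      case True
      then have "c = \<one> \<otimes> b \<oplus> \<zero>" using b by simp
      then show ?thesis using subringE(3)[OF A] lin_span.zero by blast
    next
      case False
      then have "c \<in> lin_span A B" "c \<in> carrier R" using c lin_span_base[OF A B] B by auto
      moreover from this have "c = \<zero> \<otimes> b \<oplus> c" using b by simp
      ultimately show ?thesis using subringE(2)[OF A] by blast
    qed
  qed
  ultimately have "x \<in> ?V" using lin_span_least x by blast
  then show thesis using that by blast
qed

lemma lin_span_insertI:
  assumes A: "subring A R" and B: "B \<subseteq> carrier R" and b: "b \<in> carrier R"
    and "r \<in> A" "v \<in> lin_span A B"
  shows "r \<otimes> b \<oplus> v \<in> lin_span A (insert b B)"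
  using lin_span.add[OF assms(4), of b "insert b B" v] lin_span_mono[of B "insert b B" A] assms(5) by blast

text \<open>The inductive step common to both finiteness results that follow. Here \<open>\<rho>\<close> is a linear relation
  between \<open>V\<close> and \<open>A\<close>: its image in \<open>A\<close> is an ideal, and lifts of generators of that ideal together
  with generators of the kernel generate \<open>V\<close>. A relation is used instead of a map because the
  coefficient of an element at one generator of a module is not unique.\<close>

lemma fin_gen_by_relation:
  assumes A: "subring A R" and V: "lin_sub A V"
    and noeth: "\<And>I. lin_sub A I \<Longrightarrow> I \<subseteq> A \<Longrightarrow> fin_gen A I"
    and \<rho>: "\<rho> \<subseteq> V \<times> A" and total: "\<And>v. v \<in> V \<Longrightarrow> \<exists>r. (v, r) \<in> \<rho>"
    and add: "\<And>u r v s. (u, r) \<in> \<rho> \<Longrightarrow> (v, s) \<in> \<rho> \<Longrightarrow> (u \<oplus> v, r \<oplus> s) \<in> \<rho>"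
    and smult: "\<And>c u r. c \<in> A \<Longrightarrow> (u, r) \<in> \<rho> \<Longrightarrow> (c \<otimes> u, c \<otimes> r) \<in> \<rho>"
    and ker: "fin_gen A {v. (v, \<zero>) \<in> \<rho>}"
  shows "fin_gen A V"
proof -
  note Ac = subringE(1)[OF A] and Vc = lin_subD(1)[OF V]
  have "\<zero> \<in> snd ` \<rho>"
  proof -
    obtain r where r: "(\<zero>, r) \<in> \<rho>" using total lin_subD(2)[OF V] by blast
    then have "(\<zero> \<otimes> \<zero>, \<zero> \<otimes> r) \<in> \<rho>" using smult subringE(2)[OF A] by blast
    moreover have "r \<in> carrier R" using r \<rho> Ac by blast
    ultimately show ?thesis by force
  qed
  have "lin_sub A (snd ` \<rho>)"
  proof (rule lin_subI)
    show "snd ` \<rho> \<subseteq> carrier R" using \<rho> Ac by auto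
    show "\<zero> \<in> snd ` \<rho>" by fact
    show "r \<oplus> s \<in> snd ` \<rho>" if "r \<in> snd ` \<rho>" "s \<in> snd ` \<rho>" for r s
    proof -
      obtain u v where "(u, r) \<in> \<rho>" "(v, s) \<in> \<rho>" using \<open>r \<in> snd ` \<rho>\<close> \<open>s \<in> snd ` \<rho>\<close> by auto
      then show ?thesis using add[of u r v s] by (metis image_eqI snd_conv)
    qed
    show "c \<otimes> r \<in> snd ` \<rho>" if "c \<in> A" "r \<in> snd ` \<rho>" for c r
    proof -
      obtain u where "(u, r) \<in> \<rho>" using \<open>r \<in> snd ` \<rho>\<close> by auto
      then show ?thesis using smult[OF \<open>c \<in> A\<close>, of u r] by (metis image_eqI snd_conv)
    qed
  qed
  then have "fin_gen A (snd ` \<rho>)" by (rule noeth) (use \<rho> in auto)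
  then obtain C where C: "C \<subseteq> snd ` \<rho>" "finite C" "snd ` \<rho> = lin_span A C"
    unfolding fin_gen_def by blast
  obtain B where B: "B \<subseteq> {v. (v, \<zero>) \<in> \<rho>}" "finite B" "{v. (v, \<zero>) \<in> \<rho>} = lin_span A B"
    using ker unfolding fin_gen_def by blast
  have "\<forall>c\<in>C. \<exists>v. (v, c) \<in> \<rho>"
    using C(1) by (metis image_iff prod.collapse subset_iff)
  then obtain g where g: "\<And>c. c \<in> C \<Longrightarrow> (g c, c) \<in> \<rho>" by metis
  let ?D = "B \<union> g ` C"
  have DV: "?D \<subseteq> V" using B(1) g \<rho> by auto
  have D: "lin_sub A (lin_span A ?D)" by (rule lin_sub_lin_span[OF A]) (use DV Vc in blast)
  have lift: "\<exists>w\<in>lin_span A (g ` C). (w, r) \<in> \<rho>" if "r \<in> lin_span A C" for r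
    using that
  proof induction
    case zero
    obtain v where v: "(v, \<zero>) \<in> \<rho>" using \<open>\<zero> \<in> snd ` \<rho>\<close> by auto
    then have "(\<zero> \<otimes> v, \<zero> \<otimes> \<zero>) \<in> \<rho>" using smult subringE(2)[OF A] by blast
    moreover have "v \<in> carrier R" using v \<rho> Vc by blast
    ultimately show ?case using lin_span.zero by force
  next
    case (add r c v)
    then obtain w where w: "w \<in> lin_span A (g ` C)" "(w, v) \<in> \<rho>" by blast
    have "(r \<otimes> g c \<oplus> w, r \<otimes> c \<oplus> v) \<in> \<rho>"
      using assms(6)[OF smult[OF add.hyps(1) g[OF add.hyps(2)]] w(2)] .
    moreover have "r \<otimes> g c \<oplus> w \<in> lin_span A (g ` C)" using add.hyps w by (intro lin_span.add) auto
    ultimately show ?case by blast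
  qed
  have "V \<subseteq> lin_span A ?D"
  proof
    fix v assume v: "v \<in> V"
    then obtain r where r: "(v, r) \<in> \<rho>" using total by blast
    then have "r \<in> lin_span A C" using C(3) by (metis snd_conv image_eqI)
    then obtain w where w: "w \<in> lin_span A (g ` C)" "(w, r) \<in> \<rho>" using lift by blast
    have c: "v \<in> carrier R" "w \<in> carrier R" "r \<in> carrier R" using v w(2) \<rho> Vc Ac by auto
    have "(\<ominus> \<one> \<otimes> w, \<ominus> \<one> \<otimes> r) \<in> \<rho>" using smult[OF _ w(2)] subringE(3,5)[OF A] by blast
    then have "(\<ominus> w, \<ominus> r) \<in> \<rho>" using c by (simp add: l_minus)
    from add[OF r this] have "v \<oplus> \<ominus> w \<in> lin_span A B" using B(3) c by (auto simp: r_neg)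
    then have "v \<oplus> \<ominus> w \<in> lin_span A ?D" using lin_span_mono[of B ?D A] by blast
    moreover have "w \<in> lin_span A ?D" using w(1) lin_span_mono[of "g ` C" ?D A] by blast
    ultimately have "(v \<oplus> \<ominus> w) \<oplus> w \<in> lin_span A ?D" by (rule lin_subD(3)[OF D])
    then show "v \<in> lin_span A ?D" using c by (simp add: a_assoc l_neg)
  qed
  then have "V = lin_span A ?D" using lin_span_least[OF V DV] by blast
  then show ?thesis unfolding fin_gen_def using DV B(2) C(2) by blast
qed

text \<open>Peel off one generator \<open>b\<close> at a time and relate \<open>v\<close> to its possible coefficients at \<open>b\<close>.\<close>

lemma fin_gen_submodule:
  assumes A: "subring A R"
    and noeth: "\<And>I. lin_sub A I \<Longrightarrow> I \<subseteq> A \<Longrightarrow> fin_gen A I"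
    and "finite B" "B \<subseteq> carrier R" "lin_sub A V" "V \<subseteq> lin_span A B"
  shows "fin_gen A V"
  using assms(3-)
proof (induction B arbitrary: V rule: finite_induct)
  case empty
  have "V = lin_span A {}"
    using empty.prems(3) lin_subD(2)[OF empty.prems(2)] unfolding lin_span_empty by auto
  then show ?case unfolding fin_gen_def by blast
next
  case (insert b B)
  note Ac = subringE(1)[OF A] and V = lin_subD[OF insert.prems(2)]
  have b: "b \<in> carrier R" and B: "B \<subseteq> carrier R" using insert by auto
  note S = lin_sub_lin_span[OF A B]
  let ?\<rho> = "{(v, r). v \<in> V \<and> r \<in> A \<and> v \<oplus> \<ominus> (r \<otimes> b) \<in> lin_span A B}"
  show ?case
  proof (rule fin_gen_by_relation[OF A insert.prems(2) noeth, of ?\<rho>])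
    fix v assume v: "v \<in> V"
    then obtain r w where rw: "r \<in> A" "w \<in> lin_span A B" "v = r \<otimes> b \<oplus> w"
      using lin_span_insertE[OF A B b] insert.prems(3) by blast
    then have "r \<in> carrier R" "w \<in> carrier R" using Ac lin_subD(1)[OF S] by auto
    then have "v \<oplus> \<ominus> (r \<otimes> b) = w" unfolding rw(3) using b by algebra
    then show "\<exists>r. (v, r) \<in> ?\<rho>" using rw v by auto
  next
    fix u r v s assume h: "(u, r) \<in> ?\<rho>" "(v, s) \<in> ?\<rho>"
    then have c: "u \<in> carrier R" "r \<in> carrier R" "v \<in> carrier R" "s \<in> carrier R" using V(1) Ac by auto
    have "u \<oplus> v \<oplus> \<ominus> ((r \<oplus> s) \<otimes> b) = (u \<oplus> \<ominus> (r \<otimes> b)) \<oplus> (v \<oplus> \<ominus> (s \<otimes> b))"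
      using c b by algebra
    then show "(u \<oplus> v, r \<oplus> s) \<in> ?\<rho>"
      using h V(3) lin_subD(3)[OF S] subringE(7)[OF A] by auto
  next
    fix s u r assume s: "s \<in> A" and h: "(u, r) \<in> ?\<rho>"
    then have c: "u \<in> carrier R" "r \<in> carrier R" "s \<in> carrier R" using V(1) Ac by auto
    have "s \<otimes> u \<oplus> \<ominus> ((s \<otimes> r) \<otimes> b) = s \<otimes> (u \<oplus> \<ominus> (r \<otimes> b))"
      using c b by algebra
    then show "(s \<otimes> u, s \<otimes> r) \<in> ?\<rho>"
      using h s V(4) lin_subD(4)[OF S] subringE(6)[OF A] by auto
  next
    have "{v. (v, \<zero>) \<in> ?\<rho>} = V \<inter> lin_span A B"
      using subringE(2)[OF A] b V(1) by (auto)
    moreover have "lin_sub A (V \<inter> lin_span A B)"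
      by (rule lin_subI) (use V lin_subD[OF S] in auto)
    ultimately show "fin_gen A {v. (v, \<zero>) \<in> ?\<rho>}" using insert.IH[OF B] by simp
  qed auto
qed

text \<open>The functionals embed \<open>V\<close> in a free module of finite rank. Removing one functional replaces \<open>V\<close> by
  its kernel.\<close>

lemma fin_gen_by_functionals:
  assumes A: "subring A R"
    and noeth: "\<And>I. lin_sub A I \<Longrightarrow> I \<subseteq> A \<Longrightarrow> fin_gen A I"
    and "finite F" "lin_sub A V"
    and F: "\<And>f v. f \<in> F \<Longrightarrow> v \<in> V \<Longrightarrow> f v \<in> A"
      "\<And>f u v. f \<in> F \<Longrightarrow> u \<in> V \<Longrightarrow> v \<in> V \<Longrightarrow> f (u \<oplus> v) = f u \<oplus> f v"
      "\<And>f r v. f \<in> F \<Longrightarrow> r \<in> A \<Longrightarrow> v \<in> V \<Longrightarrow> f (r \<otimes> v) = r \<otimes> f v"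
    and inj: "\<And>v. v \<in> V \<Longrightarrow> (\<And>f. f \<in> F \<Longrightarrow> f v = \<zero>) \<Longrightarrow> v = \<zero>"
  shows "fin_gen A V"
  using assms(3-)
proof (induction F arbitrary: V rule: finite_induct)
  case empty
  have "V = {\<zero>}" using empty.prems(5) lin_subD(2)[OF empty.prems(1)] by blast
  then have "V = lin_span A {}" unfolding lin_span_empty .
  then show ?case unfolding fin_gen_def by blast
next
  case (insert f F)
  note Ac = subringE(1)[OF A] and V = lin_subD[OF insert.prems(1)]
  let ?\<rho> = "{(v, r). v \<in> V \<and> r = f v}"
  show ?case
  proof (rule fin_gen_by_relation[OF A insert.prems(1) noeth, of ?\<rho>])
    let ?W = "{v. (v, \<zero>) \<in> ?\<rho>}"
    have W: "?W = {v \<in> V. f v = \<zero>}" by auto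
    have f0: "f \<zero> = \<zero>"
      using insert.prems(4)[of f \<zero> \<zero>] insert.prems(2)[of f \<zero>] subringE(2)[OF A] V(2) Ac by auto
    have LW: "lin_sub A ?W"
      unfolding W
    proof (rule lin_subI)
      show "\<And>u v. u \<in> {v \<in> V. f v = \<zero>} \<Longrightarrow> v \<in> {v \<in> V. f v = \<zero>} \<Longrightarrow> u \<oplus> v \<in> {v \<in> V. f v = \<zero>}"
        using V(3) insert.prems(3)[of f] by simp
      show "\<And>r v. r \<in> A \<Longrightarrow> v \<in> {v \<in> V. f v = \<zero>} \<Longrightarrow> r \<otimes> v \<in> {v \<in> V. f v = \<zero>}"
        using V(4) insert.prems(4)[of f] Ac by auto
    qed (use V f0 in auto)
    show "fin_gen A ?W"
    proof (rule insert.IH[OF LW])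
      show "v = \<zero>" if "v \<in> ?W" "\<And>g. g \<in> F \<Longrightarrow> g v = \<zero>" for v
        using insert.prems(5)[of v] that by auto
    qed (use insert.prems(2-4) in simp_all)
  qed (use insert.prems V in auto)
qed

text \<open>Eliminate one generator after the other: \<open>b = j + x (r b + w)\<close> can be solved for \<open>b\<close> because
  \<open>1 - x r\<close> is a unit, and the result is substituted into the other equations.\<close>

lemma nakayama:
  assumes A: "subring A R" and J: "lin_sub A J" and x: "x \<in> A"
    and unit: "\<And>r. r \<in> A \<Longrightarrow> \<exists>u\<in>A. u \<otimes> (\<one> \<ominus> x \<otimes> r) = \<one>"
    and "finite B" "B \<subseteq> carrier R"
    and "\<And>b. b \<in> B \<Longrightarrow> \<exists>j\<in>J. \<exists>w\<in>lin_span A (J \<union> B). b = j \<oplus> x \<otimes> w"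
  shows "B \<subseteq> J"
  using assms(5-)
proof (induction B rule: finite_induct)
  case empty
  then show ?case by simp
next
  case (insert b B)
  note Ac = subringE(1)[OF A] and Jc = lin_subD(1)[OF J]
  have b: "b \<in> carrier R" and B: "B \<subseteq> carrier R" and JB: "J \<union> B \<subseteq> carrier R" using insert Jc by auto
  note S = lin_sub_lin_span[OF A JB] and Sc = lin_span_carrier[OF Ac JB]
  have base: "J \<union> B \<subseteq> lin_span A (J \<union> B)" using lin_span_base[OF A JB] by blast
  have eq: "J \<union> insert b B = insert b (J \<union> B)" by auto
  obtain j w where jw: "j \<in> J" "w \<in> lin_span A (insert b (J \<union> B))" "b = j \<oplus> x \<otimes> w"
    using insert.prems(2)[of b] unfolding eq by blast
  obtain r w' where rw: "r \<in> A" "w' \<in> lin_span A (J \<union> B)" "w = r \<otimes> b \<oplus> w'"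
    using lin_span_insertE[OF A JB b jw(2)] by blast
  obtain u where u: "u \<in> A" "u \<otimes> (\<one> \<ominus> x \<otimes> r) = \<one>" using unit[OF rw(1)] by blast
  have c: "j \<in> carrier R" "x \<in> carrier R" "r \<in> carrier R" "u \<in> carrier R" "w' \<in> carrier R"
    using jw(1) rw(1,2) u(1) x Ac Jc Sc by auto
  have "(\<one> \<ominus> x \<otimes> r) \<otimes> b = j \<oplus> x \<otimes> w'"
  proof -
    have "b = j \<oplus> x \<otimes> (r \<otimes> b \<oplus> w')" using jw(3) rw(3) by simp
    moreover have "(\<one> \<ominus> x \<otimes> r) \<otimes> b = b \<ominus> x \<otimes> r \<otimes> b" using c b by algebra
    ultimately have "(\<one> \<ominus> x \<otimes> r) \<otimes> b = j \<oplus> x \<otimes> (r \<otimes> b \<oplus> w') \<ominus> x \<otimes> r \<otimes> b"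
      by simp
    also have "\<dots> = j \<oplus> x \<otimes> w'" using c b by algebra
    finally show ?thesis .
  qed
  moreover have "(u \<otimes> (\<one> \<ominus> x \<otimes> r)) \<otimes> b = u \<otimes> ((\<one> \<ominus> x \<otimes> r) \<otimes> b)"
    "u \<otimes> (j \<oplus> x \<otimes> w') = u \<otimes> j \<oplus> x \<otimes> (u \<otimes> w')"
    using c b by algebra+
  ultimately have "(u \<otimes> (\<one> \<ominus> x \<otimes> r)) \<otimes> b = u \<otimes> j \<oplus> x \<otimes> (u \<otimes> w')" by simp
  then have bu: "b = u \<otimes> j \<oplus> x \<otimes> (u \<otimes> w')" using u(2) b by simp
  have uj: "u \<otimes> j \<in> J" using lin_subD(4)[OF J u(1) jw(1)] .
  have uw: "u \<otimes> w' \<in> lin_span A (J \<union> B)" using lin_subD(4)[OF S u(1) rw(2)] .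
  have bS: "b \<in> lin_span A (J \<union> B)"
    using bu lin_subD(3)[OF S _ lin_subD(4)[OF S x uw]] uj base by auto
  have "B \<subseteq> J"
  proof (rule insert.IH[OF B])
    fix c assume "c \<in> B"
    then obtain j1 w1 where 1: "j1 \<in> J" "w1 \<in> lin_span A (insert b (J \<union> B))" "c = j1 \<oplus> x \<otimes> w1"
      using insert.prems(2)[of c] unfolding eq by blast
    have "lin_span A (insert b (J \<union> B)) \<subseteq> lin_span A (J \<union> B)"
      by (rule lin_span_least[OF S]) (use base bS in auto)
    with 1 show "\<exists>j\<in>J. \<exists>w\<in>lin_span A (J \<union> B). c = j \<oplus> x \<otimes> w" by blast
  qed
  then have "lin_span A (J \<union> B) \<subseteq> J" by (intro lin_span_least[OF J]) auto
  then have "b \<in> J" using bS by blast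
  with \<open>B \<subseteq> J\<close> show ?case by simp
qed

lemma nakayama_fin_gen:
  assumes A: "subring A R" and J: "lin_sub A J" and x: "x \<in> A"
    and unit: "\<And>r. r \<in> A \<Longrightarrow> \<exists>u\<in>A. u \<otimes> (\<one> \<ominus> x \<otimes> r) = \<one>"
    and I: "fin_gen A I" "I \<subseteq> carrier R"
    and IJ: "\<And>b. b \<in> I \<Longrightarrow> \<exists>j\<in>J. \<exists>w\<in>I. b = j \<oplus> x \<otimes> w"
  shows "I \<subseteq> J"
proof -
  obtain B where B: "B \<subseteq> I" "finite B" "I = lin_span A B" using I unfolding fin_gen_def by blast
  have "B \<subseteq> J"
  proof (rule nakayama[OF A J x unit B(2)])
    show "B \<subseteq> carrier R" using B I by blast
    fix b assume "b \<in> B"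
    then obtain j w where "j \<in> J" "w \<in> I" "b = j \<oplus> x \<otimes> w" using IJ B(1) by blast
    then show "\<exists>j\<in>J. \<exists>w\<in>lin_span A (J \<union> B). b = j \<oplus> x \<otimes> w"
      using lin_span_mono[of B "J \<union> B" A] B(3) by blast
  qed
  then show ?thesis using lin_span_least[OF J] B(3) by blast
qed

end

section \<open>Two-dimensional regular local rings\<close>

text \<open>The powers of the ideal generated by \<open>a\<close> and \<open>b\<close> in \<open>A\<close>.\<close>

primrec (in ring) two_gen_power :: "'a set \<Rightarrow> 'a \<Rightarrow> 'a \<Rightarrow> nat \<Rightarrow> 'a set" where
  "two_gen_power A a b 0 = A"
| "two_gen_power A a b (Suc n) =
     {a \<otimes> u \<oplus> b \<otimes> v | u v. u \<in> two_gen_power A a b n \<and> v \<in> two_gen_power A a b n}"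

text \<open>A noetherian local ring \<open>A\<close> inside a field, with maximal ideal generated by \<open>a\<close> and \<open>b\<close>. The prime \<open>P\<close>
  strictly between zero and the maximal ideal expresses that the dimension is at least two. The
  assumption that \<open>a\<close> is nonzero breaks the symmetry between the two generators.\<close>

locale two_dim_regular = field L for L (structure) +
  fixes A a b
  assumes subring_A: "subring A L"
    and noeth: "\<And>I. lin_sub A I \<Longrightarrow> I \<subseteq> A \<Longrightarrow> fin_gen A I"
    and a_in [simp]: "a \<in> A" and b_in [simp]: "b \<in> A" and a_nz: "a \<noteq> \<zero>"
    and unit_or_max: "\<And>r. r \<in> A \<Longrightarrow> (\<exists>s\<in>A. r \<otimes> s = \<one>) \<or> (\<exists>u\<in>A. \<exists>v\<in>A. r = a \<otimes> u \<oplus> b \<otimes> v)"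
    and proper: "\<And>u v. u \<in> A \<Longrightarrow> v \<in> A \<Longrightarrow> a \<otimes> u \<oplus> b \<otimes> v \<noteq> \<one>"
    and separated: "\<And>r. (\<And>n. r \<in> two_gen_power A a b n) \<Longrightarrow> r = \<zero>"
    and prime_between: "\<exists>P. lin_sub A P \<and> P \<subseteq> A \<and> \<one> \<notin> P \<and>
          (\<forall>r\<in>A. \<forall>s\<in>A. r \<otimes> s \<in> P \<longrightarrow> r \<in> P \<or> s \<in> P) \<and>
          (\<exists>c\<in>P. c \<noteq> \<zero>) \<and> \<not> (a \<in> P \<and> b \<in> P)"
begin

lemma A_carrier [simp]: "r \<in> A \<Longrightarrow> r \<in> carrier L"
  using subringE(1)[OF subring_A] by blast

lemma A_closed [simp]: "\<zero> \<in> A" "\<one> \<in> A" "r \<in> A \<Longrightarrow> \<ominus> r \<in> A" "r \<in> A \<Longrightarrow> s \<in> A \<Longrightarrow> r \<otimes> s \<in> A"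
   "r \<in> A \<Longrightarrow> s \<in> A \<Longrightarrow> r \<oplus> s \<in> A" "r \<in> A \<Longrightarrow> s \<in> A \<Longrightarrow> r \<ominus> s \<in> A"
  using subringE[OF subring_A] by (auto simp: a_minus_def)

lemma A_pow [simp]: "r \<in> A \<Longrightarrow> r [^] (n::nat) \<in> A"
  by (induction n) auto

lemma pow_nz: "x \<in> carrier L \<Longrightarrow> x \<noteq> \<zero> \<Longrightarrow> x [^] (n::nat) \<noteq> \<zero>"
  by (induction n) (auto simp: integral_iff)

lemma one_minus_unit:
  assumes x: "x = a \<or> x = b" and r: "r \<in> A"
  shows "\<exists>u\<in>A. u \<otimes> (\<one> \<ominus> x \<otimes> r) = \<one>"
proof -
  have x': "x \<in> A" using x by auto
  have "\<not> (\<exists>u\<in>A. \<exists>v\<in>A. \<one> \<ominus> x \<otimes> r = a \<otimes> u \<oplus> b \<otimes> v)"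
  proof safe
    fix u v assume uv: "u \<in> A" "v \<in> A" "\<one> \<ominus> x \<otimes> r = a \<otimes> u \<oplus> b \<otimes> v"
    have "\<one> = (\<one> \<ominus> x \<otimes> r) \<oplus> x \<otimes> r" using x' r by (simp add: minus_eq a_assoc l_neg)
    then have eq: "\<one> = a \<otimes> u \<oplus> b \<otimes> v \<oplus> x \<otimes> r" using uv(3) by simp
    from x show False
    proof
      assume "x = a"
      then have "\<one> = a \<otimes> (u \<oplus> r) \<oplus> b \<otimes> v" using eq uv(1,2) r by (simp add: r_distr a_ac)
      then show False using proper[of "u \<oplus> r" v] uv r by simp
    next
      assume "x = b"
      then have "\<one> = a \<otimes> u \<oplus> b \<otimes> (v \<oplus> r)" using eq uv(1,2) r by (simp add: r_distr a_ac)
      then show False using proper[of u "v \<oplus> r"] uv r by simp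
    qed
  qed
  then obtain s where s: "s \<in> A" "(\<one> \<ominus> x \<otimes> r) \<otimes> s = \<one>"
    using unit_or_max[of "\<one> \<ominus> x \<otimes> r"] x' r by auto
  then have "s \<otimes> (\<one> \<ominus> x \<otimes> r) = \<one>" using x' r by (simp add: m_comm)
  with s(1) show ?thesis by blast
qed

text \<open>A direct proof of the case of Krull's principal ideal theorem that is needed. Suppose \<open>b\<^sup>n \<in> a A\<close>, so
  that \<open>A / a A\<close> has finite length and its ideals are generated by powers of \<open>b\<close>. For \<open>c \<in> P\<close> nonzero let
  \<open>Q\<^sub>i\<close> be the contraction to \<open>A\<close> of the ideal generated by \<open>c\<^sup>i\<close> in the localisation at \<open>P\<close>. The
  decreasing chain \<open>Q\<^sub>i + a A\<close> becomes stationary; as \<open>a \<notin> P\<close> is a nonzerodivisor modulo \<open>Q\<^sub>i\<close>, this gives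
  \<open>Q\<^sub>i \<subseteq> Q\<^sub>i\<^sub>+\<^sub>1 + a Q\<^sub>i\<close> and hence \<open>Q\<^sub>i = Q\<^sub>i\<^sub>+\<^sub>1\<close> by Nakayama. Then \<open>c\<^sup>i \<in> Q\<^sub>i\<^sub>+\<^sub>1\<close> means that some element
  outside \<open>P\<close> is a multiple of \<open>c\<close>, which is absurd.\<close>

lemma b_not_nilpotent_mod_a:
  assumes r0: "r0 \<in> A"
  shows "b [^] (n::nat) \<noteq> a \<otimes> r0"
proof
  assume nil: "b [^] n = a \<otimes> r0"
  obtain P c where P: "lin_sub A P" "P \<subseteq> A" "\<one> \<notin> P" and prime: "\<And>r s. r \<in> A \<Longrightarrow> s \<in> A \<Longrightarrow> r \<otimes> s \<in> P \<Longrightarrow> r \<in> P \<or> s \<in> P"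
    and c: "c \<in> P" "c \<noteq> \<zero>" and ab: "\<not> (a \<in> P \<and> b \<in> P)"
    using prime_between by blast
  have cA [simp]: "c \<in> A" using c P by blast
  have aP: "a \<notin> P"
  proof
    assume "a \<in> P"
    then have "r0 \<otimes> a \<in> P" using lin_subD(4)[OF P(1) r0] by blast
    then have "b [^] n \<in> P" using nil r0 by (simp add: m_comm)
    then have "b \<in> P"
    proof (induction n)
      case 0
      then show ?case using P(3) by simp
    next
      case (Suc n)
      then show ?case using prime[of "b [^] n" b] by auto
    qed
    then show False using ab \<open>a \<in> P\<close> by blast
  qed
  \<comment> \<open>Modulo \<open>a\<close>, every element is zero or a unit times a power of \<open>b\<close>.\<close>
  have decomp: "(\<exists>z\<in>A. \<exists>y\<in>A. r = a \<otimes> z \<oplus> b [^] k \<otimes> y) \<or>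
      (\<exists>j::nat. \<exists>z\<in>A. \<exists>w\<in>A. \<exists>w'\<in>A. w \<otimes> w' = \<one> \<and> r = a \<otimes> z \<oplus> b [^] j \<otimes> w)" if r: "r \<in> A" for r and k :: nat
  proof (induction k)
    case 0
    have "r = a \<otimes> \<zero> \<oplus> b [^] (0::nat) \<otimes> r" using r by simp
    then show ?case using r A_closed(1) by blast
  next
    case (Suc k)
    then show ?case
    proof (elim disjE bexE)
      fix z y assume 1: "z \<in> A" "y \<in> A" "r = a \<otimes> z \<oplus> b [^] k \<otimes> y"
      consider (u) s where "s \<in> A" "y \<otimes> s = \<one>" | (m) u v where "u \<in> A" "v \<in> A" "y = a \<otimes> u \<oplus> b \<otimes> v"
        using unit_or_max[OF 1(2)] by blast
      then show ?thesis
      proof cases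
        case u
        have "y \<otimes> s = \<one> \<and> r = a \<otimes> z \<oplus> b [^] k \<otimes> y" using u(2) 1(3) by blast
        with u(1) 1(1,2) show ?thesis
          by (intro disjI2 exI[of _ k] bexI[of _ z] bexI[of _ y] bexI[of _ s])
      next
        case m
        have "r = a \<otimes> (z \<oplus> b [^] k \<otimes> u) \<oplus> b [^] Suc k \<otimes> v"
        proof -
          have "r = a \<otimes> z \<oplus> b [^] k \<otimes> (a \<otimes> u \<oplus> b \<otimes> v)" using 1(3) m(3) by simp
          also have "\<dots> = a \<otimes> (z \<oplus> b [^] k \<otimes> u) \<oplus> (b [^] k \<otimes> b) \<otimes> v"
            using 1(1) m(1,2) by (simp add: r_distr m_ac a_ac)
          finally show ?thesis by simp
        qed
        moreover have "z \<oplus> b [^] k \<otimes> u \<in> A" using 1 m by simp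
        ultimately show ?thesis using m(2) by blast
      qed
    qed (rule disjI2)
  qed
  define Q where "Q i = {r \<in> A. \<exists>s\<in>A. s \<notin> P \<and> (\<exists>t\<in>A. s \<otimes> r = c [^] i \<otimes> t)}" for i :: nat
  have QA: "Q i \<subseteq> A" for i unfolding Q_def by blast
  have Qsub: "lin_sub A (Q i)" for i
  proof (rule lin_subI)
    show "Q i \<subseteq> carrier L" using QA A_carrier by blast
    have "\<one> \<otimes> \<zero> = c [^] i \<otimes> \<zero>" by simp
    then show "\<zero> \<in> Q i" unfolding Q_def using P(3) A_closed(1,2) by blast
    fix u v assume "u \<in> Q i" "v \<in> Q i"
    then obtain s t s' t' where st: "u \<in> A" "v \<in> A" "s \<in> A" "s' \<in> A" "t \<in> A" "t' \<in> A" "s \<notin> P" "s' \<notin> P"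
      "s \<otimes> u = c [^] i \<otimes> t" "s' \<otimes> v = c [^] i \<otimes> t'" unfolding Q_def by blast
    have "(s \<otimes> s') \<otimes> (u \<oplus> v) = s' \<otimes> (s \<otimes> u) \<oplus> s \<otimes> (s' \<otimes> v)"
      using st(1-6) by (simp add: r_distr m_ac)
    also have "\<dots> = c [^] i \<otimes> (s' \<otimes> t \<oplus> s \<otimes> t')"
      unfolding st(9,10) using st(1-6) by (simp add: r_distr m_ac)
    finally have "(s \<otimes> s') \<otimes> (u \<oplus> v) = c [^] i \<otimes> (s' \<otimes> t \<oplus> s \<otimes> t')" .
    moreover have "s \<otimes> s' \<notin> P" using prime st by blast
    moreover have "s \<otimes> s' \<in> A" "u \<oplus> v \<in> A" "s' \<otimes> t \<oplus> s \<otimes> t' \<in> A" using st by simp_all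
    ultimately show "u \<oplus> v \<in> Q i" unfolding Q_def by blast
  next
    fix r u assume r: "r \<in> A" and "u \<in> Q i"
    then obtain s t where st: "u \<in> A" "s \<in> A" "t \<in> A" "s \<notin> P" "s \<otimes> u = c [^] i \<otimes> t" unfolding Q_def by blast
    have "s \<otimes> (r \<otimes> u) = r \<otimes> (s \<otimes> u)" using st(1-3) r by (simp add: m_ac)
    also have "\<dots> = c [^] i \<otimes> (r \<otimes> t)" unfolding st(5) using st(1-3) r by (simp add: m_ac)
    finally show "r \<otimes> u \<in> Q i" unfolding Q_def using st r A_closed(4) by blast
  qed
  have Qdec: "Q (Suc i) \<subseteq> Q i" for i
  proof
    fix r assume "r \<in> Q (Suc i)"
    then obtain s t where st: "r \<in> A" "s \<in> A" "t \<in> A" "s \<notin> P" "s \<otimes> r = c [^] Suc i \<otimes> t" unfolding Q_def by blast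
    then have "s \<otimes> r = c [^] i \<otimes> (c \<otimes> t)" by (simp add: m_assoc)
    then show "r \<in> Q i" unfolding Q_def using st cA A_closed(4) by blast
  qed
  have Qa: "r \<in> Q i" if rQ: "r \<in> A" "a \<otimes> r \<in> Q i" for r i
  proof -
    obtain s t where st: "s \<in> A" "t \<in> A" "s \<notin> P" "s \<otimes> (a \<otimes> r) = c [^] i \<otimes> t" using rQ unfolding Q_def by blast
    then have "(s \<otimes> a) \<otimes> r = c [^] i \<otimes> t" using rQ(1) by (simp add: m_assoc)
    moreover have "s \<otimes> a \<notin> P" using prime st aP by (meson a_in)
    ultimately show ?thesis unfolding Q_def using st(1,2) rQ(1) a_in A_closed(4) by blast
  qed
  \<comment> \<open>The ideal \<open>Q i + a A\<close> is generated by \<open>a\<close> and the power of \<open>b\<close> with exponent \<open>\<nu> i\<close>.\<close>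
  define \<nu> where "\<nu> i = (LEAST j::nat. \<exists>y\<in>Q i. \<exists>z\<in>A. b [^] j = y \<oplus> a \<otimes> z)" for i
  have zn: "\<exists>y\<in>Q i. \<exists>z\<in>A. b [^] n = y \<oplus> a \<otimes> z" for i
    using nil r0 lin_subD(2)[OF Qsub, of i] by (intro bexI[of _ \<zero>] bexI[of _ r0]) auto
  have \<nu>: "\<exists>y\<in>Q i. \<exists>z\<in>A. b [^] \<nu> i = y \<oplus> a \<otimes> z" for i
    unfolding \<nu>_def by (rule LeastI[of "\<lambda>j. \<exists>y\<in>Q i. \<exists>z\<in>A. b [^] j = y \<oplus> a \<otimes> z", OF zn[of i]])
  have \<nu>le: "\<nu> i \<le> j" if "\<exists>y\<in>Q i. \<exists>z\<in>A. b [^] j = y \<oplus> a \<otimes> z" for i and j :: nat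
    unfolding \<nu>_def by (rule Least_le[of "\<lambda>j. \<exists>y\<in>Q i. \<exists>z\<in>A. b [^] j = y \<oplus> a \<otimes> z", OF that])
  have mono: "\<nu> i \<le> \<nu> (Suc i)" for i using \<nu>le[of i] \<nu>[of "Suc i"] Qdec[of i] by blast
  have "\<exists>i. \<nu> i = \<nu> (Suc i)"
  proof (rule ccontr)
    assume "\<nexists>i. \<nu> i = \<nu> (Suc i)"
    then have lt: "\<nu> i < \<nu> (Suc i)" for i using mono[of i] by (metis le_neq_implies_less)
    have "i \<le> \<nu> i" for i by (induction i) (use lt in \<open>auto intro: le_less_trans Suc_leI\<close>)
    from this[of "Suc n"] \<nu>le[OF zn[of "Suc n"]] show False by simp
  qed
  then obtain i where i: "\<nu> i = \<nu> (Suc i)" by blast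
  have "Q i \<subseteq> Q (Suc i)"
  proof (rule nakayama_fin_gen[OF subring_A Qsub a_in one_minus_unit noeth[OF Qsub QA]])
    show "Q i \<subseteq> carrier L" using QA A_carrier by blast
    fix r assume r: "r \<in> Q i"
    then have rA: "r \<in> A" using QA by blast
    have "\<exists>y\<in>Q (Suc i). \<exists>z\<in>A. r = y \<oplus> a \<otimes> z"
      using decomp[OF rA, of n]
    proof (elim disjE bexE exE conjE)
      fix z y assume zy: "z \<in> A" "y \<in> A" "r = a \<otimes> z \<oplus> b [^] n \<otimes> y"
      have "r = \<zero> \<oplus> a \<otimes> (z \<oplus> r0 \<otimes> y)"
        unfolding zy(3) nil using zy(1,2) r0 by (simp add: r_distr m_assoc)
      moreover have "z \<oplus> r0 \<otimes> y \<in> A" using zy r0 by simp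
      ultimately show ?thesis using lin_subD(2)[OF Qsub] by blast
    next
      fix j :: nat and z w w' assume w: "z \<in> A" "w \<in> A" "w' \<in> A" "w \<otimes> w' = \<one>" "r = a \<otimes> z \<oplus> b [^] j \<otimes> w"
      have bj: "b [^] j = w' \<otimes> r \<oplus> a \<otimes> (\<ominus> (w' \<otimes> z))"
      proof -
        have "w' \<otimes> r = a \<otimes> (w' \<otimes> z) \<oplus> b [^] j \<otimes> (w \<otimes> w')"
          unfolding w(5) using w(1-3) by (simp add: r_distr m_ac)
        then have "w' \<otimes> r \<oplus> a \<otimes> (\<ominus> (w' \<otimes> z)) = a \<otimes> (w' \<otimes> z) \<oplus> b [^] j \<oplus> a \<otimes> (\<ominus> (w' \<otimes> z))"
          using w(4) by simp
        also have "\<dots> = b [^] j" using w(1-3) by (simp add: r_minus a_ac r_neg r_neg1 r_neg2)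
        finally show ?thesis by simp
      qed
      have "\<nu> i \<le> j"
        using lin_subD(4)[OF Qsub w(3) r] w(1,3)
        by (intro \<nu>le bexI[of _ "w' \<otimes> r"] bexI[of _ "\<ominus> (w' \<otimes> z)"] bj) simp_all
      obtain y z' where y: "y \<in> Q (Suc i)" "z' \<in> A" "b [^] \<nu> i = y \<oplus> a \<otimes> z'" using \<nu>[of "Suc i"] i by auto
      have yA: "y \<in> A" using y QA by blast
      let ?e = "b [^] (j - \<nu> i)"
      have "b [^] j = ?e \<otimes> b [^] \<nu> i" using \<open>\<nu> i \<le> j\<close> by (simp add: nat_pow_mult)
      then have "r = a \<otimes> z \<oplus> (?e \<otimes> (y \<oplus> a \<otimes> z')) \<otimes> w" using w(5) y(3) by simp
      also have "\<dots> = (?e \<otimes> w) \<otimes> y \<oplus> a \<otimes> (z \<oplus> ?e \<otimes> w \<otimes> z')"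
        using w(1-3) yA y(2) by (simp add: r_distr l_distr m_ac a_ac)
      finally have "r = (?e \<otimes> w) \<otimes> y \<oplus> a \<otimes> (z \<oplus> ?e \<otimes> w \<otimes> z')" .
      moreover have "(?e \<otimes> w) \<otimes> y \<in> Q (Suc i)" using lin_subD(4)[OF Qsub _ y(1)] w by simp
      moreover have "z \<oplus> ?e \<otimes> w \<otimes> z' \<in> A" using w y by simp
      ultimately show ?thesis by blast
    qed
    then obtain y z where yz: "y \<in> Q (Suc i)" "z \<in> A" "r = y \<oplus> a \<otimes> z" by blast
    have yA: "y \<in> A" using yz QA by blast
    have "a \<otimes> z = r \<ominus> y" unfolding yz(3) using yA yz(2) by (simp add: minus_eq a_ac r_neg r_neg1 r_neg2)
    then have "a \<otimes> z \<in> Q i" using lin_sub_minus(2)[OF subring_A Qsub r] yz(1) Qdec by auto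
    then have "z \<in> Q i" using Qa yz(2) by blast
    then show "\<exists>j\<in>Q (Suc i). \<exists>w\<in>Q i. r = j \<oplus> a \<otimes> w" using yz by blast
  qed auto
  moreover have "c [^] i \<in> Q i"
  proof -
    have "\<one> \<otimes> c [^] i = c [^] i \<otimes> \<one>" by simp
    then show ?thesis unfolding Q_def using P(3) A_pow[OF cA] A_closed(2) by blast
  qed
  ultimately have "c [^] i \<in> Q (Suc i)" by blast
  then obtain s t where st: "s \<in> A" "t \<in> A" "s \<notin> P" "s \<otimes> c [^] i = c [^] Suc i \<otimes> t" unfolding Q_def by blast
  have "c [^] i \<noteq> \<zero>" using c(2) by (simp add: pow_nz)
  moreover have "c [^] i \<otimes> s = c [^] i \<otimes> (t \<otimes> c)" using st by (simp add: m_ac)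
  ultimately have "s = t \<otimes> c" using st by (simp add: m_lcancel)
  then show False using st(3) lin_subD(4)[OF P(1) st(2) c(1)] by simp
qed

text \<open>Let \<open>Z\<close> consist of the elements that some power of \<open>b\<close> multiplies into \<open>a A\<close>. No power of \<open>b\<close> is in
  \<open>a A\<close>, so that \<open>Z\<close> contains no unit, and an element \<open>a u + b v\<close> of \<open>Z\<close> has \<open>v \<in> Z\<close>. Thus
  \<open>Z \<subseteq> a A + b Z\<close>, and Nakayama gives \<open>Z \<subseteq> a A\<close>.\<close>

lemma regular_sequence:
  assumes "u \<in> A" "v \<in> A" "b \<otimes> u = a \<otimes> v"
  shows "\<exists>w\<in>A. u = a \<otimes> w"
proof -
  define J where "J = {a \<otimes> w | w. w \<in> A}"
  define Z where "Z = {r \<in> A. \<exists>k::nat. \<exists>t\<in>A. b [^] k \<otimes> r = a \<otimes> t}"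
  have J: "lin_sub A J"
  proof (rule lin_subI)
    show "J \<subseteq> carrier L" unfolding J_def by auto
    have "\<zero> = a \<otimes> \<zero>" by simp
    then show "\<zero> \<in> J" unfolding J_def using A_closed(1) by blast
    fix u v assume "u \<in> J" "v \<in> J"
    then obtain w z where "w \<in> A" "z \<in> A" "u = a \<otimes> w" "v = a \<otimes> z" unfolding J_def by blast
    then have "u \<oplus> v = a \<otimes> (w \<oplus> z)" "w \<oplus> z \<in> A" by (simp_all add: r_distr)
    then show "u \<oplus> v \<in> J" unfolding J_def by blast
  next
    fix r u assume r: "r \<in> A" and "u \<in> J"
    then obtain w where w: "w \<in> A" "u = a \<otimes> w" unfolding J_def by blast
    then have "r \<otimes> u = a \<otimes> (r \<otimes> w)" "r \<otimes> w \<in> A" using r by (simp_all add: m_ac)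
    then show "r \<otimes> u \<in> J" unfolding J_def by blast
  qed
  have ZA: "Z \<subseteq> A" unfolding Z_def by blast
  have Z: "lin_sub A Z"
  proof (rule lin_subI)
    show "Z \<subseteq> carrier L" using ZA A_carrier by blast
    have "b [^] (0::nat) \<otimes> \<zero> = a \<otimes> \<zero>" by simp
    then show "\<zero> \<in> Z" unfolding Z_def using A_closed(1) by blast
    fix u v assume "u \<in> Z" "v \<in> Z"
    then obtain k l :: nat and w z where *: "u \<in> A" "v \<in> A" "w \<in> A" "z \<in> A" "b [^] k \<otimes> u = a \<otimes> w" "b [^] l \<otimes> v = a \<otimes> z"
      unfolding Z_def by blast
    have "b [^] (k + l) \<otimes> (u \<oplus> v) = b [^] l \<otimes> (b [^] k \<otimes> u) \<oplus> b [^] k \<otimes> (b [^] l \<otimes> v)"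
      using *(1-4) by (simp add: nat_pow_mult[symmetric] r_distr m_ac)
    also have "\<dots> = a \<otimes> (b [^] l \<otimes> w \<oplus> b [^] k \<otimes> z)"
      unfolding *(5,6) using *(1-4) by (simp add: r_distr m_ac)
    finally have "b [^] (k + l) \<otimes> (u \<oplus> v) = a \<otimes> (b [^] l \<otimes> w \<oplus> b [^] k \<otimes> z)" .
    moreover have "u \<oplus> v \<in> A" "b [^] l \<otimes> w \<oplus> b [^] k \<otimes> z \<in> A" using * by simp_all
    ultimately show "u \<oplus> v \<in> Z" unfolding Z_def by blast
  next
    fix r u assume r: "r \<in> A" and "u \<in> Z"
    then obtain k :: nat and w where *: "u \<in> A" "w \<in> A" "b [^] k \<otimes> u = a \<otimes> w" unfolding Z_def by blast
    have "b [^] k \<otimes> (r \<otimes> u) = r \<otimes> (b [^] k \<otimes> u)" using *(1,2) r by (simp add: m_ac)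
    also have "\<dots> = a \<otimes> (r \<otimes> w)" unfolding *(3) using *(1,2) r by (simp add: m_ac)
    finally show "r \<otimes> u \<in> Z" unfolding Z_def using * r A_closed(4) by blast
  qed
  have "Z \<subseteq> J"
  proof (rule nakayama_fin_gen[OF subring_A J b_in one_minus_unit noeth[OF Z ZA]])
    show "Z \<subseteq> carrier L" using ZA A_carrier by blast
    fix r assume "r \<in> Z"
    then obtain k :: nat and t where r: "r \<in> A" "t \<in> A" "b [^] k \<otimes> r = a \<otimes> t" unfolding Z_def by blast
    consider s where "s \<in> A" "r \<otimes> s = \<one>" | u v where "u \<in> A" "v \<in> A" "r = a \<otimes> u \<oplus> b \<otimes> v"
      using unit_or_max[OF r(1)] by blast
    then show "\<exists>j\<in>J. \<exists>w\<in>Z. r = j \<oplus> b \<otimes> w"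
    proof cases
      case 1
      have "b [^] k = b [^] k \<otimes> (r \<otimes> s)" using 1 by simp
      also have "\<dots> = (b [^] k \<otimes> r) \<otimes> s" using 1(1) r(1) by (simp add: m_assoc)
      also have "\<dots> = a \<otimes> (t \<otimes> s)" unfolding r(3) using 1(1) r(2) by (simp add: m_assoc)
      finally show ?thesis using b_not_nilpotent_mod_a[of "t \<otimes> s" k] 1(1) r(2) by simp
    next
      case 2
      have "r \<ominus> a \<otimes> u = b \<otimes> v"
        unfolding 2(3) using A_carrier[OF 2(1)] A_carrier[OF 2(2)] A_carrier[OF a_in] A_carrier[OF b_in]
        by algebra
      then have "b [^] Suc k \<otimes> v = b [^] k \<otimes> (r \<ominus> a \<otimes> u)"
        using 2(1,2) by (simp add: m_ac)
      also have "\<dots> = (b [^] k \<otimes> r) \<ominus> a \<otimes> (b [^] k \<otimes> u)"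
        using 2(1) r(1) by (simp add: minus_eq r_distr r_minus m_ac)
      also have "\<dots> = a \<otimes> (t \<ominus> b [^] k \<otimes> u)"
        unfolding r(3) using 2(1) r(2) by (simp add: minus_eq r_distr r_minus)
      finally have "b [^] Suc k \<otimes> v = a \<otimes> (t \<ominus> b [^] k \<otimes> u)" .
      moreover have "t \<ominus> b [^] k \<otimes> u \<in> A" using 2 r by simp
      ultimately have "v \<in> Z" unfolding Z_def using 2(2) by blast
      then show ?thesis using 2 unfolding J_def by blast
    qed
  qed auto
  moreover have "u \<in> Z"
  proof -
    have "b [^] (1::nat) \<otimes> u = a \<otimes> v" using assms by simp
    then show ?thesis unfolding Z_def using assms(1,2) by blast
  qed
  ultimately show ?thesis unfolding J_def by blast
qed

lemma power_regular_sequence: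
  assumes "u \<in> A" "v \<in> A" "b [^] (k::nat) \<otimes> u = a [^] (j::nat) \<otimes> v"
  shows "\<exists>w\<in>A. u = a [^] j \<otimes> w"
proof -
  have one: "\<exists>w\<in>A. u = a \<otimes> w" if "u \<in> A" "v \<in> A" "b [^] k \<otimes> u = a \<otimes> v" for u v and k :: nat
    using that
  proof (induction k arbitrary: u v)
    case 0
    then show ?case by auto
  next
    case (Suc k)
    have "b \<otimes> (b [^] k \<otimes> u) = a \<otimes> v" using Suc.prems by (simp add: m_ac)
    then obtain w where "w \<in> A" "b [^] k \<otimes> u = a \<otimes> w" using regular_sequence[of "b [^] k \<otimes> u" v] Suc.prems(1,2) by auto
    then show ?case using Suc.IH Suc.prems(1) by blast
  qed
  show ?thesis using assms
  proof (induction j arbitrary: u v)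
    case 0
    then show ?case by auto
  next
    case (Suc j)
    have "b [^] k \<otimes> u = a \<otimes> (a [^] j \<otimes> v)" using Suc.prems by (simp add: m_ac)
    then obtain w where w: "w \<in> A" "u = a \<otimes> w" using one[of u "a [^] j \<otimes> v"] Suc.prems by auto
    have "a \<otimes> (b [^] k \<otimes> w) = a \<otimes> (a [^] j \<otimes> v)"
      using Suc.prems w by (simp add: m_ac)
    then have "b [^] k \<otimes> w = a [^] j \<otimes> v" using a_nz w(1) Suc.prems(2) by (simp add: m_lcancel)
    then obtain z where "z \<in> A" "w = a [^] j \<otimes> z" using Suc.IH w(1) Suc.prems(2) by blast
    then have "u = a [^] Suc j \<otimes> z" using w(2) by (simp add: m_ac)
    then show ?case using \<open>z \<in> A\<close> by blast
  qed
qed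

lemma lin_sub_finsum:
  assumes M: "lin_sub A M" and "finite B" "\<And>x. x \<in> B \<Longrightarrow> g x \<in> M"
  shows "(\<Oplus>x\<in>B. g x) \<in> M"
  using assms(2,3)
proof (induction B rule: finite_induct)
  case empty
  then show ?case using lin_subD(2)[OF M] by simp
next
  case (insert x B)
  then have "g \<in> B \<rightarrow> carrier L" "g x \<in> carrier L" using lin_subD(1)[OF M] by auto
  then show ?case using insert lin_subD(3)[OF M] by simp
qed

lemma lin_span_finsum:
  assumes B: "finite B" "B \<subseteq> carrier L" and v: "v \<in> lin_span A B"
  shows "\<exists>c\<in>B \<rightarrow> A. v = (\<Oplus>x\<in>B. c x \<otimes> x)"
  using v
proof induction
  case zero
  have "(\<Oplus>x\<in>B. \<zero> \<otimes> x) = (\<Oplus>x\<in>B. \<zero>)" by (rule finsum_cong') (use B in auto)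
  then have "\<zero> = (\<Oplus>x\<in>B. \<zero> \<otimes> x)" by simp
  then show ?case by (intro bexI[of _ "\<lambda>_. \<zero>"]) auto
next
  case (add r b v)
  then obtain c where c: "c \<in> B \<rightarrow> A" "v = (\<Oplus>x\<in>B. c x \<otimes> x)" by blast
  let ?e = "\<lambda>x. if b = x then r \<otimes> x else \<zero>"
  have eB: "?e \<in> B \<rightarrow> carrier L" using B add by auto
  have cB: "(\<lambda>x. c x \<otimes> x) \<in> B \<rightarrow> carrier L" using B c by (auto simp: Pi_iff)
  have "(\<Oplus>x\<in>B. ?e x) = r \<otimes> b"
    using add.hyps B by (intro add.finprod_singleton) auto
  then have "r \<otimes> b \<oplus> v = (\<Oplus>x\<in>B. ?e x \<oplus> c x \<otimes> x)"
    unfolding c(2) using eB cB by (simp add: finsum_addf)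
  also have "\<dots> = (\<Oplus>x\<in>B. (if b = x then r \<oplus> c x else c x) \<otimes> x)"
    by (rule finsum_cong') (use B c add.hyps in \<open>auto simp: Pi_iff l_distr subset_iff\<close>)
  finally show ?case
    by (intro bexI[of _ "\<lambda>x. if b = x then r \<oplus> c x else c x"]) (use c add.hyps in \<open>auto simp: Pi_iff\<close>)
qed

abbreviation lin_comb :: "'a set \<Rightarrow> ('a \<Rightarrow> 'a) \<Rightarrow> 'a" where
  "lin_comb B c \<equiv> (\<Oplus>x\<in>B. c x \<otimes> x)"

lemma lin_comb_simps:
  assumes B: "finite B" "B \<subseteq> carrier L" and c: "c \<in> B \<rightarrow> A" and d: "d \<in> B \<rightarrow> A" and r: "r \<in> A"
  shows "lin_comb B c \<in> carrier L"
    and "lin_comb B (\<lambda>x. c x \<oplus> d x) = lin_comb B c \<oplus> lin_comb B d"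
    and "lin_comb B (\<lambda>x. r \<otimes> c x) = r \<otimes> lin_comb B c"
proof -
  have cB: "(\<lambda>x. c x \<otimes> x) \<in> B \<rightarrow> carrier L" and dB: "(\<lambda>x. d x \<otimes> x) \<in> B \<rightarrow> carrier L"
    using B c d by (auto simp: Pi_iff)
  show "lin_comb B c \<in> carrier L" using cB by simp
  have "lin_comb B (\<lambda>x. c x \<oplus> d x) = (\<Oplus>x\<in>B. c x \<otimes> x \<oplus> d x \<otimes> x)"
    by (rule finsum_cong') (use B c d in \<open>auto simp: Pi_iff l_distr subset_iff\<close>)
  then show "lin_comb B (\<lambda>x. c x \<oplus> d x) = lin_comb B c \<oplus> lin_comb B d"
    using cB dB by (simp add: finsum_addf)
  have "lin_comb B (\<lambda>x. r \<otimes> c x) = (\<Oplus>x\<in>B. r \<otimes> (c x \<otimes> x))"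
    by (rule finsum_cong') (use B c r in \<open>auto simp: Pi_iff m_assoc subset_iff\<close>)
  then show "lin_comb B (\<lambda>x. r \<otimes> c x) = r \<otimes> lin_comb B c"
    using cB r B by (simp add: finsum_rdistr)
qed

text \<open>Modules of depth two are free. A relation with a unit coefficient would make one generator of a
  minimal generating set superfluous, so that every relation has the form \<open>a s + b t\<close>. Writing \<open>\<Sigma>\<close> for
  linear combinations, \<open>a \<Sigma> s + b \<Sigma> t = 0\<close>, and regularity provides \<open>y\<close> with
  \<open>\<Sigma> t = a \<Sigma> y\<close>; then \<open>t - a y\<close> and \<open>s + b y\<close> are relations, and the given one is
  \<open>a (s + b y) + b (t - a y)\<close>. By induction the coefficients of every relation are in all powers of
  the maximal ideal.\<close>

lemma basis_of_regular:
  assumes M: "lin_sub A M" and fg: "fin_gen A M"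
    and reg: "\<And>u v. u \<in> M \<Longrightarrow> v \<in> M \<Longrightarrow> b \<otimes> u = a \<otimes> v \<Longrightarrow> \<exists>w\<in>M. u = a \<otimes> w"
  shows "\<exists>B\<subseteq>M. finite B \<and> M = lin_span A B \<and>
     (\<forall>c\<in>B \<rightarrow> A. lin_comb B c = \<zero> \<longrightarrow> (\<forall>x\<in>B. c x = \<zero>))"
proof -
  have "\<exists>B. B \<subseteq> M \<and> finite B \<and> M = lin_span A B" using fg unfolding fin_gen_def by blast
  then obtain B where B: "B \<subseteq> M" "finite B" "M = lin_span A B"
    and minimal: "\<And>C. C \<subseteq> M \<Longrightarrow> finite C \<Longrightarrow> M = lin_span A C \<Longrightarrow> card B \<le> card C"
    using ex_has_least_nat[of "\<lambda>B. B \<subseteq> M \<and> finite B \<and> M = lin_span A B" _ card] by metis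
  have BL: "B \<subseteq> carrier L" using B(1) lin_subD(1)[OF M] by blast
  note lc = lin_comb_simps[OF B(2) BL]
  define rels where "rels = {c \<in> B \<rightarrow> A. lin_comb B c = \<zero>}"
  have nonunit: "c x \<otimes> s \<noteq> \<one>" if c: "c \<in> rels" and x: "x \<in> B" and s: "s \<in> A" for c x s
  proof
    assume unit: "c x \<otimes> s = \<one>"
    let ?C = "B - {x}"
    have cA: "c \<in> B \<rightarrow> A" using c unfolding rels_def by blast
    have CL: "?C \<subseteq> carrier L" using BL by blast
    note S = lin_sub_lin_span[OF subring_A CL]
    have xL [simp]: "x \<in> carrier L" and cx [simp]: "c x \<in> A" using x BL cA by auto
    define y where "y = (\<Oplus>z\<in>?C. c z \<otimes> z)"
    have y: "y \<in> lin_span A ?C"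
      unfolding y_def
    proof (rule lin_sub_finsum[OF S])
      fix z assume "z \<in> ?C"
      then show "c z \<otimes> z \<in> lin_span A ?C"
        using lin_subD(4)[OF S] lin_span_base[OF subring_A CL] cA by auto
    qed (use B in simp)
    then have yL: "y \<in> carrier L" using lin_subD(1)[OF S] by blast
    have "lin_comb (insert x ?C) c = c x \<otimes> x \<oplus> y"
      unfolding y_def using B(2) cA BL by (intro finsum_insert) (auto simp: Pi_iff)
    then have "c x \<otimes> x \<oplus> y = \<zero>" using c x unfolding rels_def by (simp add: insert_absorb)
    then have "c x \<otimes> x = \<ominus> y" using yL by (simp add: sum_zero_eq_neg)
    then have "s \<otimes> (c x \<otimes> x) = \<ominus> s \<otimes> y" using s yL by (simp add: l_minus r_minus)
    moreover have "s \<otimes> (c x \<otimes> x) = (c x \<otimes> s) \<otimes> x" using s by (simp add: m_ac)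
    ultimately have "x = \<ominus> s \<otimes> y" using unit by simp
    then have "x \<in> lin_span A ?C" using lin_subD(4)[OF S _ y] s by simp
    then have "B \<subseteq> lin_span A ?C" using lin_span_base[OF subring_A CL] by blast
    then have "M \<subseteq> lin_span A ?C" using lin_span_least[OF S] B(3) by blast
    moreover have "lin_span A ?C \<subseteq> M" using lin_span_least[OF M] B(1) by blast
    ultimately have "card B \<le> card ?C" using minimal[of ?C] B by blast
    moreover have "card ?C < card B" using B(2) x by (rule card_Diff1_less)
    ultimately show False by simp
  qed
  have split: "\<exists>s\<in>rels. \<exists>t\<in>rels. \<forall>x\<in>B. c x = a \<otimes> s x \<oplus> b \<otimes> t x" if c: "c \<in> rels" for c
  proof -
    have cA: "c \<in> B \<rightarrow> A" and c0: "lin_comb B c = \<zero>" using c unfolding rels_def by auto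
    define s where "s x = (SOME u. \<exists>v. u \<in> A \<and> v \<in> A \<and> c x = a \<otimes> u \<oplus> b \<otimes> v)" for x
    define t where "t x = (SOME v. s x \<in> A \<and> v \<in> A \<and> c x = a \<otimes> s x \<oplus> b \<otimes> v)" for x
    have st_ex: "\<exists>u. \<exists>v. u \<in> A \<and> v \<in> A \<and> c x = a \<otimes> u \<oplus> b \<otimes> v" if x: "x \<in> B" for x
      using unit_or_max[of "c x"] nonunit[OF c x] funcset_mem[OF cA x] by blast
    have "s x \<in> A \<and> t x \<in> A \<and> c x = a \<otimes> s x \<oplus> b \<otimes> t x" if x: "x \<in> B" for x
    proof -
      have "\<exists>v. s x \<in> A \<and> v \<in> A \<and> c x = a \<otimes> s x \<oplus> b \<otimes> v"
        unfolding s_def by (rule someI_ex[OF st_ex[OF x]])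
      from someI_ex[OF this] show ?thesis unfolding t_def .
    qed
    then have st: "\<And>x. x \<in> B \<Longrightarrow> s x \<in> A" "\<And>x. x \<in> B \<Longrightarrow> t x \<in> A"
      "\<And>x. x \<in> B \<Longrightarrow> c x = a \<otimes> s x \<oplus> b \<otimes> t x" by simp_all
    then have sB: "s \<in> B \<rightarrow> A" and tB: "t \<in> B \<rightarrow> A" by auto
    have asB: "(\<lambda>x. a \<otimes> s x) \<in> B \<rightarrow> A" and btB: "(\<lambda>x. b \<otimes> t x) \<in> B \<rightarrow> A" using st by auto
    let ?S = "lin_comb B s" and ?T = "lin_comb B t"
    have inM: "lin_comb B d \<in> M" if "d \<in> B \<rightarrow> A" for d
      by (rule lin_sub_finsum[OF M B(2)]) (use that lin_subD(4)[OF M] B(1) in auto)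
    have SM: "?S \<in> M" and TM: "?T \<in> M" using inM sB tB by auto
    have SL [simp]: "?S \<in> carrier L" and TL [simp]: "?T \<in> carrier L" using SM TM lin_subD(1)[OF M] by auto
    have "lin_comb B c = lin_comb B (\<lambda>x. a \<otimes> s x \<oplus> b \<otimes> t x)"
      by (rule finsum_cong') (use st BL in \<open>auto simp: Pi_iff\<close>)
    also have "\<dots> = a \<otimes> ?S \<oplus> b \<otimes> ?T"
      using lc(2)[OF asB btB a_in] lc(3)[OF sB sB a_in] lc(3)[OF tB tB b_in] by simp
    finally have z: "a \<otimes> ?S \<oplus> b \<otimes> ?T = \<zero>" using c0 by simp
    then have "b \<otimes> ?T = a \<otimes> (\<ominus> ?S)"
      using sum_zero_eq_neg[of "a \<otimes> ?S" "b \<otimes> ?T"] by (simp add: r_minus)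
    moreover have "\<ominus> ?S \<in> M" using lin_sub_minus(1)[OF subring_A M SM] .
    ultimately obtain w where w: "w \<in> M" "?T = a \<otimes> w" using reg TM by blast
    have wL: "w \<in> carrier L" using w lin_subD(1)[OF M] by blast
    obtain y where y: "y \<in> B \<rightarrow> A" "w = lin_comb B y" using lin_span_finsum[OF B(2) BL] w B(3) by blast
    have byB: "(\<lambda>x. b \<otimes> y x) \<in> B \<rightarrow> A" and ayB: "(\<lambda>x. \<ominus> a \<otimes> y x) \<in> B \<rightarrow> A"
      using y by (auto simp: Pi_iff)
    have "lin_comb B (\<lambda>x. t x \<oplus> \<ominus> a \<otimes> y x) = ?T \<oplus> \<ominus> a \<otimes> w"
      using lc(2)[OF tB ayB a_in] lc(3)[OF y(1) y(1), of "\<ominus> a"] y(2) by simp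
    also have "\<dots> = \<zero>" unfolding w(2) using wL by (simp add: l_minus r_neg)
    finally have t': "(\<lambda>x. t x \<oplus> \<ominus> a \<otimes> y x) \<in> rels"
      unfolding rels_def using tB y by (auto simp: Pi_iff)
    have "a \<otimes> (?S \<oplus> b \<otimes> w) = a \<otimes> ?S \<oplus> b \<otimes> ?T"
      unfolding w(2) using wL by (simp add: r_distr m_ac)
    then have "a \<otimes> (?S \<oplus> b \<otimes> w) = \<zero>" using z by simp
    then have "?S \<oplus> b \<otimes> w = \<zero>"
      using integral[of a "?S \<oplus> b \<otimes> w"] a_nz wL by simp
    then have "lin_comb B (\<lambda>x. s x \<oplus> b \<otimes> y x) = \<zero>"
      using lc(2)[OF sB byB a_in] lc(3)[OF y(1) y(1) b_in] y(2) by simp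
    then have s': "(\<lambda>x. s x \<oplus> b \<otimes> y x) \<in> rels"
      unfolding rels_def using sB y by (auto simp: Pi_iff)
    have "c x = a \<otimes> (s x \<oplus> b \<otimes> y x) \<oplus> b \<otimes> (t x \<oplus> \<ominus> a \<otimes> y x)" if x: "x \<in> B" for x
    proof -
      have car: "s x \<in> carrier L" "t x \<in> carrier L" "y x \<in> carrier L" "a \<in> carrier L" "b \<in> carrier L"
        using st x y by (auto simp: Pi_iff)
      show ?thesis unfolding st(3)[OF x] using car by algebra
    qed
    then have "\<forall>x\<in>B. c x = a \<otimes> (\<lambda>x. s x \<oplus> b \<otimes> y x) x \<oplus> b \<otimes> (\<lambda>x. t x \<oplus> \<ominus> a \<otimes> y x) x"
      by simp
    then show ?thesis by (intro bexI[OF _ s'] bexI[OF _ t'])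
  qed
  have "c x \<in> two_gen_power A a b n" if "c \<in> rels" "x \<in> B" for c x n
    using that
  proof (induction n arbitrary: c)
    case 0
    then show ?case unfolding rels_def by auto
  next
    case (Suc n)
    obtain s t where "s \<in> rels" "t \<in> rels" "c x = a \<otimes> s x \<oplus> b \<otimes> t x"
      using split[OF Suc.prems(1)] Suc.prems(2) by blast
    then show ?case using Suc.IH Suc.prems(2) by auto
  qed
  then have "c x = \<zero>" if "c \<in> rels" "x \<in> B" for c x using that separated by blast
  then show ?thesis using B unfolding rels_def by blast
qed

lemma coordinates_of_basis:
  assumes M: "lin_sub A M" and B: "B \<subseteq> M" "finite B" "M = lin_span A B"
    and indep: "\<And>c. c \<in> B \<rightarrow> A \<Longrightarrow> lin_comb B c = \<zero> \<Longrightarrow> \<forall>x\<in>B. c x = \<zero>"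
  shows "\<exists>f. (\<forall>x\<in>B. (\<forall>v\<in>M. f x v \<in> A) \<and> (\<forall>u\<in>M. \<forall>v\<in>M. f x (u \<oplus> v) = f x u \<oplus> f x v) \<and>
      (\<forall>r\<in>A. \<forall>v\<in>M. f x (r \<otimes> v) = r \<otimes> f x v)) \<and> (\<forall>v\<in>M. v = (\<Oplus>x\<in>B. f x v \<otimes> x))"
proof -
  have BL: "B \<subseteq> carrier L" using B(1) lin_subD(1)[OF M] by blast
  note lc = lin_comb_simps[OF B(2) BL]
  have "\<forall>v\<in>M. \<exists>c. c \<in> B \<rightarrow> A \<and> v = lin_comb B c" using lin_span_finsum[OF B(2) BL] B(3) by blast
  then obtain g where g: "\<And>v. v \<in> M \<Longrightarrow> g v \<in> B \<rightarrow> A" "\<And>v. v \<in> M \<Longrightarrow> v = lin_comb B (g v)" by metis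
  have unique: "\<forall>x\<in>B. c x = d x" if c: "c \<in> B \<rightarrow> A" and d: "d \<in> B \<rightarrow> A" and eq: "lin_comb B c = lin_comb B d" for c d
  proof -
    have nd: "(\<lambda>x. \<ominus> \<one> \<otimes> d x) \<in> B \<rightarrow> A" using d by (auto simp: Pi_iff)
    have "lin_comb B (\<lambda>x. c x \<oplus> \<ominus> \<one> \<otimes> d x) = lin_comb B d \<oplus> \<ominus> \<one> \<otimes> lin_comb B d"
      using lc(2)[OF c nd a_in] lc(3)[OF d d, of "\<ominus> \<one>"] eq by simp
    also have "\<dots> = \<zero>" using lc(1)[OF d d a_in] by (simp add: l_minus r_neg)
    finally have "\<forall>x\<in>B. c x \<oplus> \<ominus> \<one> \<otimes> d x = \<zero>"
      using c nd by (intro indep) (auto simp: Pi_iff)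
    then have "\<forall>x\<in>B. c x \<ominus> d x = \<zero>" using d by (auto simp: Pi_iff l_minus minus_eq)
    then show ?thesis using c d by (auto simp: Pi_iff)
  qed
  have "g (u \<oplus> v) x = g u x \<oplus> g v x" if "u \<in> M" "v \<in> M" "x \<in> B" for u v x
  proof -
    have "lin_comb B (g (u \<oplus> v)) = u \<oplus> v" using g(2) lin_subD(3)[OF M that(1,2)] by simp
    also have "\<dots> = lin_comb B (\<lambda>x. g u x \<oplus> g v x)"
      using lc(2)[OF g(1) g(1) a_in] g(2) that(1,2) by simp
    finally show ?thesis
      using unique[of "g (u \<oplus> v)" "\<lambda>x. g u x \<oplus> g v x"] g(1) lin_subD(3)[OF M that(1,2)] that by (auto simp: Pi_iff)
  qed
  moreover have "g (r \<otimes> v) x = r \<otimes> g v x" if "r \<in> A" "v \<in> M" "x \<in> B" for r v x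
  proof -
    have "lin_comb B (g (r \<otimes> v)) = r \<otimes> v" using g(2) lin_subD(4)[OF M that(1,2)] by simp
    also have "\<dots> = lin_comb B (\<lambda>x. r \<otimes> g v x)"
      using lc(3)[OF g(1) g(1) that(1)] g(2) that(2) by simp
    finally show ?thesis
      using unique[of "g (r \<otimes> v)" "\<lambda>x. r \<otimes> g v x"] g(1) lin_subD(4)[OF M that(1,2)] that by (auto simp: Pi_iff)
  qed
  moreover have "g v x \<in> A" if "v \<in> M" "x \<in> B" for v x using g(1) that by blast
  ultimately show ?thesis using g(2) by (intro exI[of _ "\<lambda>x v. g v x"]) blast
qed

text \<open>For an \<open>A\<close>-submodule \<open>N\<close> these are the sections of \<open>N\<close> over the punctured spectrum of \<open>A\<close>. The passage
  from \<open>N\<close> to its saturation enforces the hypothesis of \<open>basis_of_regular\<close>; see \<open>saturation_regular\<close>.\<close>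

definition saturation :: "'a set \<Rightarrow> 'a set" where
  "saturation N = {y \<in> carrier L. \<exists>k::nat. a [^] k \<otimes> y \<in> N \<and> b [^] k \<otimes> y \<in> N}"

lemma saturation_raise:
  assumes N: "lin_sub A N" and "y \<in> carrier L" and "a [^] (k::nat) \<otimes> y \<in> N" "b [^] (l::nat) \<otimes> y \<in> N"
  shows "y \<in> saturation N"
proof -
  have "a [^] (k + l) \<otimes> y = a [^] l \<otimes> (a [^] k \<otimes> y)" "b [^] (k + l) \<otimes> y = b [^] k \<otimes> (b [^] l \<otimes> y)"
    using assms(2) by (simp_all add: nat_pow_mult[symmetric] m_ac)
  then have "a [^] (k + l) \<otimes> y \<in> N \<and> b [^] (k + l) \<otimes> y \<in> N"
    using lin_subD(4)[OF N] assms(3,4) by simp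
  then show ?thesis unfolding saturation_def using assms(2) by blast
qed

lemma saturation_incl: "N \<subseteq> carrier L \<Longrightarrow> N \<subseteq> saturation N"
  unfolding saturation_def by (auto intro!: exI[of _ "0::nat"])

lemma lin_sub_saturation:
  assumes N: "lin_sub A N"
  shows "lin_sub A (saturation N)"
proof (rule lin_subI)
  show "saturation N \<subseteq> carrier L" unfolding saturation_def by blast
  show "\<zero> \<in> saturation N" using saturation_incl[OF lin_subD(1)[OF N]] lin_subD(2)[OF N] by blast
  fix u v assume "u \<in> saturation N" "v \<in> saturation N"
  then obtain k l :: nat where kl: "u \<in> carrier L" "v \<in> carrier L" "a [^] k \<otimes> u \<in> N" "b [^] k \<otimes> u \<in> N"
     "a [^] l \<otimes> v \<in> N" "b [^] l \<otimes> v \<in> N" unfolding saturation_def by blast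
  have "x [^] (k + l) \<otimes> (u \<oplus> v) \<in> N" if "x \<in> A" "x [^] k \<otimes> u \<in> N" "x [^] l \<otimes> v \<in> N" for x
  proof -
    have "x [^] (k + l) \<otimes> (u \<oplus> v) = x [^] l \<otimes> (x [^] k \<otimes> u) \<oplus> x [^] k \<otimes> (x [^] l \<otimes> v)"
      using kl(1,2) that(1) by (simp add: nat_pow_mult[symmetric] r_distr m_ac)
    then show ?thesis using lin_subD(3,4)[OF N] that by simp
  qed
  then have "a [^] (k + l) \<otimes> (u \<oplus> v) \<in> N" "b [^] (k + l) \<otimes> (u \<oplus> v) \<in> N" using kl by auto
  then show "u \<oplus> v \<in> saturation N" using kl(1,2) unfolding saturation_def by blast
next
  fix r u assume r: "r \<in> A" and "u \<in> saturation N"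
  then obtain k :: nat where k: "u \<in> carrier L" "a [^] k \<otimes> u \<in> N" "b [^] k \<otimes> u \<in> N" unfolding saturation_def by blast
  have "x [^] k \<otimes> (r \<otimes> u) = r \<otimes> (x [^] k \<otimes> u)" if "x \<in> A" for x using k(1) r that by (simp add: m_ac)
  then have "a [^] k \<otimes> (r \<otimes> u) \<in> N" "b [^] k \<otimes> (r \<otimes> u) \<in> N" using k lin_subD(4)[OF N r] by simp_all
  then show "r \<otimes> u \<in> saturation N" unfolding saturation_def using k(1) r by auto
qed

lemma subring_saturation:
  assumes N: "subring N L" and AN: "A \<subseteq> N"
  shows "subring (saturation N) L"
proof -
  have lN: "lin_sub A N" by (rule lin_subI) (use subringE[OF N] AN in auto)
  note S = lin_sub_saturation[OF lN]
  show ?thesis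
  proof (rule subringI)
    show "saturation N \<subseteq> carrier L" using lin_subD(1)[OF S] .
    show "\<one> \<in> saturation N" using saturation_incl[OF subringE(1)[OF N]] subringE(3)[OF N] by blast
    show "\<ominus> h \<in> saturation N" if "h \<in> saturation N" for h using lin_sub_minus(1)[OF subring_A S that] .
    show "h \<oplus> k \<in> saturation N" if "h \<in> saturation N" "k \<in> saturation N" for h k using lin_subD(3)[OF S that] .
    fix u v assume "u \<in> saturation N" "v \<in> saturation N"
    then obtain k l :: nat where kl: "u \<in> carrier L" "v \<in> carrier L" "a [^] k \<otimes> u \<in> N" "b [^] k \<otimes> u \<in> N"
       "a [^] l \<otimes> v \<in> N" "b [^] l \<otimes> v \<in> N" unfolding saturation_def by blast
    have "x [^] (k + l) \<otimes> (u \<otimes> v) = (x [^] k \<otimes> u) \<otimes> (x [^] l \<otimes> v)" if "x \<in> A" for x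
      using kl(1,2) that by (simp add: nat_pow_mult[symmetric] m_ac)
    then have "a [^] (k + l) \<otimes> (u \<otimes> v) \<in> N" "b [^] (k + l) \<otimes> (u \<otimes> v) \<in> N"
      using kl subringE(6)[OF N] by simp_all
    then show "u \<otimes> v \<in> saturation N" unfolding saturation_def using kl by auto
  qed
qed

text \<open>If \<open>a\<^sup>k y\<close> and \<open>b\<^sup>k y\<close> are in \<open>A\<close>, then \<open>b\<^sup>k (a\<^sup>k y) = a\<^sup>k (b\<^sup>k y)\<close>, and regularity shows that \<open>a\<^sup>k y\<close> is a
  multiple of \<open>a\<^sup>k\<close>.\<close>

lemma saturation_A: "saturation A = A"
proof
  show "saturation A \<subseteq> A"
  proof
    fix y assume "y \<in> saturation A"
    then obtain k :: nat where y: "y \<in> carrier L" "a [^] k \<otimes> y \<in> A" "b [^] k \<otimes> y \<in> A" unfolding saturation_def by blast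
    have "b [^] k \<otimes> (a [^] k \<otimes> y) = a [^] k \<otimes> (b [^] k \<otimes> y)" using y(1) by (simp add: m_ac)
    then obtain w where w: "w \<in> A" "a [^] k \<otimes> y = a [^] k \<otimes> w"
      using power_regular_sequence[OF y(2,3)] by blast
    have "a [^] k \<noteq> \<zero>" using a_nz by (simp add: pow_nz)
    then have "y = w" using w y(1) by (simp add: m_lcancel)
    then show "y \<in> A" using w by simp
  qed
  show "A \<subseteq> saturation A" by (rule saturation_incl) auto
qed

text \<open>From \<open>b u = a v\<close> the element \<open>w = u / a\<close> of the field satisfies \<open>a w = u\<close> and \<open>b w = v\<close>, so that powers
  of \<open>a\<close> and of \<open>b\<close> multiply it into \<open>N\<close>.\<close>

lemma saturation_regular:
  assumes N: "lin_sub A N" and u: "u \<in> saturation N" and v: "v \<in> saturation N" and eq: "b \<otimes> u = a \<otimes> v"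
  shows "\<exists>w\<in>saturation N. u = a \<otimes> w"
proof -
  obtain k l :: nat where kl: "u \<in> carrier L" "v \<in> carrier L" "a [^] k \<otimes> u \<in> N" "b [^] l \<otimes> v \<in> N"
    using u v unfolding saturation_def by blast
  define w where "w = inv a \<otimes> u"
  have ia: "inv a \<in> carrier L" "a \<otimes> inv a = \<one>" using a_nz by (simp_all add: field_Units)
  have wL: "w \<in> carrier L" using ia kl unfolding w_def by simp
  have uw: "u = a \<otimes> w"
  proof -
    have "a \<otimes> w = (a \<otimes> inv a) \<otimes> u" unfolding w_def using ia(1) kl(1) by (simp add: m_assoc)
    then show ?thesis using ia(2) kl(1) by simp
  qed
  have "a \<otimes> (b \<otimes> w) = a \<otimes> v" using eq unfolding uw using wL by (simp add: m_ac)
  then have vw: "v = b \<otimes> w" using a_nz wL kl(2) by (simp add: m_lcancel)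
  have "a [^] Suc k \<otimes> w = a [^] k \<otimes> u" "b [^] Suc l \<otimes> w = b [^] l \<otimes> v"
    unfolding uw vw using wL by (simp_all add: m_ac)
  then have "w \<in> saturation N" using saturation_raise[OF N wL, of "Suc k" "Suc l"] kl by simp
  then show ?thesis using uw by blast
qed

text \<open>A ring between \<open>A\<close> and its fraction field with bounded denominators is contained in \<open>A\<close>. Its
  saturation is free over \<open>A\<close>, of rank one since any two elements of the fraction field are linearly
  dependent. With \<open>e\<close> as basis, \<open>e e = r e\<close> for some \<open>r \<in> A\<close>, hence \<open>e = r\<close> is in \<open>A\<close>.\<close>

lemma normal:
  assumes N: "subring N L" and AN: "A \<subseteq> N" and d: "d \<in> A" "d \<noteq> \<zero>"
    and dN: "\<And>y. y \<in> N \<Longrightarrow> d \<otimes> y \<in> A"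
  shows "N \<subseteq> A"
proof -
  have lN: "lin_sub A N" by (rule lin_subI) (use subringE[OF N] AN in auto)
  let ?S = "saturation N"
  note S = lin_sub_saturation[OF lN] and SR = subring_saturation[OF N AN]
  have SL: "y \<in> carrier L" if "y \<in> ?S" for y using that lin_subD(1)[OF S] by blast
  have dS: "d \<otimes> y \<in> A" if y: "y \<in> ?S" for y
  proof -
    obtain k :: nat where k: "y \<in> carrier L" "a [^] k \<otimes> y \<in> N" "b [^] k \<otimes> y \<in> N" using y unfolding saturation_def by blast
    have "a [^] k \<otimes> (d \<otimes> y) = d \<otimes> (a [^] k \<otimes> y)" "b [^] k \<otimes> (d \<otimes> y) = d \<otimes> (b [^] k \<otimes> y)"
      using k(1) d by (simp_all add: m_ac)
    then have "a [^] k \<otimes> (d \<otimes> y) \<in> A" "b [^] k \<otimes> (d \<otimes> y) \<in> A" using dN k by simp_all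
    then have "d \<otimes> y \<in> saturation A" unfolding saturation_def using k d by auto
    then show ?thesis by (simp add: saturation_A)
  qed
  have fg: "fin_gen A ?S"
  proof (rule fin_gen_by_functionals[OF subring_A noeth, of "{\<lambda>y. d \<otimes> y}"])
    show "lin_sub A ?S" by (rule S)
    fix v assume "v \<in> ?S" "\<And>f. f \<in> {(\<otimes>) d} \<Longrightarrow> f v = \<zero>"
    then show "v = \<zero>" using d SL[of v] by (metis A_carrier integral singletonI)
  next
    fix f u v assume f: "f \<in> {\<lambda>y. d \<otimes> y}" "u \<in> ?S" "v \<in> ?S"
    then show "f (u \<oplus> v) = f u \<oplus> f v" using d SL by (simp add: r_distr)
  next
    fix f r v assume f: "f \<in> {\<lambda>y. d \<otimes> y}" "r \<in> A" "v \<in> ?S"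
    then show "f (r \<otimes> v) = r \<otimes> f v" using d SL by (simp add: m_ac)
  qed (use dS in auto)
  have "\<exists>B\<subseteq>?S. finite B \<and> ?S = lin_span A B \<and>
     (\<forall>c\<in>B \<rightarrow> A. lin_comb B c = \<zero> \<longrightarrow> (\<forall>x\<in>B. c x = \<zero>))"
    by (rule basis_of_regular[OF S fg saturation_regular[OF lN]])
  then obtain B where B: "B \<subseteq> ?S" "finite B" "?S = lin_span A B"
    and indep: "\<And>c. c \<in> B \<rightarrow> A \<Longrightarrow> lin_comb B c = \<zero> \<Longrightarrow> \<forall>x\<in>B. c x = \<zero>"
    by auto
  have BL: "B \<subseteq> carrier L" using B(1) SL by blast
  note lc = lin_comb_simps[OF B(2) BL]
  have single: "lin_comb B (\<lambda>z. if x = z then r else \<zero>) = r \<otimes> x" if "x \<in> B" "r \<in> A" for x r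
  proof -
    have "lin_comb B (\<lambda>z. if x = z then r else \<zero>) = (\<Oplus>z\<in>B. if x = z then r \<otimes> z else \<zero>)"
      by (rule finsum_cong') (use BL that in \<open>auto simp: subset_iff\<close>)
    also have "\<dots> = r \<otimes> x" using that B(2) BL by (intro add.finprod_singleton) auto
    finally show ?thesis .
  qed
  have nz: "x \<noteq> \<zero>" if x: "x \<in> B" for x
  proof
    assume "x = \<zero>"
    then have "lin_comb B (\<lambda>z. if x = z then \<one> else \<zero>) = \<zero>" using single[OF x, of \<one>] by simp
    from indep[OF _ this] x show False by auto
  qed
  have at_most_one: "x = y" if x: "x \<in> B" and y: "y \<in> B" for x y
  proof (rule ccontr)
    assume "x \<noteq> y"
    have xL: "x \<in> carrier L" and yL: "y \<in> carrier L" using x y BL by auto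
    have dx: "d \<otimes> x \<in> A" and dy: "d \<otimes> y \<in> A" using dS x y B(1) by auto
    \<comment> \<open>The relation \<open>(d y) x - (d x) y = 0\<close> has coefficients in \<open>A\<close>.\<close>
    let ?c = "\<lambda>z. (if x = z then d \<otimes> y else \<zero>) \<oplus> (if y = z then \<ominus> (d \<otimes> x) else \<zero>)"
    have "lin_comb B ?c = (d \<otimes> y) \<otimes> x \<oplus> (\<ominus> (d \<otimes> x)) \<otimes> y"
      using lc(2)[of "\<lambda>z. if x = z then d \<otimes> y else \<zero>" "\<lambda>z. if y = z then \<ominus> (d \<otimes> x) else \<zero>" a]
        single[OF x dy] single[OF y A_closed(3)[OF dx]] dx dy by simp
    also have "\<dots> = \<zero>" using xL yL d(1) by (simp add: l_minus r_minus m_ac r_neg)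
    finally have "\<forall>z\<in>B. ?c z = \<zero>" using dx dy by (intro indep) auto
    then have "d \<otimes> y = \<zero>" using x \<open>x \<noteq> y\<close> dy by force
    then show False using nz[OF y] yL d by (metis A_carrier integral)
  qed
  have "\<one> \<in> ?S" using subringE(3)[OF SR] .
  have "B \<noteq> {}"
  proof
    assume "B = {}"
    then have "x = \<zero>" if "x \<in> ?S" for x using lin_span_finsum[OF B(2) BL] that B(3) by auto
    then show False using \<open>\<one> \<in> ?S\<close> by force
  qed
  then obtain e where e: "e \<in> B" by blast
  then have Be: "B = {e}" using at_most_one by blast
  have eL: "e \<in> carrier L" using BL e by blast
  have span: "\<exists>r\<in>A. x = r \<otimes> e" if xS: "x \<in> ?S" for x
  proof -
    have "x \<in> lin_span A B" using xS B(3) by simp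
    from lin_span_finsum[OF B(2) BL this] obtain c where "c \<in> B \<rightarrow> A" "x = lin_comb B c" by (elim bexE)
    then show ?thesis unfolding Be using eL by auto
  qed
  have "e \<otimes> e \<in> ?S" using subringE(6)[OF SR] e B(1) by blast
  then obtain r where r: "r \<in> A" "e \<otimes> e = r \<otimes> e" using span by blast
  then have "e = r" using nz[OF e] eL by (simp add: m_rcancel)
  then have "e \<in> A" using r(1) by simp
  have "?S \<subseteq> A"
  proof
    fix x assume "x \<in> ?S"
    from span[OF this] obtain r' where "r' \<in> A" "x = r' \<otimes> e" by (elim bexE)
    then show "x \<in> A" using \<open>e \<in> A\<close> by simp
  qed
  then show ?thesis using saturation_incl[OF subringE(1)[OF N]] by blast
qed

end

section \<open>Powers of one element\<close>

context cring
begin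

abbreviation nat_elem :: "nat \<Rightarrow> 'a" where
  "nat_elem n \<equiv> add_pow R n \<one>"

text \<open>Monic equations are expressed through spans of powers: \<open>z\<close> satisfies a monic equation of degree \<open>n\<close>
  over \<open>A\<close> if and only if \<open>z\<^sup>n\<close> is in the span of the lower powers. The lemmas on \<open>eval\<close> translate to lists
  of coefficients, highest degree first.\<close>

abbreviation powers_below :: "'a \<Rightarrow> nat \<Rightarrow> 'a set" where
  "powers_below z n \<equiv> (\<lambda>i. z [^] i) ` {..<n}"

lemma powers_below_carrier: "z \<in> carrier R \<Longrightarrow> powers_below z n \<subseteq> carrier R"
  by auto

lemma powers_below_Suc: "powers_below z (Suc n) = insert (z [^] n) (powers_below z n)"
  by (simp add: lessThan_Suc)

lemma eval_Cons: "eval (c # cs) x = c \<otimes> x [^] length cs \<oplus> eval cs x"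
  by simp

declare eval.simps(2) [simp del]

lemma eval_mem_span:
  assumes A: "subring A R" and z: "z \<in> carrier R" and "set cs \<subseteq> A"
  shows "eval cs z \<in> lin_span A (powers_below z (length cs))"
  using assms(3)
proof (induction cs)
  case Nil
  then show ?case by (simp add: lin_span.zero)
next
  case (Cons c cs)
  then show ?case
    using lin_span_insertI[OF A powers_below_carrier[OF z] nat_pow_closed[OF z], of c "eval cs z" "length cs" "length cs"]
    by (simp add: eval_Cons powers_below_Suc del: image_insert lessThan_Suc)
qed

lemma mem_span_eval:
  assumes A: "subring A R" and z: "z \<in> carrier R" and "u \<in> lin_span A (powers_below z n)"
  shows "\<exists>cs. length cs = n \<and> set cs \<subseteq> A \<and> u = eval cs z"
  using assms(3)
proof (induction n arbitrary: u)
  case 0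
  then show ?case by (simp add: lin_span_empty)
next
  case (Suc n)
  obtain r v where "r \<in> A" "v \<in> lin_span A (powers_below z n)" "u = r \<otimes> z [^] n \<oplus> v"
    using lin_span_insertE[OF A powers_below_carrier[OF z] nat_pow_closed[OF z]] Suc.prems
    unfolding powers_below_Suc by metis
  moreover from Suc.IH[OF this(2)] obtain cs where "length cs = n" "set cs \<subseteq> A" "v = eval cs z" by blast
  ultimately show ?case by (intro exI[of _ "r # cs"]) (auto simp: eval_Cons)
qed

text \<open>The span is closed under multiplication by \<open>z\<close>, hence under multiplication by all powers of \<open>z\<close>.\<close>

lemma subring_span_powers:
  assumes A: "subring A R" and z: "z \<in> carrier R" and n: "0 < n"
    and zn: "z [^] n \<in> lin_span A (powers_below z n)"
  shows "subring (lin_span A (powers_below z n)) R" and "A \<subseteq> lin_span A (powers_below z n)"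
    and "z [^] (i::nat) \<in> lin_span A (powers_below z n)"
proof -
  let ?S = "lin_span A (powers_below z n)"
  note Ac = subringE(1)[OF A] and P = powers_below_carrier[OF z, of n]
  note S = lin_sub_lin_span[OF A P]
  note SD = lin_subD[OF S]
  have base: "z [^] i \<in> ?S" if "i < n" for i using lin_span_base[OF A P] that by blast
  have shift: "z \<otimes> v \<in> ?S" if "v \<in> ?S" for v
    using that
  proof induction
    case zero
    then show ?case using z SD(2) by simp
  next
    case (add r b v)
    then obtain i :: nat where i: "b = z [^] i" "i < n" by blast
    have c: "r \<in> carrier R" "v \<in> carrier R" using add Ac SD(1) by auto
    have "z [^] Suc i \<in> ?S"
    proof (cases "Suc i = n")
      case True
      then show ?thesis using zn by simp
    next
      case False
      then show ?thesis using base[of "Suc i"] i by simp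
    qed
    then have "r \<otimes> z [^] Suc i \<oplus> z \<otimes> v \<in> ?S" using SD(3,4) add by blast
    then show ?case unfolding i(1) using c z by (simp add: r_distr m_ac)
  qed
  show pw: "z [^] i \<in> ?S" for i :: nat
  proof (induction i)
    case 0
    then show ?case using base[OF n] .
  next
    case (Suc i)
    then show ?case using shift[OF Suc] z by (simp add: m_comm)
  qed
  show AS: "A \<subseteq> ?S"
  proof
    fix r assume r: "r \<in> A"
    then have "r \<otimes> z [^] (0::nat) \<in> ?S" using SD(4) pw by blast
    then show "r \<in> ?S" using r Ac by auto
  qed
  show "subring ?S R"
  proof (rule subringI)
    show "?S \<subseteq> carrier R" by (rule SD(1))
    show "\<one> \<in> ?S" using AS subringE(3)[OF A] by blast
    show "\<ominus> h \<in> ?S" if "h \<in> ?S" for h using lin_sub_minus(1)[OF A S that] .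
    show "h \<oplus> k \<in> ?S" if "h \<in> ?S" "k \<in> ?S" for h k using SD(3)[OF that] .
    fix u v assume u: "u \<in> ?S" and v: "v \<in> ?S"
    have vc: "v \<in> carrier R" using v SD(1) by blast
    have pv: "z [^] i \<otimes> v \<in> ?S" for i :: nat
    proof (induction i)
      case 0
      then show ?case using v vc by simp
    next
      case (Suc i)
      then show ?case using shift[OF Suc] z vc by (simp add: m_ac)
    qed
    from u show "u \<otimes> v \<in> ?S"
    proof induction
      case zero
      then show ?case using vc SD(2) by simp
    next
      case (add r b w)
      then obtain i :: nat where i: "b = z [^] i" by blast
      have c: "r \<in> carrier R" "w \<in> carrier R" using add Ac SD(1) by auto
      have "r \<otimes> (z [^] i \<otimes> v) \<oplus> w \<otimes> v \<in> ?S" using SD(3,4) add pv by blast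
      then show ?case unfolding i(1) using c z vc by (simp add: l_distr m_assoc)
    qed
  qed
qed

definition integral_elem :: "'a set \<Rightarrow> 'a \<Rightarrow> bool" where
  "integral_elem A z \<longleftrightarrow> z \<in> carrier R \<and> (\<exists>n>0. z [^] (n::nat) \<in> lin_span A (powers_below z n))"

lemma lin_span_coeff_mono: "A \<subseteq> A' \<Longrightarrow> lin_span A B \<subseteq> lin_span A' B"
proof
  fix x assume "A \<subseteq> A'" "x \<in> lin_span A B"
  from this(2,1) show "x \<in> lin_span A' B" by induction (auto intro: lin_span.intros)
qed

lemma integral_elem_mono: "A \<subseteq> A' \<Longrightarrow> integral_elem A z \<Longrightarrow> integral_elem A' z"
  unfolding integral_elem_def using lin_span_coeff_mono[of A A'] by blast

lemma integral_elem_in: "z \<in> A \<Longrightarrow> subring A R \<Longrightarrow> integral_elem A z"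
proof -
  assume z: "z \<in> A" and A: "subring A R"
  then have c: "z \<in> carrier R" using subringE(1) by blast
  have "z \<otimes> \<one> \<oplus> \<zero> \<in> lin_span A {\<one>}" using z by (intro lin_span.intros) auto
  moreover have "powers_below z 1 = {\<one>}" by auto
  ultimately have "z [^] (1::nat) \<in> lin_span A (powers_below z 1)" using c by simp
  then show ?thesis unfolding integral_elem_def using c by blast
qed

lemma integral_elem_least:
  assumes "integral_elem A z"
  obtains n :: nat where "n > 0" "z [^] n \<in> lin_span A (powers_below z n)"
    "\<And>k. 0 < k \<Longrightarrow> k < n \<Longrightarrow> z [^] k \<notin> lin_span A (powers_below z k)"
proof -
  let ?P = "\<lambda>n. n > 0 \<and> z [^] n \<in> lin_span A (powers_below z n)"
  have "\<exists>n. ?P n" using assms unfolding integral_elem_def by blast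
  then have 1: "?P (LEAST n. ?P n)" by (rule LeastI_ex)
  have 2: "\<not> ?P k" if "k < (LEAST n. ?P n)" for k using that by (rule not_less_Least)
  show thesis using 1 2 by (intro that[of "LEAST n. ?P n"]) auto
qed

end

section \<open>Automorphisms of an algebraic closure\<close>

text \<open>An algebraic closure \<open>L\<close> of \<open>K\<close>. The list \<open>\<one> # cs\<close> is a monic polynomial of degree \<open>length cs\<close>.\<close>

locale alg_closed_over = field L for L (structure) +
  fixes K
  assumes K: "subfield K L"
    and has_root: "\<And>cs. set cs \<subseteq> carrier L \<Longrightarrow> cs \<noteq> [] \<Longrightarrow> \<exists>z\<in>carrier L. eval (\<one> # cs) z = \<zero>"
    and finite_roots: "\<And>cs. set cs \<subseteq> carrier L \<Longrightarrow> finite {z \<in> carrier L. eval (\<one> # cs) z = \<zero>}"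
    and integral: "\<And>z. z \<in> carrier L \<Longrightarrow> integral_elem K z"
begin

lemma subring_K: "subring K L" using subfieldE(1)[OF K] .

lemma K_carrier: "k \<in> K \<Longrightarrow> k \<in> carrier L" using subfieldE(3)[OF K] by blast

lemma one_not_zero_span: "\<one> \<notin> lin_span A (powers_below z 0)"
  using one_not_zero by (simp add: lin_span_empty)

text \<open>In an equation \<open>y\<^sup>n = c + y w\<close> of minimal degree over \<open>K\<close> the constant term \<open>c\<close> is nonzero, for otherwise
  division by \<open>y\<close> would lower the degree; solving for \<open>c\<close> inverts \<open>y\<close>.\<close>

lemma inverse_of_algebraic:
  assumes D: "subring D L" and KD: "K \<subseteq> D" and y: "y \<in> D" "y \<noteq> \<zero>"
  shows "inv y \<in> D"
proof -
  have yL: "y \<in> carrier L" using y subringE(1)[OF D] by blast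
  obtain n :: nat where n: "n > 0" "y [^] n \<in> lin_span K (powers_below y n)"
    "\<And>k. 0 < k \<Longrightarrow> k < n \<Longrightarrow> y [^] k \<notin> lin_span K (powers_below y k)"
    using integral_elem_least[OF integral[OF yL]] by blast
  obtain m where m: "n = Suc m" using n(1) by (cases n) auto
  have PD: "lin_span K (powers_below y k) \<subseteq> D" for k
  proof (rule lin_span_least)
    show "lin_sub K D" by (rule lin_subI) (use subringE[OF D] KD in auto)
    have "y [^] i \<in> D" for i :: nat by (induction i) (use subringE[OF D] y in auto)
    then show "powers_below y k \<subseteq> D" by auto
  qed
  have split: "\<exists>c\<in>K. \<exists>w\<in>lin_span K (powers_below y m). v = c \<oplus> y \<otimes> w"
    if vm: "v \<in> lin_span K (powers_below y (Suc m))" for v m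
  proof -
    have "powers_below y (Suc m) = insert \<one> ((\<otimes>) y ` powers_below y m)"
    proof -
      have "{..<Suc m} = insert 0 (Suc ` {..<m})" by (rule lessThan_Suc_eq_insert_0)
      then show ?thesis using yL by (auto simp: image_image m_comm)
    qed
    then have vm': "v \<in> lin_span K (insert \<one> ((\<otimes>) y ` powers_below y m))" using vm by simp
    have yP: "(\<otimes>) y ` powers_below y m \<subseteq> carrier L" using yL by auto
    obtain c w where cw: "c \<in> K" "w \<in> lin_span K ((\<otimes>) y ` powers_below y m)" "v = c \<otimes> \<one> \<oplus> w"
      by (rule lin_span_insertE[OF subring_K yP one_closed vm'])
    from cw(2) have "\<exists>w'\<in>lin_span K (powers_below y m). w = y \<otimes> w'"
    proof induction
      case zero
      then show ?case using yL by (intro bexI[of _ \<zero>]) (auto intro: lin_span.zero)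
    next
      case (add r b v)
      then obtain b' v' where *: "b' \<in> powers_below y m" "b = y \<otimes> b'" "v' \<in> lin_span K (powers_below y m)" "v = y \<otimes> v'"
        by blast
      have "b' \<in> carrier L" "v' \<in> carrier L" "r \<in> carrier L"
        using * yL K_carrier[OF add(1)] lin_span_carrier[OF subfieldE(3)[OF K] powers_below_carrier[OF yL]] by auto
      then have "r \<otimes> b \<oplus> v = y \<otimes> (r \<otimes> b' \<oplus> v')" unfolding *(2,4) using yL by (simp add: r_distr m_ac)
      then show ?case using lin_span.add[OF add(1) *(1,3)] by blast
    qed
    then show ?thesis using cw K_carrier by auto
  qed
  obtain c w where cw: "c \<in> K" "w \<in> lin_span K (powers_below y m)" "y [^] n = c \<oplus> y \<otimes> w"
    using split n(2) unfolding m by blast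
  have wL: "w \<in> carrier L" and cL: "c \<in> carrier L" and wD: "w \<in> D"
    using cw PD K_carrier subringE(1)[OF D] by auto
  define d where "d = y [^] m \<ominus> w"
  have dD: "d \<in> D"
  proof -
    have "y [^] m \<in> D" by (induction m) (use subringE[OF D] y in auto)
    then show ?thesis unfolding d_def using wD subringE[OF D] by (auto simp: minus_eq)
  qed
  have dL: "d \<in> carrier L" using dD subringE(1)[OF D] by blast
  have yd: "y \<otimes> d = c"
  proof -
    have "y \<otimes> d = y [^] n \<ominus> y \<otimes> w" unfolding d_def m using yL wL
      by (simp add: minus_eq r_distr r_minus m_comm)
    also have "\<dots> = c" unfolding cw(3) using yL wL cL by algebra
    finally show ?thesis .
  qed
  have "c \<noteq> \<zero>"
  proof
    assume "c = \<zero>"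
    then have "d = \<zero>" using yd y(2) yL dL integral_iff by blast
    then have "y [^] m = w" unfolding d_def using yL wL by (simp add: r_right_minus_eq)
    then have yw: "y [^] m \<in> lin_span K (powers_below y m)" using cw(2) by simp
    show False
    proof (cases m)
      case 0
      then show False using yw one_not_zero_span by simp
    next
      case (Suc m')
      then show False using yw n(3)[of m] m by simp
    qed
  qed
  then have ic: "inv c \<in> K" "inv c \<in> carrier L" "c \<otimes> inv c = \<one>"
    using subfield_m_inv[OF K] cw(1) K_carrier by auto
  have "y \<otimes> (d \<otimes> inv c) = \<one>" using yd ic yL dL by (simp add: m_assoc[symmetric])
  then have "inv y = d \<otimes> inv c"
    using yL dL ic(2) by (intro comm_inv_char) auto
  then show ?thesis using dD ic(1) KD subringE(6)[OF D] by auto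
qed

abbreviation LL :: "('a \<times> 'a) ring" where "LL \<equiv> RDirProd L L"

lemma cring_LL: "cring LL"
proof -
  interpret P: ring LL by (rule RDirProd_ring) (rule ring_axioms)+
  show ?thesis
    by unfold_locales (auto simp: RDirProd_def DirProd_def monoid.defs m_comm)
qed

lemma LL_simps: "carrier LL = carrier L \<times> carrier L"
  "(u, v) \<oplus>\<^bsub>LL\<^esub> (u', v') = (u \<oplus> u', v \<oplus> v')" "(u, v) \<otimes>\<^bsub>LL\<^esub> (u', v') = (u \<otimes> u', v \<otimes> v')"
  "\<zero>\<^bsub>LL\<^esub> = (\<zero>, \<zero>)" "\<one>\<^bsub>LL\<^esub> = (\<one>, \<one>)"
  by (auto simp: RDirProd_def DirProd_def monoid.defs)

lemma LL_minus: "u \<in> carrier L \<Longrightarrow> v \<in> carrier L \<Longrightarrow> \<ominus>\<^bsub>LL\<^esub> (u, v) = (\<ominus> u, \<ominus> v)"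
proof -
  assume uv: "u \<in> carrier L" "v \<in> carrier L"
  interpret P: cring LL by (rule cring_LL)
  show ?thesis using uv by (intro P.minus_equality) (auto simp: LL_simps l_neg)
qed

lemma LL_pow: "(u, v) [^]\<^bsub>LL\<^esub> (n::nat) = (u [^] n, v [^] n)"
  by (induction n) (auto simp: LL_simps)

text \<open>Graphs of \<open>K\<close>-homomorphisms from subrings of \<open>L\<close> to \<open>L\<close>, as subrings of \<open>L \<times> L\<close>. In this form unions
  of chains need no gluing. The domain is a field by \<open>inverse_of_algebraic\<close>.\<close>

definition partial_hom :: "('a \<times> 'a) set \<Rightarrow> bool" where
  "partial_hom \<Gamma> \<longleftrightarrow> subring \<Gamma> LL \<and> (\<forall>k\<in>K. (k, k) \<in> \<Gamma>) \<and> (\<forall>v. (\<zero>, v) \<in> \<Gamma> \<longrightarrow> v = \<zero>)"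

lemma subring_fst:
  assumes "subring \<Gamma> LL"
  shows "subring (fst ` \<Gamma>) L"
proof (rule subringI)
  note E = subringE[OF assms]
  show "fst ` \<Gamma> \<subseteq> carrier L" using E(1) by (auto simp: LL_simps)
  show "\<one> \<in> fst ` \<Gamma>" using E(3) by (force simp: LL_simps)
  show "\<ominus> h \<in> fst ` \<Gamma>" if h: "h \<in> fst ` \<Gamma>" for h
  proof -
    obtain v where v: "(h, v) \<in> \<Gamma>" using h by auto
    then have "h \<in> carrier L" "v \<in> carrier L" using E(1) by (auto simp: LL_simps)
    then show ?thesis using E(5)[OF v] by (force simp: LL_minus)
  qed
  show "h \<otimes> k \<in> fst ` \<Gamma>" "h \<oplus> k \<in> fst ` \<Gamma>" if hk: "h \<in> fst ` \<Gamma>" "k \<in> fst ` \<Gamma>" for h k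
  proof -
    obtain v w where v: "(h, v) \<in> \<Gamma>" "(k, w) \<in> \<Gamma>" using hk by auto
    show "h \<otimes> k \<in> fst ` \<Gamma>" "h \<oplus> k \<in> fst ` \<Gamma>"
      using E(6)[OF v] E(7)[OF v] by (force simp: LL_simps)+
  qed
qed

text \<open>Extension of a homomorphism \<open>h\<close> to a simple algebraic extension. If \<open>n\<close> is the degree of \<open>y\<close> over the
  domain of \<open>h\<close> and \<open>y'\<close> satisfies the transported equation, then the span of the powers of \<open>(y, y')\<close> below
  \<open>n\<close> is a subring of \<open>L \<times> L\<close>. It is again a graph because the powers of \<open>y\<close> below \<open>n\<close> are linearly
  independent: an element with first component zero has zero coefficients.\<close>

lemma partial_hom_extend:
  assumes \<Gamma>: "partial_hom \<Gamma>" and y: "y \<in> carrier L" and y': "y' \<in> carrier L" and n: "n > 0"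
    and zn: "(y, y') [^]\<^bsub>LL\<^esub> n \<in> cring.lin_span LL \<Gamma> ((\<lambda>i. (y, y') [^]\<^bsub>LL\<^esub> i) ` {..<n})"
    and min: "\<And>k. 0 < k \<Longrightarrow> k < n \<Longrightarrow> y [^] k \<notin> lin_span (fst ` \<Gamma>) (powers_below y k)"
  shows "\<exists>\<Gamma>'. partial_hom \<Gamma>' \<and> \<Gamma> \<subseteq> \<Gamma>' \<and> (y, y') \<in> \<Gamma>'"
proof -
  interpret P: cring LL by (rule cring_LL)
  have sr: "subring \<Gamma> LL" and diag: "\<And>k. k \<in> K \<Longrightarrow> (k, k) \<in> \<Gamma>" and fn: "\<And>v. (\<zero>, v) \<in> \<Gamma> \<Longrightarrow> v = \<zero>"
    using \<Gamma> unfolding partial_hom_def by auto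
  let ?z = "(y, y')"
  have z: "?z \<in> carrier LL" using y y' by (simp add: LL_simps)
  let ?S = "P.lin_span \<Gamma> (P.powers_below ?z n)"
  note S = P.subring_span_powers[OF sr z n zn]
  note D = subring_fst[OF sr]
  have KD: "K \<subseteq> fst ` \<Gamma>" using diag by force
  have \<Gamma>c: "u \<in> carrier L \<and> v \<in> carrier L" if "(u, v) \<in> \<Gamma>" for u v
    using that subringE(1)[OF sr] by (auto simp: LL_simps)
  have proj: "u \<in> carrier L \<and> v \<in> carrier L \<and> u \<in> lin_span (fst ` \<Gamma>) (powers_below y k)"
    if "(u, v) \<in> P.lin_span \<Gamma> (P.powers_below ?z k)" for u v k
    using that
  proof (induction "(u, v)" arbitrary: u v)
    case zero
    then show ?case using lin_span.zero by (auto simp: LL_simps)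
  next
    case (add r b w)
    obtain r1 r2 w1 w2 where rw: "r = (r1, r2)" "w = (w1, w2)" by (cases r, cases w)
    obtain i where i: "b = (y [^] i, y' [^] i)" "i < k" using add by (auto simp: LL_pow)
    have eq: "u = r1 \<otimes> y [^] i \<oplus> w1" "v = r2 \<otimes> y' [^] i \<oplus> w2"
      using add(5) unfolding rw i by (auto simp: LL_simps)
    have r: "r1 \<in> fst ` \<Gamma>" "r1 \<in> carrier L" "r2 \<in> carrier L" using add(1) \<Gamma>c unfolding rw by force+
    have "r1 \<otimes> y [^] i \<oplus> w1 \<in> lin_span (fst ` \<Gamma>) (powers_below y k)"
      by (rule lin_span.add) (use r i add(4)[OF rw(2)] in auto)
    then show ?case unfolding eq using r y y' add(4)[OF rw(2)] by auto
  qed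
  have inj: "v = \<zero>" if "(\<zero>, v) \<in> P.lin_span \<Gamma> (P.powers_below ?z k)" "k \<le> n" for k v
    using that
  proof (induction k arbitrary: v)
    case 0
    then show ?case by (simp add: P.lin_span_empty LL_simps)
  next
    case (Suc k)
    have "(\<zero>, v) \<in> P.lin_span \<Gamma> (insert (?z [^]\<^bsub>LL\<^esub> k) (P.powers_below ?z k))"
      using Suc.prems(1) unfolding P.powers_below_Suc .
    then obtain r w where rw: "r \<in> \<Gamma>" "w \<in> P.lin_span \<Gamma> (P.powers_below ?z k)"
      "(\<zero>, v) = r \<otimes>\<^bsub>LL\<^esub> ?z [^]\<^bsub>LL\<^esub> k \<oplus>\<^bsub>LL\<^esub> w"
      using P.lin_span_insertE[OF sr P.powers_below_carrier[OF z] P.nat_pow_closed[OF z]] by metis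
    obtain r1 r2 w1 w2 where r12: "r = (r1, r2)" "w = (w1, w2)" by (cases r, cases w)
    have eq: "\<zero> = r1 \<otimes> y [^] k \<oplus> w1" "v = r2 \<otimes> y' [^] k \<oplus> w2"
      using rw(3) unfolding r12 by (auto simp: LL_simps LL_pow)
    have r: "r1 \<in> fst ` \<Gamma>" "r1 \<in> carrier L" "r2 \<in> carrier L" using rw(1) \<Gamma>c unfolding r12 by force+
    have w: "w1 \<in> carrier L" "w2 \<in> carrier L" "w1 \<in> lin_span (fst ` \<Gamma>) (powers_below y k)"
      using proj rw(2) unfolding r12 by auto
    have "r1 = \<zero>"
    proof (rule ccontr)
      assume nz: "r1 \<noteq> \<zero>"
      then have ir: "inv r1 \<in> fst ` \<Gamma>" using inverse_of_algebraic[OF D KD r(1)] by blast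
      have irL: "inv r1 \<in> carrier L" "inv r1 \<otimes> r1 = \<one>" using nz r by (simp_all add: field_Units)
      have "r1 \<otimes> y [^] k = \<ominus> w1" using eq(1) sum_zero_eq_neg[of "r1 \<otimes> y [^] k" w1] r w y by simp
      then have "inv r1 \<otimes> (r1 \<otimes> y [^] k) = \<ominus> (inv r1) \<otimes> w1" using irL w by (simp add: l_minus r_minus)
      then have "y [^] k = \<ominus> (inv r1) \<otimes> w1" using irL r y by (simp add: m_assoc[symmetric])
      then have mem: "y [^] k \<in> lin_span (fst ` \<Gamma>) (powers_below y k)"
        using lin_subD(4)[OF lin_sub_lin_span[OF D powers_below_carrier[OF y]] subringE(5)[OF D ir] w(3)] by simp
      show False
      proof (cases "k = 0")
        case True
        then show False using mem one_not_zero_span by simp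
      next
        case False
        then show False using mem min[of k] Suc.prems(2) by simp
      qed
    qed
    then have "r2 = \<zero>" using fn rw(1) r12 by blast
    have "w1 = \<zero>" using eq(1) \<open>r1 = \<zero>\<close> w y by simp
    then have "w2 = \<zero>" using Suc.IH[of w2] rw(2) r12 Suc.prems(2) by simp
    then show ?case using eq(2) \<open>r2 = \<zero>\<close> y' by simp
  qed
  have "partial_hom ?S"
    unfolding partial_hom_def using S(1,2) diag inj[of _ n] by blast
  moreover have "?z \<in> ?S" using S(3)[of 1] z P.nat_pow_eone by simp
  ultimately show ?thesis using S(2) by blast
qed

lemma eval_pair_mem_span:
  assumes \<Gamma>: "subring \<Gamma> LL" and y: "y \<in> carrier L" and y': "y' \<in> carrier L"
    and "list_all2 (\<lambda>c d. (c, d) \<in> \<Gamma>) cs ds"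
  shows "(eval cs y, eval ds y') \<in> cring.lin_span LL \<Gamma> ((\<lambda>i. (y, y') [^]\<^bsub>LL\<^esub> i) ` {..<length cs})"
  using assms(4)
proof (induction rule: list_all2_induct)
  interpret P: cring LL by (rule cring_LL)
  have z: "(y, y') \<in> carrier LL" using y y' by (simp add: LL_simps)
  case Nil
  show ?case using P.lin_span.zero by (simp add: LL_simps)
next
  interpret P: cring LL by (rule cring_LL)
  have z: "(y, y') \<in> carrier LL" using y y' by (simp add: LL_simps)
  case (Cons c cs d ds)
  have len: "length cs = length ds" using Cons(2) list_all2_lengthD by blast
  show ?case
    using P.lin_span_insertI[OF \<Gamma> P.powers_below_carrier[OF z] P.nat_pow_closed[OF z] Cons(1,3)] len
    unfolding list.size P.powers_below_Suc[of _ "length cs", simplified] add_Suc_right add_0_right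
    by (simp add: eval_Cons P.powers_below_Suc LL_simps LL_pow)
qed

lemma eval_uminus:
  assumes "set cs \<subseteq> carrier L" "z \<in> carrier L"
  shows "eval (map (\<lambda>c. \<ominus> c) cs) z = \<ominus> eval cs z"
  using assms by (induction cs) (auto simp: eval_Cons eval_in_carrier l_minus minus_add)

lemma monic_root_iff:
  assumes "set cs \<subseteq> carrier L" "z \<in> carrier L"
  shows "eval (\<one> # map (\<lambda>c. \<ominus> c) cs) z = \<zero> \<longleftrightarrow> z [^] length cs = eval cs z"
  using assms by (simp add: eval_Cons eval_uminus eval_in_carrier minus_eq[symmetric])

text \<open>Zorn's lemma; a maximal graph has full domain since every \<open>y\<close> is algebraic over the domain and the
  transported minimal equation has a root.\<close>

lemma total_extension:
  assumes \<Gamma>0: "partial_hom \<Gamma>0"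
  shows "\<exists>\<Gamma>. partial_hom \<Gamma> \<and> \<Gamma>0 \<subseteq> \<Gamma> \<and> fst ` \<Gamma> = carrier L"
proof -
  interpret P: cring LL by (rule cring_LL)
  let ?G = "{\<Gamma>. partial_hom \<Gamma> \<and> \<Gamma>0 \<subseteq> \<Gamma>}"
  have "\<exists>M\<in>?G. \<forall>N\<in>?G. M \<subseteq> N \<longrightarrow> N = M"
  proof (rule subset_Zorn_nonempty)
    show "?G \<noteq> {}" using \<Gamma>0 by blast
    fix \<C> assume ne: "\<C> \<noteq> {}" and ch: "subset.chain ?G \<C>"
    have mem: "partial_hom \<Gamma>" "subring \<Gamma> LL" "\<Gamma>0 \<subseteq> \<Gamma>" if "\<Gamma> \<in> \<C>" for \<Gamma>
      using ch that unfolding subset.chain_def partial_hom_def by auto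
    have two: "\<exists>\<Gamma>\<in>\<C>. u \<in> \<Gamma> \<and> v \<in> \<Gamma>" if uv: "u \<in> \<Union>\<C>" "v \<in> \<Union>\<C>" for u v
    proof -
      obtain \<Gamma> \<Gamma>' where "\<Gamma> \<in> \<C>" "\<Gamma>' \<in> \<C>" "u \<in> \<Gamma>" "v \<in> \<Gamma>'" using uv by blast
      moreover have "\<Gamma> \<subseteq> \<Gamma>' \<or> \<Gamma>' \<subseteq> \<Gamma>"
        using subset_chain_def[of ?G \<C>] ch calculation(1,2) by blast
      ultimately show ?thesis by blast
    qed
    have "subring (\<Union>\<C>) LL"
    proof (rule P.subringI)
      show "\<Union>\<C> \<subseteq> carrier LL" using mem(2) subringE(1) by blast
      obtain \<Gamma>1 where "\<Gamma>1 \<in> \<C>" using ne by blast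
      then show "\<one>\<^bsub>LL\<^esub> \<in> \<Union>\<C>" using subringE(3)[OF mem(2)] by blast
      show "\<ominus>\<^bsub>LL\<^esub> h \<in> \<Union>\<C>" if "h \<in> \<Union>\<C>" for h using that subringE(5)[OF mem(2)] by blast
      show "h \<otimes>\<^bsub>LL\<^esub> k \<in> \<Union>\<C>" "h \<oplus>\<^bsub>LL\<^esub> k \<in> \<Union>\<C>" if hk: "h \<in> \<Union>\<C>" "k \<in> \<Union>\<C>" for h k
      proof -
        obtain \<Gamma> where \<Gamma>: "\<Gamma> \<in> \<C>" "h \<in> \<Gamma>" "k \<in> \<Gamma>" using two[OF hk] by blast
        show "h \<otimes>\<^bsub>LL\<^esub> k \<in> \<Union>\<C>" "h \<oplus>\<^bsub>LL\<^esub> k \<in> \<Union>\<C>"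
          using subringE(6)[OF mem(2)[OF \<Gamma>(1)] \<Gamma>(2,3)] subringE(7)[OF mem(2)[OF \<Gamma>(1)] \<Gamma>(2,3)] \<Gamma>(1)
          by blast+
      qed
    qed
    moreover have "(k, k) \<in> \<Union>\<C>" if "k \<in> K" for k using ne mem(1) that unfolding partial_hom_def by blast
    moreover have "v = \<zero>" if "(\<zero>, v) \<in> \<Union>\<C>" for v using mem(1) that unfolding partial_hom_def by blast
    moreover have "\<Gamma>0 \<subseteq> \<Union>\<C>" using ne mem(3) by blast
    ultimately show "\<Union>\<C> \<in> ?G" unfolding partial_hom_def by blast
  qed
  then obtain \<Gamma> where "\<Gamma> \<in> ?G" and maxG: "\<forall>N\<in>?G. \<Gamma> \<subseteq> N \<longrightarrow> N = \<Gamma>" by (rule bexE)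
  then have \<Gamma>: "partial_hom \<Gamma>" "\<Gamma>0 \<subseteq> \<Gamma>" by simp_all
  have max: "N = \<Gamma>" if "partial_hom N" "\<Gamma> \<subseteq> N" for N
    using maxG \<Gamma>(2) that by simp
  have sr: "subring \<Gamma> LL" and diag: "\<And>k. k \<in> K \<Longrightarrow> (k, k) \<in> \<Gamma>" using \<Gamma> unfolding partial_hom_def by auto
  note D = subring_fst[OF sr]
  have KD: "K \<subseteq> fst ` \<Gamma>" using diag by force
  have "y \<in> fst ` \<Gamma>" if y: "y \<in> carrier L" for y
  proof -
    have "integral_elem (fst ` \<Gamma>) y" using integral_elem_mono[OF KD integral[OF y]] .
    then obtain n :: nat where n: "n > 0" "y [^] n \<in> lin_span (fst ` \<Gamma>) (powers_below y n)"
      "\<And>k. 0 < k \<Longrightarrow> k < n \<Longrightarrow> y [^] k \<notin> lin_span (fst ` \<Gamma>) (powers_below y k)"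
      using integral_elem_least by blast
    obtain cs where cs: "length cs = n" "set cs \<subseteq> fst ` \<Gamma>" "y [^] n = eval cs y"
      using mem_span_eval[OF D y n(2)] by blast
    define ds where "ds = map (\<lambda>c. SOME d. (c, d) \<in> \<Gamma>) cs"
    have lift: "(c, SOME d. (c, d) \<in> \<Gamma>) \<in> \<Gamma>" if c: "c \<in> set cs" for c
    proof -
      have "\<exists>d. (c, d) \<in> \<Gamma>" using c cs(2) by force
      then show ?thesis by (rule someI_ex)
    qed
    have all: "list_all2 (\<lambda>c d. (c, d) \<in> \<Gamma>) cs ds"
      unfolding ds_def by (auto simp: list_all2_map2 list_all2_same lift)
    have dsL: "set ds \<subseteq> carrier L"
      unfolding ds_def using lift subringE(1)[OF sr] by (auto simp: LL_simps)
    have len: "length ds = n" using cs(1) by (simp add: ds_def)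
    obtain y' where y': "y' \<in> carrier L" "eval (\<one> # map (\<lambda>c. \<ominus> c) ds) y' = \<zero>"
      using has_root[of "map (\<lambda>c. \<ominus> c) ds"] dsL len n(1) by auto
    then have "y' [^] n = eval ds y'" using monic_root_iff[OF dsL y'(1)] len by simp
    then have "(y, y') [^]\<^bsub>LL\<^esub> n = (eval cs y, eval ds y')" using cs(3) by (simp add: LL_pow)
    then have "(y, y') [^]\<^bsub>LL\<^esub> n \<in> cring.lin_span LL \<Gamma> ((\<lambda>i. (y, y') [^]\<^bsub>LL\<^esub> i) ` {..<n})"
      using eval_pair_mem_span[OF sr y y'(1) all] cs(1) by simp
    from partial_hom_extend[OF \<Gamma>(1) y y'(1) n(1) this n(3)]
    obtain N where "partial_hom N" "\<Gamma> \<subseteq> N" "(y, y') \<in> N" by blast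
    then have "(y, y') \<in> \<Gamma>" using max by blast
    then show ?thesis by force
  qed
  then have "fst ` \<Gamma> = carrier L" using subringE(1)[OF D] by blast
  then show ?thesis using \<Gamma> by blast
qed

definition auts :: "('a \<Rightarrow> 'a) set" where
  "auts = {\<tau> \<in> ring_hom L L. bij_betw \<tau> (carrier L) (carrier L) \<and> (\<forall>k\<in>K. \<tau> k = k)}"

lemma ring_hom_eval:
  assumes \<tau>: "\<tau> \<in> ring_hom L L" and fixes_cs: "\<And>c. c \<in> set cs \<Longrightarrow> \<tau> c = c"
    and cs: "set cs \<subseteq> carrier L" and z: "z \<in> carrier L"
  shows "\<tau> (eval cs z) = eval cs (\<tau> z)"
proof -
  interpret h: ring_hom_cring L L \<tau>
    by (intro ring_hom_cring.intro ring_hom_cring_axioms.intro is_cring \<tau>)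
  show ?thesis using fixes_cs cs
  proof (induction cs)
    case Nil
    then show ?case using h.hom_zero by simp
  next
    case (Cons c cs)
    then show ?case using z eval_in_carrier[of cs z] by (simp add: eval_Cons h.hom_pow)
  qed
qed

text \<open>An endomorphism of \<open>L\<close> over \<open>K\<close> is injective, and it maps the finite set of roots of each polynomial over
  \<open>K\<close> to itself, so that it is surjective.\<close>

lemma aut_of_total:
  assumes \<Gamma>: "partial_hom \<Gamma>" and total: "fst ` \<Gamma> = carrier L"
  shows "\<exists>\<tau>\<in>auts. \<forall>u v. (u, v) \<in> \<Gamma> \<longrightarrow> \<tau> u = v"
proof -
  have sr: "subring \<Gamma> LL" and diag: "\<And>k. k \<in> K \<Longrightarrow> (k, k) \<in> \<Gamma>" and fn: "\<And>v. (\<zero>, v) \<in> \<Gamma> \<Longrightarrow> v = \<zero>"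
    using \<Gamma> unfolding partial_hom_def by auto
  note E = subringE[OF sr]
  have \<Gamma>c: "u \<in> carrier L" "v \<in> carrier L" if "(u, v) \<in> \<Gamma>" for u v
    using that E(1) by (auto simp: LL_simps)
  have unique: "v = w" if vw: "(u, v) \<in> \<Gamma>" "(u, w) \<in> \<Gamma>" for u v w
  proof -
    have c: "u \<in> carrier L" "v \<in> carrier L" "w \<in> carrier L" using \<Gamma>c[OF vw(1)] \<Gamma>c[OF vw(2)] by auto
    have "(u, v) \<oplus>\<^bsub>LL\<^esub> \<ominus>\<^bsub>LL\<^esub> (u, w) \<in> \<Gamma>" using E(7)[OF vw(1) E(5)[OF vw(2)]] .
    then have "(\<zero>, v \<oplus> \<ominus> w) \<in> \<Gamma>" using c by (simp add: LL_minus LL_simps r_neg)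
    then have "v \<ominus> w = \<zero>" using fn c by (simp add: minus_eq)
    then show ?thesis using c by simp
  qed
  define \<tau> where "\<tau> u = (THE v. (u, v) \<in> \<Gamma>)" for u
  have \<tau>eq: "\<tau> u = v" if "(u, v) \<in> \<Gamma>" for u v
    unfolding \<tau>_def using that unique by (intro the_equality) auto
  have \<tau>in: "(u, \<tau> u) \<in> \<Gamma>" if u: "u \<in> carrier L" for u
  proof -
    have "u \<in> fst ` \<Gamma>" using u total by simp
    then obtain v where "(u, v) \<in> \<Gamma>" by auto
    then show ?thesis using \<tau>eq by simp
  qed
  have hom: "\<tau> \<in> ring_hom L L"
  proof (rule ring_hom_memI)
    show "\<tau> u \<in> carrier L" if "u \<in> carrier L" for u using \<Gamma>c(2)[OF \<tau>in[OF that]] .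
    show "\<tau> (u \<otimes> v) = \<tau> u \<otimes> \<tau> v" if "u \<in> carrier L" "v \<in> carrier L" for u v
      using E(6)[OF \<tau>in[OF that(1)] \<tau>in[OF that(2)]] by (intro \<tau>eq) (simp add: LL_simps)
    show "\<tau> (u \<oplus> v) = \<tau> u \<oplus> \<tau> v" if "u \<in> carrier L" "v \<in> carrier L" for u v
      using E(7)[OF \<tau>in[OF that(1)] \<tau>in[OF that(2)]] by (intro \<tau>eq) (simp add: LL_simps)
    show "\<tau> \<one> = \<one>" using E(3) by (intro \<tau>eq) (simp add: LL_simps)
  qed
  interpret h: ring_hom_cring L L \<tau>
    by (intro ring_hom_cring.intro ring_hom_cring_axioms.intro is_cring hom)
  have inj: "inj_on \<tau> (carrier L)"
  proof (rule inj_onI)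
    fix u v assume uv: "u \<in> carrier L" "v \<in> carrier L" "\<tau> u = \<tau> v"
    show "u = v"
    proof (rule ccontr)
      assume "u \<noteq> v"
      then have nz: "u \<ominus> v \<noteq> \<zero>" using uv by simp
      have dL: "u \<ominus> v \<in> carrier L" using uv by simp
      have iL: "inv (u \<ominus> v) \<in> carrier L" "(u \<ominus> v) \<otimes> inv (u \<ominus> v) = \<one>"
        using nz dL by (simp_all add: field_Units)
      have "\<tau> (u \<ominus> v) = \<zero>" using uv by (simp add: minus_eq r_neg)
      then have "\<tau> ((u \<ominus> v) \<otimes> inv (u \<ominus> v)) = \<zero>"
        using h.hom_mult[OF dL iL(1)] h.hom_closed[OF iL(1)] by simp
      then have "\<tau> \<one> = \<zero>" unfolding iL(2) .
      then show False using h.hom_one one_not_zero by simp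
    qed
  qed
  have fixK: "\<tau> k = k" if "k \<in> K" for k using \<tau>eq[OF diag[OF that]] .
  have "\<tau> ` carrier L = carrier L"
  proof
    show "\<tau> ` carrier L \<subseteq> carrier L" by auto
    show "carrier L \<subseteq> \<tau> ` carrier L"
    proof
      fix v assume v: "v \<in> carrier L"
      obtain n :: nat where n: "n > 0" "v [^] n \<in> lin_span K (powers_below v n)"
        using integral[OF v] unfolding integral_elem_def by blast
      obtain cs where cs: "length cs = n" "set cs \<subseteq> K" "v [^] n = eval cs v"
        using mem_span_eval[OF subring_K v n(2)] by blast
      let ?p = "map (\<lambda>c. \<ominus> c) cs"
      have pK: "set ?p \<subseteq> K" using cs(2) subringE(5)[OF subring_K] by auto
      have csL: "set cs \<subseteq> carrier L" and pL: "set ?p \<subseteq> carrier L" using pK cs(2) K_carrier by auto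
      let ?Z = "{z \<in> carrier L. eval (\<one> # ?p) z = \<zero>}"
      have "\<tau> ` ?Z \<subseteq> ?Z"
      proof safe
        fix z assume z: "z \<in> carrier L" "eval (\<one> # ?p) z = \<zero>"
        show "\<tau> z \<in> carrier L" using z by simp
        have "\<tau> (eval (\<one> # ?p) z) = eval (\<one> # ?p) (\<tau> z)"
          using pK fixK pL z(1) h.hom_one by (intro ring_hom_eval[OF hom]) auto
        then show "eval (\<one> # ?p) (\<tau> z) = \<zero>" using z(2) by simp
      qed
      moreover have "inj_on \<tau> ?Z" using inj by (rule inj_on_subset) auto
      ultimately have "\<tau> ` ?Z = ?Z" using endo_inj_surj[OF finite_roots[OF pL]] by blast
      moreover have "v \<in> ?Z" using monic_root_iff[OF csL v] cs v by simp
      ultimately show "v \<in> \<tau> ` carrier L" by blast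
    qed
  qed
  then have "\<tau> \<in> auts" unfolding auts_def bij_betw_def using hom inj fixK by blast
  then show ?thesis using \<tau>eq by blast
qed

text \<open>Synthetic division: the coefficients of the quotient of the polynomial \<open>b # cs\<close> by the linear factor with
  root \<open>x\<close>.\<close>

primrec horner :: "'a \<Rightarrow> 'a \<Rightarrow> 'a list \<Rightarrow> 'a list" where
  "horner x b [] = []"
| "horner x b (c # cs) = b # horner x (b \<otimes> x \<oplus> c) cs"

lemma length_horner [simp]: "length (horner x b cs) = length cs"
  by (induction cs arbitrary: b) auto

lemma horner_carrier:
  "x \<in> carrier L \<Longrightarrow> b \<in> carrier L \<Longrightarrow> set cs \<subseteq> carrier L \<Longrightarrow> set (horner x b cs) \<subseteq> carrier L"
  by (induction cs arbitrary: b) auto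

lemma eval_horner:
  assumes "x \<in> carrier L" "z \<in> carrier L" "b \<in> carrier L" "set cs \<subseteq> carrier L"
  shows "eval (b # cs) z = (z \<ominus> x) \<otimes> eval (horner x b cs) z \<oplus> eval (b # cs) x"
  using assms(3,4)
proof (induction cs arbitrary: b)
  case Nil
  then show ?case using assms(1,2) by (simp add: eval_Cons)
next
  case (Cons c cs)
  let ?b = "b \<otimes> x \<oplus> c" and ?Z = "z [^] length cs" and ?Y = "x [^] length cs"
  let ?Q = "eval (horner x ?b cs) z"
  have c: "c \<in> carrier L" "b \<in> carrier L" "set cs \<subseteq> carrier L" "?b \<in> carrier L" using Cons.prems assms(1) by auto
  have E: "eval cs z \<in> carrier L" "eval cs x \<in> carrier L" "?Q \<in> carrier L"
    using eval_in_carrier c(3) assms(1,2) horner_carrier[OF assms(1) c(4,3)] by auto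
  have P: "?Z \<in> carrier L" "?Y \<in> carrier L" using assms by auto
  have IH: "?b \<otimes> ?Z \<oplus> eval cs z = (z \<ominus> x) \<otimes> ?Q \<oplus> (?b \<otimes> ?Y \<oplus> eval cs x)"
    using Cons.IH[OF c(4,3)] by (simp add: eval_Cons)
  have "(z \<ominus> x) \<otimes> (b \<otimes> Z \<oplus> Q) \<oplus> (b \<otimes> (Y \<otimes> x) \<oplus> (c \<otimes> Y \<oplus> F))
      = ((z \<ominus> x) \<otimes> Q \<oplus> ((b \<otimes> x \<oplus> c) \<otimes> Y \<oplus> F)) \<oplus> b \<otimes> (Z \<otimes> z) \<ominus> b \<otimes> x \<otimes> Z"
    "((b \<otimes> x \<oplus> c) \<otimes> Z \<oplus> E) \<oplus> b \<otimes> (Z \<otimes> z) \<ominus> b \<otimes> x \<otimes> Z = b \<otimes> (Z \<otimes> z) \<oplus> (c \<otimes> Z \<oplus> E)"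
    if "Z \<in> carrier L" "Y \<in> carrier L" "E \<in> carrier L" "F \<in> carrier L" "Q \<in> carrier L" for Z Y E F Q
    using that assms(1,2) c(1,2) by algebra+
  note this[OF P E]
  then show ?case using IH by (simp add: eval_Cons)
qed

lemma nat_in_K: "nat_elem n \<in> K" for n :: nat
  by (induction n) (use subringE[OF subring_K] in auto)

text \<open>The quotient of \<open>p - p(x)\<close> by the linear factor takes at \<open>x\<close> the value \<open>p'(x)\<close>, whose leading term is
  \<open>n b x\<^sup>n\<^sup>-\<^sup>1\<close>. For \<open>length cs = 0\<close> both sides are zero.\<close>

lemma eval_horner_self:
  assumes x: "x \<in> carrier L" and "b \<in> carrier L" "set cs \<subseteq> K"
  shows "\<exists>s\<in>lin_span K (powers_below x (length cs - 1)).
    eval (horner x b cs) x = (nat_elem (length cs)) \<otimes> (b \<otimes> x [^] (length cs - 1)) \<oplus> s"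
  using assms(2,3)
proof (induction cs arbitrary: b)
  case Nil
  then show ?case using x by (intro bexI[of _ \<zero>]) (auto intro: lin_span.zero)
next
  case (Cons c cs)
  have c: "c \<in> K" "c \<in> carrier L" "set cs \<subseteq> K" "b \<otimes> x \<oplus> c \<in> carrier L" using Cons.prems x K_carrier by auto
  obtain s where s: "s \<in> lin_span K (powers_below x (length cs - 1))"
    "eval (horner x (b \<otimes> x \<oplus> c) cs) x = (nat_elem (length cs)) \<otimes> ((b \<otimes> x \<oplus> c) \<otimes> x [^] (length cs - 1)) \<oplus> s"
    using Cons.IH[OF c(4,3)] by blast
  have sL: "s \<in> carrier L"
    using s(1) lin_span_carrier[OF subfieldE(3)[OF K] powers_below_carrier[OF x]] by blast
  show ?case
  proof (cases "length cs")
    case 0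
    then have "eval (horner x b (c # cs)) x = b \<oplus> s" using s(2) Cons.prems(1) x sL c by (simp add: eval_Cons)
    moreover have "s = \<zero>" using s(1) 0 by (simp add: lin_span_empty)
    ultimately show ?thesis using 0 Cons.prems(1) x by (intro bexI[of _ \<zero>]) (auto intro: lin_span.zero)
  next
    case (Suc m)
    let ?N = "nat_elem (Suc m)"
    have N: "?N \<in> carrier L" "?N \<in> K" using nat_in_K K_carrier by blast+
    have "?N \<otimes> c \<in> K" using N c subringE(6)[OF subring_K] by blast
    then have s': "(?N \<otimes> c) \<otimes> x [^] m \<oplus> s \<in> lin_span K (powers_below x (Suc m))"
      using lin_span_insertI[OF subring_K powers_below_carrier[OF x] nat_pow_closed[OF x], of "?N \<otimes> c" s m m] s(1) Suc
      by (simp add: powers_below_Suc del: image_insert lessThan_Suc)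
    have id: "b \<otimes> (Y \<otimes> x) \<oplus> (n \<otimes> ((b \<otimes> x \<oplus> c) \<otimes> Y) \<oplus> s) = (n \<oplus> \<one>) \<otimes> (b \<otimes> (Y \<otimes> x)) \<oplus> ((n \<otimes> c) \<otimes> Y \<oplus> s)"
      if "Y \<in> carrier L" "n \<in> carrier L" for Y n
      using that x c(2) Cons.prems(1) sL by algebra
    have "eval (horner x b (c # cs)) x = b \<otimes> (x [^] m \<otimes> x) \<oplus> (?N \<otimes> ((b \<otimes> x \<oplus> c) \<otimes> x [^] m) \<oplus> s)"
      using s(2) Suc by (simp add: eval_Cons del: add.nat_pow_Suc)
    also have "\<dots> = (?N \<oplus> \<one>) \<otimes> (b \<otimes> (x [^] m \<otimes> x)) \<oplus> ((?N \<otimes> c) \<otimes> x [^] m \<oplus> s)"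
      using id[of "x [^] m" ?N] x N by simp
    finally show ?thesis using s' Suc
      by (intro bexI[of _ "(?N \<otimes> c) \<otimes> x [^] m \<oplus> s"]) simp_all
  qed
qed

text \<open>Let \<open>p\<close> be the minimal polynomial of \<open>x\<close>, of degree \<open>n \<ge> 2\<close>. In characteristic zero \<open>p'(x)\<close> is nonzero,
  since otherwise \<open>x\<^sup>n\<^sup>-\<^sup>1\<close> would be a combination of lower powers. Thus \<open>x\<close> is no root of the quotient of
  \<open>p\<close> by its linear factor, and any root \<open>x'\<close> of this quotient is a second root of \<open>p\<close>. The
  \<open>K\<close>-homomorphism with \<open>x \<mapsto> x'\<close> extends to an automorphism of \<open>L\<close>.\<close>

theorem exists_moving_aut:
  assumes char0: "\<And>n::nat. 0 < n \<Longrightarrow> nat_elem n \<noteq> \<zero>"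
    and x: "x \<in> carrier L" "x \<notin> K"
  shows "\<exists>\<tau>\<in>auts. \<tau> x \<noteq> x"
proof -
  obtain n :: nat where n: "n > 0" "x [^] n \<in> lin_span K (powers_below x n)"
    "\<And>k. 0 < k \<Longrightarrow> k < n \<Longrightarrow> x [^] k \<notin> lin_span K (powers_below x k)"
    using integral_elem_least[OF integral[OF x(1)]] by blast
  have n2: "n \<ge> 2"
  proof (rule ccontr)
    assume "\<not> n \<ge> 2"
    then have "n = 1" using n(1) by simp
    then have "x [^] (1::nat) \<in> lin_span K {\<one>}" using n(2) by (simp add: lessThan_Suc)
    moreover have "lin_span K {\<one>} \<subseteq> K"
    proof (rule lin_span_least)
      show "lin_sub K K" by (rule lin_subI) (use subringE[OF subring_K] in auto)
    qed (use subringE[OF subring_K] in auto)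
    ultimately show False using x by auto
  qed
  obtain cs where cs: "length cs = n" "set cs \<subseteq> K" "x [^] n = eval cs x"
    using mem_span_eval[OF subring_K x(1) n(2)] by blast
  let ?p = "map (\<lambda>c. \<ominus> c) cs"
  have pK: "set ?p \<subseteq> K" using cs(2) subringE(5)[OF subring_K] by auto
  have csL: "set cs \<subseteq> carrier L" and pL: "set ?p \<subseteq> carrier L" using pK cs(2) K_carrier by auto
  have x0: "eval (\<one> # ?p) x = \<zero>" using monic_root_iff[OF csL x(1)] cs by simp
  let ?q = "horner x \<one> ?p"
  have qL: "set ?q \<subseteq> carrier L" using horner_carrier[OF x(1) one_closed pL] .
  obtain c p' where p': "?p = c # p'" using cs(1) n2 by (cases ?p) auto
  then have q: "?q = \<one> # tl ?q" by simp
  have "length (tl ?q) = n - 1" using cs(1) by simp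
  then have "0 < length (tl ?q)" using n2 by linarith
  then have ne: "tl ?q \<noteq> []" by (rule length_greater_0_conv[THEN iffD1])
  have "set (tl ?q) \<subseteq> carrier L" using qL list.set_sel(2)[of ?q] p' by auto
  from has_root[OF this ne] obtain x' where x': "x' \<in> carrier L" "eval ?q x' = \<zero>"
    using q by auto
  have "x' \<noteq> x"
  proof
    assume "x' = x"
    obtain s where s: "s \<in> lin_span K (powers_below x (n - 1))"
      "eval ?q x = (nat_elem n) \<otimes> (\<one> \<otimes> x [^] (n - 1)) \<oplus> s"
      using eval_horner_self[OF x(1) one_closed pK] cs(1) by auto
    have sL: "s \<in> carrier L"
      using s(1) lin_span_carrier[OF subfieldE(3)[OF K] powers_below_carrier[OF x(1)]] by blast
    have NK: "nat_elem n \<in> K - {\<zero>}" using nat_in_K char0[OF n(1)] by blast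
    note iN = subfield_m_inv[OF K NK]
    have NL: "nat_elem n \<in> carrier L" "inv (nat_elem n) \<in> carrier L" using NK iN(1) K_carrier by auto
    have "(nat_elem n) \<otimes> x [^] (n - 1) \<oplus> s = \<zero>" using s(2) x'(2) \<open>x' = x\<close> x(1) by simp
    then have "(nat_elem n) \<otimes> x [^] (n - 1) = \<ominus> s" using sum_zero_eq_neg sL x(1) NL by simp
    then have "inv (nat_elem n) \<otimes> ((nat_elem n) \<otimes> x [^] (n - 1)) = inv (nat_elem n) \<otimes> (\<ominus> s)" by simp
    then have "x [^] (n - 1) = \<ominus> (inv (nat_elem n)) \<otimes> s"
      using iN(3) x(1) NL sL by (simp add: m_assoc[symmetric] l_minus r_minus)
    then have "x [^] (n - 1) \<in> lin_span K (powers_below x (n - 1))"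
      using lin_subD(4)[OF lin_sub_lin_span[OF subring_K powers_below_carrier[OF x(1)]] _ s(1)]
        subringE(5)[OF subring_K] iN(1) by simp
    then show False using n(3)[of "n - 1"] n2 by simp
  qed
  have "eval (\<one> # ?p) x' = \<zero>"
    using eval_horner[OF x(1) x'(1) one_closed pL] x'(2) x0 x'(1) x(1) by simp
  then have x'n: "x' [^] n = eval cs x'" using monic_root_iff[OF csL x'(1)] cs(1) by simp
  let ?\<Delta> = "(\<lambda>k. (k, k)) ` K"
  interpret P: cring LL by (rule cring_LL)
  have sr: "subring ?\<Delta> LL"
  proof (rule P.subringI)
    show "?\<Delta> \<subseteq> carrier LL" using K_carrier by (auto simp: LL_simps)
    show "\<one>\<^bsub>LL\<^esub> \<in> ?\<Delta>" using subringE(3)[OF subring_K] by (auto simp: LL_simps)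
    show "\<ominus>\<^bsub>LL\<^esub> h \<in> ?\<Delta>" if "h \<in> ?\<Delta>" for h
      using that subringE(5)[OF subring_K] K_carrier by (auto simp: LL_minus)
    show "h \<otimes>\<^bsub>LL\<^esub> k \<in> ?\<Delta>" "h \<oplus>\<^bsub>LL\<^esub> k \<in> ?\<Delta>" if "h \<in> ?\<Delta>" "k \<in> ?\<Delta>" for h k
      using that subringE(6,7)[OF subring_K] by (auto simp: LL_simps)
  qed
  have \<Delta>: "partial_hom ?\<Delta>" unfolding partial_hom_def using sr by auto
  have "list_all2 (\<lambda>c d. (c, d) \<in> ?\<Delta>) cs cs" using cs(2) by (auto simp: list_all2_same)
  from eval_pair_mem_span[OF sr x(1) x'(1) this]
  have zn: "(x, x') [^]\<^bsub>LL\<^esub> n \<in> cring.lin_span LL ?\<Delta> ((\<lambda>i. (x, x') [^]\<^bsub>LL\<^esub> i) ` {..<n})"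
    using cs(1,3) x'n by (simp add: LL_pow)
  have fst\<Delta>: "fst ` ?\<Delta> = K" by force
  from partial_hom_extend[OF \<Delta> x(1) x'(1) n(1) zn] n(3)
  obtain \<Gamma>0 where \<Gamma>0: "partial_hom \<Gamma>0" "(x, x') \<in> \<Gamma>0" unfolding fst\<Delta> by blast
  obtain \<Gamma> where \<Gamma>: "partial_hom \<Gamma>" "\<Gamma>0 \<subseteq> \<Gamma>" "fst ` \<Gamma> = carrier L"
    using total_extension[OF \<Gamma>0(1)] by blast
  obtain \<tau> where "\<tau> \<in> auts" "\<forall>u v. (u, v) \<in> \<Gamma> \<longrightarrow> \<tau> u = v"
    using aut_of_total[OF \<Gamma>(1,3)] by blast
  then show ?thesis using \<Gamma>(2) \<Gamma>0(2) \<open>x' \<noteq> x\<close> by blast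
qed

end

section \<open>Averages over Galois orbits\<close>

locale char0_alg_closed_over = alg_closed_over +
  assumes char0: "\<And>n::nat. 0 < n \<Longrightarrow> nat_elem n \<noteq> \<zero>"
begin

lemma autD:
  assumes "\<tau> \<in> auts"
  shows "x \<in> carrier L \<Longrightarrow> \<tau> x \<in> carrier L"
    and "x \<in> carrier L \<Longrightarrow> y \<in> carrier L \<Longrightarrow> \<tau> (x \<oplus> y) = \<tau> x \<oplus> \<tau> y"
    and "x \<in> carrier L \<Longrightarrow> y \<in> carrier L \<Longrightarrow> \<tau> (x \<otimes> y) = \<tau> x \<otimes> \<tau> y"
    and "inj_on \<tau> (carrier L)" and "\<tau> \<in> ring_hom L L" and "k \<in> K \<Longrightarrow> \<tau> k = k"
  using assms unfolding auts_def bij_betw_def ring_hom_def by auto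

lemma aut_ring_hom_cring: "\<tau> \<in> auts \<Longrightarrow> ring_hom_cring L L \<tau>"
  by (intro ring_hom_cring.intro ring_hom_cring_axioms.intro is_cring) (simp add: autD)

lemma aut_pow: "\<tau> \<in> auts \<Longrightarrow> x \<in> carrier L \<Longrightarrow> \<tau> (x [^] (n::nat)) = \<tau> x [^] n"
  by (rule ring_hom_cring.hom_pow[OF aut_ring_hom_cring])

text \<open>Groups of automorphisms as sets of functions. Inverses are required on the carrier only, because
  elements of \<open>auts\<close> are arbitrary outside it.\<close>

definition group_like :: "('a \<Rightarrow> 'a) set \<Rightarrow> bool" where
  "group_like H \<longleftrightarrow> H \<subseteq> auts \<and> (\<lambda>x. x) \<in> H \<and> (\<forall>\<tau>\<in>H. \<forall>\<rho>\<in>H. (\<lambda>x. \<tau> (\<rho> x)) \<in> H) \<and>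
     (\<forall>\<tau>\<in>H. \<exists>\<rho>\<in>H. \<forall>x\<in>carrier L. \<rho> (\<tau> x) = x)"

lemma group_likeD:
  assumes "group_like H"
  shows "\<tau> \<in> H \<Longrightarrow> \<tau> \<in> auts" "(\<lambda>x. x) \<in> H" "\<tau> \<in> H \<Longrightarrow> \<rho> \<in> H \<Longrightarrow> (\<lambda>x. \<tau> (\<rho> x)) \<in> H"
    "\<tau> \<in> H \<Longrightarrow> \<exists>\<rho>\<in>H. \<forall>x\<in>carrier L. \<rho> (\<tau> x) = x"
  using assms unfolding group_like_def by blast+

lemma group_like_auts: "group_like auts"
  unfolding group_like_def
proof (intro conjI ballI)
  show "(\<lambda>x. x) \<in> auts" unfolding auts_def by (auto simp: ring_hom_def bij_betw_def)
  show "(\<lambda>x. \<tau> (\<rho> x)) \<in> auts" if "\<tau> \<in> auts" "\<rho> \<in> auts" for \<tau> \<rho>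
  proof -
    have "bij_betw (\<tau> \<circ> \<rho>) (carrier L) (carrier L)"
      using that bij_betw_trans unfolding auts_def by blast
    moreover have "\<tau> \<circ> \<rho> \<in> ring_hom L L" using that ring_hom_trans unfolding auts_def by blast
    ultimately show ?thesis using that unfolding auts_def by (auto simp: comp_def)
  qed
  show "\<exists>\<rho>\<in>auts. \<forall>x\<in>carrier L. \<rho> (\<tau> x) = x" if \<tau>: "\<tau> \<in> auts" for \<tau>
  proof -
    let ?\<rho> = "inv_into (carrier L) \<tau>"
    have bij: "bij_betw \<tau> (carrier L) (carrier L)" using \<tau> unfolding auts_def by blast
    have "\<tau> \<in> ring_iso L L" using \<tau> unfolding auts_def ring_iso_def by blast
    then have "?\<rho> \<in> ring_iso L L" by (rule ring_iso_set_sym[OF ring_axioms])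
    then have "?\<rho> \<in> ring_hom L L" "bij_betw ?\<rho> (carrier L) (carrier L)" unfolding ring_iso_def by auto
    moreover have inv: "?\<rho> (\<tau> x) = x" if "x \<in> carrier L" for x
      using bij_betw_inv_into_left[OF bij that] .
    moreover have "?\<rho> k = k" if "k \<in> K" for k using inv[OF K_carrier[OF that]] autD(6)[OF \<tau> that] by simp
    ultimately show ?thesis unfolding auts_def by blast
  qed
qed simp

lemma group_like_stabilizer:
  assumes x: "x \<in> carrier L"
  shows "group_like {\<tau> \<in> auts. \<tau> x = x}"
proof -
  note G = group_likeD[OF group_like_auts]
  have "\<exists>\<rho>\<in>{\<tau> \<in> auts. \<tau> x = x}. \<forall>z\<in>carrier L. \<rho> (\<tau> z) = z" if \<tau>: "\<tau> \<in> {\<tau> \<in> auts. \<tau> x = x}" for \<tau>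
  proof -
    have \<tau>': "\<tau> \<in> auts" "\<tau> x = x" using \<tau> by auto
    obtain \<rho> where \<rho>: "\<rho> \<in> auts" "\<forall>z\<in>carrier L. \<rho> (\<tau> z) = z" using G(4)[OF \<tau>'(1)] by blast
    then have "\<rho> x = x" using x \<tau>'(2) by metis
    then show ?thesis using \<rho> by blast
  qed
  then show ?thesis unfolding group_like_def using G(2,3) by auto
qed

abbreviation orbit :: "('a \<Rightarrow> 'a) set \<Rightarrow> 'a \<Rightarrow> 'a set" where
  "orbit H x \<equiv> (\<lambda>\<tau>. \<tau> x) ` H"

text \<open>On the orbit of an element this is the normalised trace.\<close>

definition avg :: "('a \<Rightarrow> 'a) set \<Rightarrow> 'a \<Rightarrow> 'a" where
  "avg H x = inv (nat_elem (card (orbit H x))) \<otimes> (\<Oplus>u\<in>orbit H x. u)"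

lemma aut_root:
  assumes \<tau>: "\<tau> \<in> auts" and x: "x \<in> carrier L" and cs: "set cs \<subseteq> K" and eq: "x [^] length cs = eval cs x"
  shows "\<tau> x [^] length cs = eval cs (\<tau> x)"
proof -
  have "\<tau> (eval cs x) = eval cs (\<tau> x)"
    by (rule ring_hom_eval) (use autD[OF \<tau>] cs K_carrier x in auto)
  then show ?thesis using aut_pow[OF \<tau> x] eq by metis
qed

lemma finite_orbit:
  assumes H: "H \<subseteq> auts" and x: "x \<in> carrier L"
  shows "finite (orbit H x)"
proof -
  obtain n :: nat where n: "n > 0" "x [^] n \<in> lin_span K (powers_below x n)"
    using integral[OF x] unfolding integral_elem_def by blast
  obtain cs where cs: "length cs = n" "set cs \<subseteq> K" "x [^] n = eval cs x"
    using mem_span_eval[OF subring_K x n(2)] by blast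
  let ?p = "map (\<lambda>c. \<ominus> c) cs"
  have csL: "set cs \<subseteq> carrier L" using cs(2) K_carrier by auto
  then have pL: "set ?p \<subseteq> carrier L" by auto
  have "orbit H x \<subseteq> {z \<in> carrier L. eval (\<one> # ?p) z = \<zero>}"
  proof safe
    fix \<tau> assume "\<tau> \<in> H"
    then have \<tau>: "\<tau> \<in> auts" using H by blast
    show "\<tau> x \<in> carrier L" using autD(1)[OF \<tau> x] .
    then show "eval (\<one> # ?p) (\<tau> x) = \<zero>"
      using monic_root_iff[OF csL] aut_root[OF \<tau> x cs(2)] cs by simp
  qed
  then show ?thesis using finite_roots[OF pL] finite_subset by blast
qed

lemma nat_carrier: "nat_elem n \<in> carrier L" for n :: nat
  using K_carrier nat_in_K by blast

lemma nat_mult: "nat_elem (n * k) = (nat_elem n) \<otimes> (nat_elem k)" for n k :: nat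
  by (simp add: add_pow_ldistr nat_carrier add.nat_pow_pow mult.commute)

lemma inv_nat:
  assumes "0 < (n::nat)"
  shows "inv (nat_elem n) \<in> carrier L" "inv (nat_elem n) \<in> K" "inv (nat_elem n) \<otimes> (nat_elem n) = \<one>"
  using subfield_m_inv[OF K, of "nat_elem n"] nat_in_K char0[OF assms] K_carrier by auto

text \<open>The average of \<open>f (x, y)\<close> can be computed over the orbit \<open>Q\<close> of the pair \<open>(x, y)\<close>: the group acts
  transitively on the orbit of \<open>f (x, y)\<close> and permutes the fibres of \<open>f\<close>, so that all fibres have the same
  size. The orbit of a pair is a common index set for the averages of \<open>x\<close>, \<open>y\<close> and \<open>x \<oplus> y\<close>; additivity and
  linearity of the average become additivity and linearity of sums.\<close>

lemma avg_equivariant: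
  assumes H: "group_like H" and x: "x \<in> carrier L" and y: "y \<in> carrier L"
    and f: "\<And>u v. u \<in> carrier L \<Longrightarrow> v \<in> carrier L \<Longrightarrow> f (u, v) \<in> carrier L"
    and equi: "\<And>\<tau> u v. \<tau> \<in> H \<Longrightarrow> u \<in> carrier L \<Longrightarrow> v \<in> carrier L \<Longrightarrow> f (\<tau> u, \<tau> v) = \<tau> (f (u, v))"
    and Q: "Q = (\<lambda>\<tau>. (\<tau> x, \<tau> y)) ` H"
  shows "avg H (f (x, y)) = inv (nat_elem (card Q)) \<otimes> (\<Oplus>p\<in>Q. f p)"
    and "finite Q" "Q \<noteq> {}" "Q \<subseteq> carrier L \<times> carrier L"
proof -
  note G = group_likeD[OF H]
  have HA: "H \<subseteq> auts" using G(1) by blast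
  show finQ: "finite Q"
  proof (rule finite_subset)
    show "Q \<subseteq> orbit H x \<times> orbit H y" unfolding Q by auto
  qed (use finite_orbit[OF HA] x y in simp)
  show neQ: "Q \<noteq> {}" unfolding Q using G(2) by blast
  show QL: "Q \<subseteq> carrier L \<times> carrier L" unfolding Q using autD(1)[OF G(1)] x y by auto
  let ?O = "orbit H (f (x, y))"
  let ?fib = "\<lambda>u. {p \<in> Q. f p = u}"
  have fQ: "f p \<in> carrier L" if "p \<in> Q" for p using f QL that by (cases p) auto
  have img: "?O = f ` Q" unfolding Q using equi x y by (auto simp: image_image)
  have finO: "finite ?O" unfolding img using finQ by simp
  have OL: "?O \<subseteq> carrier L" unfolding img using fQ by auto
  have act: "(\<tau> (fst p), \<tau> (snd p)) \<in> Q" if \<tau>p: "\<tau> \<in> H" "p \<in> Q" for \<tau> p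
  proof -
    obtain \<rho> where "\<rho> \<in> H" "p = (\<rho> x, \<rho> y)" using \<tau>p unfolding Q by blast
    then show ?thesis unfolding Q using G(3)[OF \<tau>p(1)] by (auto intro!: image_eqI[of _ _ "\<lambda>z. \<tau> (\<rho> z)"])
  qed
  have f_act: "f (\<tau> (fst p), \<tau> (snd p)) = \<tau> (f p)" if "\<tau> \<in> H" "p \<in> Q" for \<tau> p
    using equi[OF that(1), of "fst p" "snd p"] QL that(2) by auto
  have le: "card (?fib (f (x, y))) \<le> card (?fib (\<tau> (f (x, y))))"
    "card (?fib (\<tau> (f (x, y)))) \<le> card (?fib (f (x, y)))" if \<tau>: "\<tau> \<in> H" for \<tau>
  proof -
    have *: "card (?fib u) \<le> card (?fib (\<mu> u))" if \<mu>: "\<mu> \<in> H" for \<mu> u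
    proof (rule card_inj_on_le[of "\<lambda>p. (\<mu> (fst p), \<mu> (snd p))"])
      show "inj_on (\<lambda>p. (\<mu> (fst p), \<mu> (snd p))) (?fib u)"
      proof (rule inj_onI)
        fix p q assume p: "p \<in> ?fib u" and q: "q \<in> ?fib u"
          and eq: "(\<mu> (fst p), \<mu> (snd p)) = (\<mu> (fst q), \<mu> (snd q))"
        have "p \<in> carrier L \<times> carrier L" "q \<in> carrier L \<times> carrier L" using p q QL by blast+
        then show "p = q"
          using eq inj_onD[OF autD(4)[OF G(1)[OF \<mu>]], of "fst p" "fst q"]
            inj_onD[OF autD(4)[OF G(1)[OF \<mu>]], of "snd p" "snd q"]
          by (simp add: prod_eq_iff mem_Times_iff)
      qed
      show "(\<lambda>p. (\<mu> (fst p), \<mu> (snd p))) ` ?fib u \<subseteq> ?fib (\<mu> u)"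
        using act[OF \<mu>] f_act[OF \<mu>] by auto
    qed (use finQ in simp)
    show "card (?fib (f (x, y))) \<le> card (?fib (\<tau> (f (x, y))))" using *[OF \<tau>] .
    obtain \<rho> where \<rho>: "\<rho> \<in> H" "\<forall>z\<in>carrier L. \<rho> (\<tau> z) = z" using G(4)[OF \<tau>] by blast
    then show "card (?fib (\<tau> (f (x, y)))) \<le> card (?fib (f (x, y)))"
      using *[OF \<rho>(1), of "\<tau> (f (x, y))"] f[OF x y] by simp
  qed
  define d where "d = card (?fib (f (x, y)))"
  have card_fib: "card (?fib u) = d" if "u \<in> ?O" for u
    using that le unfolding d_def by (auto intro: antisym)
  have UN: "(\<Union>u\<in>?O. ?fib u) = Q" unfolding img by blast
  have "(x, y) \<in> Q" unfolding Q using G(2) by (auto intro!: image_eqI[of _ _ "\<lambda>z. z"])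
  then have d0: "d > 0" unfolding d_def using finQ by (auto simp: card_gt_0_iff)
  have cardQ: "card Q = d * card ?O"
  proof -
    have "card Q = card (\<Union>u\<in>?O. ?fib u)" by (simp only: UN)
    also have "\<dots> = (\<Sum>u\<in>?O. card (?fib u))"
      by (rule card_UN_disjoint) (use finO finQ in auto)
    also have "\<dots> = (\<Sum>u\<in>?O. d)" using card_fib by (intro sum.cong) auto
    finally show ?thesis by simp
  qed
  have "(\<Oplus>p\<in>Q. f p) = finsum L f (\<Union>u\<in>?O. ?fib u)" by (simp only: UN)
  also have "\<dots> = (\<Oplus>u\<in>?O. (\<Oplus>p\<in>?fib u. f p))"
    by (rule add.finprod_UN_disjoint) (use finO finQ fQ in \<open>auto simp: pairwise_def disjnt_def\<close>)
  also have "\<dots> = (\<Oplus>u\<in>?O. (nat_elem d) \<otimes> u)"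
  proof (rule finsum_cong')
    fix u assume u: "u \<in> ?O"
    have uL: "u \<in> carrier L" using u OL by blast
    have "(\<Oplus>p\<in>?fib u. f p) = (\<Oplus>p\<in>?fib u. u)" by (rule finsum_cong') (use uL in auto)
    also have "\<dots> = [card (?fib u)] \<cdot> u" using uL by (rule add.finprod_const)
    finally show "(\<Oplus>p\<in>?fib u. f p) = (nat_elem d) \<otimes> u" using card_fib[OF u] uL by (simp add: add_pow_ldistr)
  qed (use OL nat_carrier in auto)
  also have "\<dots> = (nat_elem d) \<otimes> (\<Oplus>u\<in>?O. u)"
    using finO OL nat_carrier by (intro finsum_rdistr[symmetric]) auto
  finally have sum: "(\<Oplus>p\<in>Q. f p) = (nat_elem d) \<otimes> (\<Oplus>u\<in>?O. u)" .
  let ?s = "\<Oplus>u\<in>?O. u"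
  have sL: "?s \<in> carrier L" using OL by (intro finsum_closed) auto
  have o0: "card ?O > 0" using finO neQ img by (simp add: card_gt_0_iff)
  have q0: "card Q > 0" using finQ neQ by (simp add: card_gt_0_iff)
  have "nat_elem (card Q) = (nat_elem d) \<otimes> (nat_elem (card ?O))" unfolding cardQ by (rule nat_mult)
  then have "inv (nat_elem (card Q)) \<otimes> ((nat_elem d) \<otimes> (nat_elem (card ?O))) = \<one>" using inv_nat(3)[OF q0] by simp
  then have "inv (nat_elem (card ?O)) = inv (nat_elem (card Q)) \<otimes> (nat_elem d)"
    using inv_nat(1)[OF q0] nat_carrier by (intro comm_inv_char) (auto simp: m_ac)
  then show "avg H (f (x, y)) = inv (nat_elem (card Q)) \<otimes> (\<Oplus>p\<in>Q. f p)"
    unfolding avg_def sum using inv_nat(1)[OF q0] nat_carrier sL by (simp add: m_assoc)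
qed

lemma avg_closed:
  assumes H: "group_like H" and x: "x \<in> carrier L"
  shows "avg H x \<in> carrier L"
proof -
  have "orbit H x \<subseteq> carrier L" using autD(1)[OF group_likeD(1)[OF H]] x by auto
  moreover have "card (orbit H x) > 0"
    using finite_orbit[OF _ x, of H] group_likeD(1,2)[OF H] by (auto simp: card_gt_0_iff)
  ultimately show ?thesis unfolding avg_def using inv_nat(1) by (auto intro!: finsum_closed)
qed

lemma avg_add:
  assumes H: "group_like H" and x: "x \<in> carrier L" and y: "y \<in> carrier L"
  shows "avg H (x \<oplus> y) = avg H x \<oplus> avg H y"
proof -
  define Q where "Q = (\<lambda>\<tau>. (\<tau> x, \<tau> y)) ` H"
  note aut = autD(1,2)[OF group_likeD(1)[OF H]]
  have 1: "avg H x = inv (nat_elem (card Q)) \<otimes> (\<Oplus>p\<in>Q. fst p)"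
    using avg_equivariant(1)[OF H x y _ _ Q_def, of fst] by simp
  have 2: "avg H y = inv (nat_elem (card Q)) \<otimes> (\<Oplus>p\<in>Q. snd p)"
    using avg_equivariant(1)[OF H x y _ _ Q_def, of snd] by simp
  have 3: "avg H (x \<oplus> y) = inv (nat_elem (card Q)) \<otimes> (\<Oplus>p\<in>Q. fst p \<oplus> snd p)"
    using avg_equivariant(1)[OF H x y _ _ Q_def, of "\<lambda>p. fst p \<oplus> snd p"] aut by simp
  have Q: "finite Q" "Q \<noteq> {}" "Q \<subseteq> carrier L \<times> carrier L"
    using avg_equivariant(2-4)[OF H x y _ _ Q_def, of fst] by auto
  have c: "fst \<in> Q \<rightarrow> carrier L" "snd \<in> Q \<rightarrow> carrier L" using Q(3) by auto
  have "card Q > 0" using Q by (simp add: card_gt_0_iff)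
  then show ?thesis unfolding 1 2 3
    using inv_nat(1) c by (simp add: finsum_addf r_distr)
qed

lemma avg_smult:
  assumes H: "group_like H" and x: "x \<in> carrier L" and r: "r \<in> carrier L" "\<And>\<tau>. \<tau> \<in> H \<Longrightarrow> \<tau> r = r"
  shows "avg H (r \<otimes> x) = r \<otimes> avg H x"
proof -
  define Q where "Q = (\<lambda>\<tau>. (\<tau> x, \<tau> x)) ` H"
  note aut = autD(1,3)[OF group_likeD(1)[OF H]]
  have 1: "avg H x = inv (nat_elem (card Q)) \<otimes> (\<Oplus>p\<in>Q. fst p)"
    using avg_equivariant(1)[OF H x x _ _ Q_def, of fst] by simp
  have "avg H ((\<lambda>p. r \<otimes> fst p) (x, x)) = inv (nat_elem (card Q)) \<otimes> (\<Oplus>p\<in>Q. r \<otimes> fst p)"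
  proof (rule avg_equivariant(1)[OF H x x _ _ Q_def])
    show "r \<otimes> fst (u, v) \<in> carrier L" if "u \<in> carrier L" for u v :: 'a using that r(1) by simp
    show "r \<otimes> fst (\<tau> u, \<tau> v) = \<tau> (r \<otimes> fst (u, v))" if "\<tau> \<in> H" "u \<in> carrier L" for \<tau> and u v :: 'a
      using aut(2)[OF that(1) r(1) that(2)] r(2)[OF that(1)] by simp
  qed
  then have 3: "avg H (r \<otimes> x) = inv (nat_elem (card Q)) \<otimes> (\<Oplus>p\<in>Q. r \<otimes> fst p)" by simp
  have Q: "finite Q" "Q \<noteq> {}" "Q \<subseteq> carrier L \<times> carrier L"
    using avg_equivariant(2-4)[OF H x x _ _ Q_def, of fst] by auto
  have c: "fst \<in> Q \<rightarrow> carrier L" using Q(3) by auto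
  then have sL: "(\<Oplus>p\<in>Q. fst p) \<in> carrier L" by (rule finsum_closed)
  have "card Q > 0" using Q by (simp add: card_gt_0_iff)
  moreover have "(\<Oplus>p\<in>Q. r \<otimes> fst p) = r \<otimes> (\<Oplus>p\<in>Q. fst p)"
    using finsum_rdistr[OF Q(1) r(1) c] by simp
  ultimately show ?thesis unfolding 1 3 using inv_nat(1) r(1) sL by (simp add: m_lcomm)
qed

lemma avg_fixed_elem:
  assumes H: "group_like H" and x: "x \<in> carrier L" "\<And>\<tau>. \<tau> \<in> H \<Longrightarrow> \<tau> x = x"
  shows "avg H x = x"
proof -
  have "orbit H x = {x}" using x(2) group_likeD(2)[OF H] by auto
  moreover have "(\<Oplus>u\<in>{x}. u) = x" using x(1) by simp
  moreover have "inv \<one> = \<one>" by simp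
  ultimately show ?thesis unfolding avg_def using x(1) by simp
qed

lemma avg_invariant:
  assumes H: "group_like H" and x: "x \<in> carrier L" and \<tau>: "\<tau> \<in> H"
  shows "\<tau> (avg H x) = avg H x"
proof -
  note G = group_likeD[OF H]
  let ?O = "orbit H x"
  interpret h: ring_hom_cring L L \<tau> by (rule aut_ring_hom_cring[OF G(1)[OF \<tau>]])
  have OL: "?O \<subseteq> carrier L" using autD(1)[OF G(1)] x by auto
  have fin: "finite ?O" using finite_orbit[OF _ x] G(1) by blast
  have pos: "card ?O > 0" using fin G(2) by (auto simp: card_gt_0_iff)
  have inj: "inj_on \<tau> ?O" using autD(4)[OF G(1)[OF \<tau>]] OL by (rule inj_on_subset)
  have "\<tau> ` ?O \<subseteq> ?O"
  proof safe
    fix \<rho> assume "\<rho> \<in> H"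
    from G(3)[OF \<tau> this] show "\<tau> (\<rho> x) \<in> ?O" by (intro image_eqI[of _ _ "\<lambda>z. \<tau> (\<rho> z)"]) simp
  qed
  then have surj: "\<tau> ` ?O = ?O" using endo_inj_surj[OF fin _ inj] by blast
  have "\<tau> (\<Oplus>u\<in>?O. u) = (\<Oplus>u\<in>?O. \<tau> u)" using h.hom_finsum[of "\<lambda>u. u" ?O] OL
    by (simp add: comp_def Pi_iff subset_iff)
  also have "\<dots> = (\<Oplus>u\<in>\<tau> ` ?O. u)"
  proof (rule finsum_reindex[OF _ inj, symmetric])
    show "(\<lambda>u. u) \<in> \<tau> ` ?O \<rightarrow> carrier L" using OL unfolding surj by blast
  qed
  finally have "\<tau> (\<Oplus>u\<in>?O. u) = (\<Oplus>u\<in>?O. u)" unfolding surj .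
  moreover have "(\<Oplus>u\<in>?O. u) \<in> carrier L" using OL by (intro finsum_closed) auto
  ultimately show ?thesis
    unfolding avg_def using inv_nat[OF pos] autD(6)[OF G(1)[OF \<tau>]] by simp
qed

text \<open>Induction on the index set: subtracting \<open>u k\<close> times the equation for \<open>j\<close> from the equation for
  \<open>Suc j\<close> removes the index \<open>k\<close> and multiplies the other coefficients by \<open>u i \<ominus> u k\<close>, which is nonzero.\<close>

lemma vandermonde:
  assumes "finite I" "inj_on u I" "\<And>i. i \<in> I \<Longrightarrow> u i \<in> carrier L" "\<And>i. i \<in> I \<Longrightarrow> v i \<in> carrier L"
    and "\<And>j. j < card I \<Longrightarrow> (\<Oplus>i\<in>I. v i \<otimes> u i [^] (j::nat)) = \<zero>"
  shows "\<forall>i\<in>I. v i = \<zero>"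
  using assms
proof (induction I arbitrary: v rule: finite_induct)
  case empty
  then show ?case by simp
next
  case (insert k I)
  have uk: "u k \<in> carrier L" and vk: "v k \<in> carrier L"
    and ui: "\<And>i. i \<in> I \<Longrightarrow> u i \<in> carrier L" and vi: "\<And>i. i \<in> I \<Longrightarrow> v i \<in> carrier L"
    using insert.prems by auto
  have s: "(\<Oplus>i\<in>insert k I. v i \<otimes> u i [^] j) = v k \<otimes> u k [^] j \<oplus> (\<Oplus>i\<in>I. v i \<otimes> u i [^] j)" for j :: nat
    using insert.hyps uk vk ui vi by (intro finsum_insert) auto
  have mem: "(\<lambda>i. v i \<otimes> u i [^] j) \<in> I \<rightarrow> carrier L" for j :: nat using ui vi by auto
  let ?S = "\<lambda>j::nat. (\<Oplus>i\<in>I. v i \<otimes> u i [^] j)"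
  have SL: "?S j \<in> carrier L" for j using mem by (rule finsum_closed)
  have "\<forall>i\<in>I. v i \<otimes> (u i \<ominus> u k) = \<zero>"
  proof (rule insert.IH)
    show "inj_on u I" using insert.prems(1) by auto
    show "\<And>i. i \<in> I \<Longrightarrow> u i \<in> carrier L" "\<And>i. i \<in> I \<Longrightarrow> v i \<otimes> (u i \<ominus> u k) \<in> carrier L"
      using ui vi uk by auto
    fix j assume j: "j < card I"
    have "(\<Oplus>i\<in>I. v i \<otimes> (u i \<ominus> u k) \<otimes> u i [^] j) = (\<Oplus>i\<in>I. v i \<otimes> u i [^] Suc j \<oplus> (\<ominus> u k) \<otimes> (v i \<otimes> u i [^] j))"
    proof (rule finsum_cong')
      fix i assume i: "i \<in> I"
      have "\<lbrakk>V \<in> carrier L; U \<in> carrier L; W \<in> carrier L; Z \<in> carrier L\<rbrakk> \<Longrightarrow>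
         V \<otimes> (U \<ominus> W) \<otimes> Z = V \<otimes> (Z \<otimes> U) \<oplus> (\<ominus> W) \<otimes> (V \<otimes> Z)" for V U W Z
        by algebra
      from this[OF vi[OF i] ui[OF i] uk nat_pow_closed[OF ui[OF i]]]
      show "v i \<otimes> (u i \<ominus> u k) \<otimes> u i [^] j = v i \<otimes> u i [^] Suc j \<oplus> (\<ominus> u k) \<otimes> (v i \<otimes> u i [^] j)"
        by simp
    qed (use ui vi uk in auto)
    also have "\<dots> = ?S (Suc j) \<oplus> (\<Oplus>i\<in>I. (\<ominus> u k) \<otimes> (v i \<otimes> u i [^] j))"
      using ui vi uk by (intro finsum_addf) auto
    also have "(\<Oplus>i\<in>I. (\<ominus> u k) \<otimes> (v i \<otimes> u i [^] j)) = (\<ominus> u k) \<otimes> ?S j"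
      using insert.hyps(1) mem uk by (intro finsum_rdistr[symmetric]) auto
    finally have eq: "(\<Oplus>i\<in>I. v i \<otimes> (u i \<ominus> u k) \<otimes> u i [^] j) = ?S (Suc j) \<oplus> (\<ominus> u k) \<otimes> ?S j" .
    have z: "v k \<otimes> u k [^] j \<oplus> ?S j = \<zero>" "v k \<otimes> u k [^] Suc j \<oplus> ?S (Suc j) = \<zero>"
      using insert.prems(4)[of j] insert.prems(4)[of "Suc j"] j insert.hyps
      unfolding s[of j] s[of "Suc j"] by auto
    have "\<lbrakk>V \<in> carrier L; W \<in> carrier L; Z \<in> carrier L; S \<in> carrier L; S' \<in> carrier L\<rbrakk> \<Longrightarrow>
         S' \<oplus> (\<ominus> W) \<otimes> S = (V \<otimes> (Z \<otimes> W) \<oplus> S') \<oplus> (\<ominus> W) \<otimes> (V \<otimes> Z \<oplus> S)" for V W Z S S'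
      by algebra
    from this[OF vk uk nat_pow_closed[OF uk, of j] SL[of j] SL[of "Suc j"]]
    have "?S (Suc j) \<oplus> (\<ominus> u k) \<otimes> ?S j =
        (v k \<otimes> u k [^] Suc j \<oplus> ?S (Suc j)) \<oplus> (\<ominus> u k) \<otimes> (v k \<otimes> u k [^] j \<oplus> ?S j)"
      by (simp only: nat_pow_Suc)
    also have "\<dots> = \<zero>" unfolding z using uk by simp
    finally show "(\<Oplus>i\<in>I. v i \<otimes> (u i \<ominus> u k) \<otimes> u i [^] j) = \<zero>" unfolding eq .
  qed
  then have vI: "v i = \<zero>" if i: "i \<in> I" for i
  proof -
    have "u i \<noteq> u k" using insert.prems(1) insert.hyps(2) i by (auto simp: inj_on_def)
    then have "u i \<ominus> u k \<noteq> \<zero>" using ui[OF i] uk by simp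
    moreover have "v i \<otimes> (u i \<ominus> u k) = \<zero>" using i \<open>\<forall>i\<in>I. v i \<otimes> (u i \<ominus> u k) = \<zero>\<close> by blast
    ultimately show ?thesis using ui[OF i] vi[OF i] uk integral_iff by auto
  qed
  have "?S 0 = \<zero>"
  proof -
    have "?S 0 = (\<Oplus>i\<in>I. \<zero>)" by (rule finsum_cong') (use vI in auto)
    then show ?thesis by simp
  qed
  then have "v k = \<zero>" using insert.prems(4)[of 0] s[of 0] vk insert.hyps by auto
  then show ?case using vI by simp
qed

end

section \<open>Integral elements over a noetherian ring\<close>

context cring
begin

text \<open>The \<open>A\<close>-span of all powers of \<open>z\<close> is a submodule of a finitely generated module, hence finitely
  generated; its generators involve powers up to some bound, and the next power is in their span.\<close>

lemma integral_of_finite_extension: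
  assumes A: "subring A R" and noeth: "\<And>I. lin_sub A I \<Longrightarrow> I \<subseteq> A \<Longrightarrow> fin_gen A I"
    and N: "subring N R" "A \<subseteq> N" and B: "finite B" "B \<subseteq> carrier R" "N \<subseteq> lin_span A B" and z: "z \<in> N"
  shows "integral_elem A z"
proof -
  note NE = subringE[OF N(1)]
  have zc: "z \<in> carrier R" using z NE(1) by blast
  have lN: "lin_sub A N" by (rule lin_subI) (use NE N(2) in auto)
  let ?P = "range (\<lambda>i::nat. z [^] i)"
  have Pc: "?P \<subseteq> carrier R" using zc by auto
  have "z [^] i \<in> N" for i :: nat by (induction i) (use NE z in auto)
  then have VN: "lin_span A ?P \<subseteq> N" by (intro lin_span_least[OF lN]) auto
  have "fin_gen A (lin_span A ?P)"
    by (rule fin_gen_submodule[OF A noeth B(1,2) lin_sub_lin_span[OF A Pc]]) (use VN B(3) in auto)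
  then obtain C where C: "C \<subseteq> lin_span A ?P" "finite C" "lin_span A ?P = lin_span A C"
    unfolding fin_gen_def by blast
  have mono: "lin_span A (powers_below z k) \<subseteq> lin_span A (powers_below z l)" if "k \<le> l" for k l
    using that by (intro lin_span_mono) auto
  have bound: "\<exists>k. v \<in> lin_span A (powers_below z k)" if "v \<in> lin_span A ?P" for v
    using that
  proof induction
    case zero
    then show ?case using lin_span.zero by blast
  next
    case (add r b v)
    then obtain i :: nat and k where ik: "b = z [^] i" "v \<in> lin_span A (powers_below z k)" by blast
    have b': "b \<in> powers_below z (max k (Suc i))" using ik(1) by auto
    have v': "v \<in> lin_span A (powers_below z (max k (Suc i)))" using mono[of k "max k (Suc i)"] ik(2) by auto
    show ?case by (rule exI[of _ "max k (Suc i)"]) (rule lin_span.add[OF add.hyps(1) b' v'])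
  qed
  have "\<exists>k. C \<subseteq> lin_span A (powers_below z k)"
    using C(2,1)
  proof (induction C rule: finite_induct)
    case empty
    then show ?case by simp
  next
    case (insert c C)
    then obtain k l where "C \<subseteq> lin_span A (powers_below z k)" "c \<in> lin_span A (powers_below z l)"
      using bound by blast
    then have "insert c C \<subseteq> lin_span A (powers_below z (max k l))"
      using mono[of k "max k l"] mono[of l "max k l"] by auto
    then show ?case by blast
  qed
  then obtain k where k: "C \<subseteq> lin_span A (powers_below z k)" by blast
  then have "C \<subseteq> lin_span A (powers_below z (Suc k))" using mono[of k "Suc k"] by auto
  then have "lin_span A ?P \<subseteq> lin_span A (powers_below z (Suc k))"
    using lin_span_least[OF lin_sub_lin_span[OF A powers_below_carrier[OF zc]]] C(3) by simp
  moreover have "z [^] Suc k \<in> lin_span A ?P" using lin_span_base[OF A Pc] by blast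
  ultimately show ?thesis unfolding integral_elem_def using zc by blast
qed

lemma lin_span_lin_span:
  assumes A: "subring A R" and B: "B \<subseteq> carrier R" and C: "C \<subseteq> carrier R"
  shows "lin_span (lin_span A B) C \<subseteq> lin_span A ((\<lambda>(b, c). b \<otimes> c) ` (B \<times> C))"
proof
  let ?D = "(\<lambda>(b, c). b \<otimes> c) ` (B \<times> C)"
  have D: "?D \<subseteq> carrier R" using B C by auto
  note S = lin_subD[OF lin_sub_lin_span[OF A D]]
  note Ac = subringE(1)[OF A] and Bc = lin_span_carrier[OF subringE(1)[OF A] B]
  fix x assume "x \<in> lin_span (lin_span A B) C"
  then show "x \<in> lin_span A ?D"
  proof induction
    case zero
    then show ?case by (rule lin_span.zero)
  next
    case (add r c v)
    have c: "c \<in> carrier R" using add C by blast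
    have "r \<otimes> c \<in> lin_span A ?D"
      using add.hyps(1)
    proof induction
      case zero
      then show ?case using c S(2) by simp
    next
      case (add s b w)
      then have car: "s \<in> carrier R" "b \<in> carrier R" "w \<in> carrier R" using Ac B Bc by auto
      have bc: "b \<otimes> c \<in> ?D" using add.hyps(2) \<open>c \<in> C\<close> by force
      have "s \<otimes> (b \<otimes> c) \<oplus> w \<otimes> c \<in> lin_span A ?D"
        by (rule lin_span.add[OF add.hyps(1) bc add.IH])
      then show ?case using car c by (simp add: l_distr m_assoc)
    qed
    then show ?case using S(3) add.IH by blast
  qed
qed

text \<open>Two integral elements are contained in a finite extension of \<open>A\<close>, namely \<open>A[x][y]\<close>.\<close>

lemma subring_integral:
  assumes A: "subring A R" and noeth: "\<And>I. lin_sub A I \<Longrightarrow> I \<subseteq> A \<Longrightarrow> fin_gen A I"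
  shows "subring {z. integral_elem A z} R"
proof -
  have ext: "\<exists>N. subring N R \<and> x \<in> N \<and> y \<in> N \<and> (\<forall>z\<in>N. integral_elem A z)"
    if x: "integral_elem A x" and y: "integral_elem A y" for x y
  proof -
    obtain n :: nat where n: "0 < n" "x [^] n \<in> lin_span A (powers_below x n)" and xc: "x \<in> carrier R"
      using x unfolding integral_elem_def by blast
    let ?S = "lin_span A (powers_below x n)"
    note S = subring_span_powers[OF A xc n]
    have "integral_elem ?S y" using integral_elem_mono[OF S(2) y] .
    then obtain k :: nat where k: "0 < k" "y [^] k \<in> lin_span ?S (powers_below y k)" and yc: "y \<in> carrier R"
      unfolding integral_elem_def by blast
    let ?N = "lin_span ?S (powers_below y k)"
    note N = subring_span_powers[OF S(1) yc k]
    let ?D = "(\<lambda>(b, c). b \<otimes> c) ` (powers_below x n \<times> powers_below y k)"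
    have "finite ?D" "?D \<subseteq> carrier R" using xc yc by auto
    moreover have "?N \<subseteq> lin_span A ?D"
      by (rule lin_span_lin_span[OF A]) (use xc yc in auto)
    ultimately have "\<forall>z\<in>?N. integral_elem A z"
      using integral_of_finite_extension[OF A noeth N(1)] S(2) N(2) by blast
    moreover have "x \<in> ?N" using S(3)[of 1] N(2) xc by auto
    moreover have "y \<in> ?N" using N(3)[of 1] yc by simp
    ultimately show ?thesis using N(1) by blast
  qed
  show ?thesis
  proof (rule subringI)
    show "{z. integral_elem A z} \<subseteq> carrier R" unfolding integral_elem_def by blast
    show "\<one> \<in> {z. integral_elem A z}" using integral_elem_in[OF subringE(3)[OF A] A] by simp
    show "\<ominus> h \<in> {z. integral_elem A z}" if hz: "h \<in> {z. integral_elem A z}" for h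
    proof -
      obtain N where N: "subring N R" "h \<in> N" "\<forall>z\<in>N. integral_elem A z" using ext[of h h] hz by blast
      show ?thesis using subringE(5)[OF N(1,2)] N(3) by blast
    qed
    show "h \<otimes> k \<in> {z. integral_elem A z}" "h \<oplus> k \<in> {z. integral_elem A z}"
      if hk: "h \<in> {z. integral_elem A z}" "k \<in> {z. integral_elem A z}" for h k
    proof -
      obtain N where N: "subring N R" "h \<in> N" "k \<in> N" "\<forall>z\<in>N. integral_elem A z" using ext hk by blast
      show "h \<otimes> k \<in> {z. integral_elem A z}" "h \<oplus> k \<in> {z. integral_elem A z}"
        using subringE(6,7)[OF N(1) N(2,3)] N(4) by blast+
    qed
  qed
qed

end

section \<open>The absolute integral closure of a two-dimensional regular ring\<close>

locale regular_surface_closure =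
  two_dim_regular L A a b + char0_alg_closed_over L K for L (structure) and A a b K +
  assumes A_K: "A \<subseteq> K"
    and fractions: "\<And>k. k \<in> K \<Longrightarrow> \<exists>q\<in>A. q \<noteq> \<zero> \<and> q \<otimes> k \<in> A"
    and inv_nat_A: "\<And>n::nat. 0 < n \<Longrightarrow> inv (nat_elem n) \<in> A"
begin

definition integral_elems :: "'a set" where
  "integral_elems = {z. integral_elem A z}"

lemma subring_integral_elems: "subring integral_elems L"
  unfolding integral_elems_def by (rule subring_integral[OF subring_A noeth])

lemma A_integral_elems: "A \<subseteq> integral_elems"
  unfolding integral_elems_def using integral_elem_in[OF _ subring_A] by blast

lemma lin_sub_integral_elems: "lin_sub A integral_elems"
  by (rule lin_subI) (use subringE[OF subring_integral_elems] A_integral_elems in auto)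

text \<open>If \<open>q w \<in> A\<close> and \<open>w\<close> satisfies a monic equation of degree \<open>n\<close>, then \<open>q\<^sup>n\<close> is a common denominator for the
  ring \<open>A[w]\<close>, which is thus contained in \<open>A\<close>.\<close>

lemma integral_elems_K: "integral_elems \<inter> K \<subseteq> A"
proof
  fix w assume w: "w \<in> integral_elems \<inter> K"
  then obtain n :: nat where n: "0 < n" "w [^] n \<in> lin_span A (powers_below w n)" and wL: "w \<in> carrier L"
    unfolding integral_elems_def integral_elem_def by blast
  obtain q where q: "q \<in> A" "q \<noteq> \<zero>" "q \<otimes> w \<in> A" using fractions w by blast
  let ?N = "lin_span A (powers_below w n)"
  note N = subring_span_powers[OF subring_A wL n]
  have pw: "q [^] n \<otimes> w [^] i \<in> A" if "i < n" for i
  proof -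
    have "q [^] n = q [^] (n - i) \<otimes> q [^] i" using that q(1) by (simp add: nat_pow_mult)
    then have "q [^] n \<otimes> w [^] i = q [^] (n - i) \<otimes> (q \<otimes> w) [^] i"
      using q(1) wL by (simp add: nat_pow_distrib m_assoc)
    then show ?thesis using q by simp
  qed
  have "q [^] n \<otimes> y \<in> A" if "y \<in> ?N" for y
    using that
  proof induction
    case zero
    then show ?case using q by simp
  next
    case (add r b v)
    then obtain i where i: "b = w [^] i" "i < n" by blast
    have vL: "v \<in> carrier L" using add.hyps(3) subringE(1)[OF N(1)] by blast
    have "q [^] n \<otimes> (r \<otimes> b \<oplus> v) = r \<otimes> (q [^] n \<otimes> b) \<oplus> q [^] n \<otimes> v"
      using add.hyps(1) i wL vL q(1) by (simp add: r_distr m_lcomm)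
    then show ?case using add.hyps(1) add.IH pw[OF i(2)] i(1) by simp
  qed
  then have "?N \<subseteq> A"
    using normal[OF N(1,2) A_pow[OF q(1)] pow_nz[OF A_carrier[OF q(1)] q(2)]] by blast
  then show "w \<in> A" using N(3)[of 1] wL by auto
qed

lemma aut_integral:
  assumes \<tau>: "\<tau> \<in> auts" and x: "x \<in> integral_elems"
  shows "\<tau> x \<in> integral_elems"
proof -
  obtain n :: nat where n: "0 < n" "x [^] n \<in> lin_span A (powers_below x n)" and xL: "x \<in> carrier L"
    using x unfolding integral_elems_def integral_elem_def by blast
  obtain cs where cs: "length cs = n" "set cs \<subseteq> A" "x [^] n = eval cs x"
    using mem_span_eval[OF subring_A xL n(2)] by blast
  have "\<tau> x [^] n = eval cs (\<tau> x)" using aut_root[OF \<tau> xL] cs A_K by auto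
  moreover have tL: "\<tau> x \<in> carrier L" using autD(1)[OF \<tau> xL] .
  ultimately have "\<tau> x [^] n \<in> lin_span A (powers_below (\<tau> x) n)"
    using eval_mem_span[OF subring_A tL cs(2)] cs(1) by simp
  then show ?thesis unfolding integral_elems_def integral_elem_def using n(1) tL by blast
qed

lemma avg_integral:
  assumes H: "group_like H" and x: "x \<in> integral_elems"
  shows "avg H x \<in> integral_elems"
proof -
  note G = group_likeD[OF H]
  have xL: "x \<in> carrier L" using x subringE(1)[OF subring_integral_elems] by blast
  have fin: "finite (orbit H x)" using finite_orbit[OF _ xL] G(1) by blast
  then have "card (orbit H x) > 0" using G(2) by (auto simp: card_gt_0_iff)
  moreover have "(\<Oplus>u\<in>orbit H x. u) \<in> integral_elems"
    by (rule lin_sub_finsum[OF lin_sub_integral_elems fin]) (use aut_integral[OF G(1)] x in auto)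
  ultimately show ?thesis unfolding avg_def
    using lin_subD(4)[OF lin_sub_integral_elems inv_nat_A] by blast
qed

lemma fixed_by_auts:
  assumes "x \<in> carrier L" "\<And>\<tau>. \<tau> \<in> auts \<Longrightarrow> \<tau> x = x"
  shows "x \<in> K"
  using exists_moving_aut[OF char0 assms(1)] assms(2) by blast

lemma trace_in_A:
  assumes "x \<in> integral_elems"
  shows "avg auts x \<in> A"
proof -
  have xL: "x \<in> carrier L" using assms subringE(1)[OF subring_integral_elems] by blast
  have "avg auts x \<in> K"
    using avg_closed[OF group_like_auts xL] avg_invariant[OF group_like_auts xL] by (rule fixed_by_auts)
  then show ?thesis using integral_elems_K avg_integral[OF group_like_auts assms] by blast
qed

text \<open>The average over all automorphisms is \<open>A\<close>-linear and maps integral elements to \<open>A\<close>, so that it maps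
  their saturation to the saturation of \<open>A\<close>, which is \<open>A\<close>.\<close>

lemma trace_saturation:
  assumes "y \<in> saturation integral_elems"
  shows "avg auts y \<in> A"
proof -
  obtain k :: nat where k: "y \<in> carrier L" "a [^] k \<otimes> y \<in> integral_elems" "b [^] k \<otimes> y \<in> integral_elems"
    using assms unfolding saturation_def by blast
  have "avg auts (r \<otimes> y) = r \<otimes> avg auts y" if "r \<in> A" for r
    by (rule avg_smult[OF group_like_auts k(1)]) (use that A_K autD(6) in auto)
  then have "a [^] k \<otimes> avg auts y = avg auts (a [^] k \<otimes> y)" "b [^] k \<otimes> avg auts y = avg auts (b [^] k \<otimes> y)"
    by simp_all
  then have "a [^] k \<otimes> avg auts y \<in> A" "b [^] k \<otimes> avg auts y \<in> A"
    using trace_in_A[OF k(2)] trace_in_A[OF k(3)] by simp_all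
  then have "avg auts y \<in> saturation A"
    unfolding saturation_def using avg_closed[OF group_like_auts k(1)] by blast
  then show ?thesis by (simp add: saturation_A)
qed

text \<open>Since \<open>y\<close> is fixed by the stabiliser of \<open>x\<close>, a conjugate of the pair \<open>(x, y)\<close> is determined by its first
  component. The vanishing averages are a Vandermonde system with the distinct conjugates of \<open>x\<close> as nodes
  and the conjugates of \<open>y\<close> as unknowns.\<close>

lemma trace_form_nondegenerate:
  assumes x: "x \<in> carrier L" and y: "y \<in> carrier L"
    and stab: "\<And>\<tau>. \<tau> \<in> auts \<Longrightarrow> \<tau> x = x \<Longrightarrow> \<tau> y = y"
    and zero: "\<And>j. j < card (orbit auts x) \<Longrightarrow> avg auts (y \<otimes> x [^] (j::nat)) = \<zero>"
  shows "y = \<zero>"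
proof -
  note G = group_likeD[OF group_like_auts]
  define Q where "Q = (\<lambda>\<tau>. (\<tau> x, \<tau> y)) ` auts"
  have eqv: "avg auts (y \<otimes> x [^] j) = inv (nat_elem (card Q)) \<otimes> (\<Oplus>p\<in>Q. snd p \<otimes> fst p [^] j)
     \<and> finite Q \<and> Q \<noteq> {} \<and> Q \<subseteq> carrier L \<times> carrier L" for j :: nat
  proof -
    let ?f = "\<lambda>p. snd p \<otimes> fst p [^] j"
    have f: "?f (u, v) \<in> carrier L" if "u \<in> carrier L" "v \<in> carrier L" for u v using that by simp
    have e: "?f (\<tau> u, \<tau> v) = \<tau> (?f (u, v))" if \<tau>: "\<tau> \<in> auts" and "u \<in> carrier L" "v \<in> carrier L" for \<tau> u v
      using that(2,3) autD(3)[OF \<tau>] aut_pow[OF \<tau>] by simp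
    note avg_equivariant[OF group_like_auts x y f e Q_def]
    then show ?thesis by simp
  qed
  then have Q: "finite Q" "Q \<noteq> {}" "Q \<subseteq> carrier L \<times> carrier L" by blast+
  have inj: "inj_on fst Q"
  proof (rule inj_onI)
    fix p q assume "p \<in> Q" "q \<in> Q" and eq: "fst p = fst q"
    then obtain \<tau> \<rho> where t: "\<tau> \<in> auts" "p = (\<tau> x, \<tau> y)" and r: "\<rho> \<in> auts" "q = (\<rho> x, \<rho> y)"
      unfolding Q_def by blast
    obtain \<mu> where \<mu>: "\<mu> \<in> auts" "\<forall>z\<in>carrier L. \<mu> (\<rho> z) = z" using G(4)[OF r(1)] by blast
    have xx: "\<tau> x = \<rho> x" using eq t r by simp
    have "(\<lambda>z. \<mu> (\<tau> z)) \<in> auts" using G(3)[OF \<mu>(1) t(1)] .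
    moreover have "\<mu> (\<tau> x) = x" using xx \<mu>(2) x by simp
    ultimately have "\<mu> (\<tau> y) = y" using stab by blast
    also have "y = \<mu> (\<rho> y)" using \<mu>(2) y by simp
    finally have "\<tau> y = \<rho> y"
      using inj_onD[OF autD(4)[OF \<mu>(1)]] autD(1)[OF t(1) y] autD(1)[OF r(1) y] by blast
    then show "p = q" using xx t r by simp
  qed
  have cardQ: "card Q = card (orbit auts x)"
  proof -
    have "fst ` Q = orbit auts x" unfolding Q_def by (simp add: image_image)
    then show ?thesis using card_image[OF inj] by simp
  qed
  have pos: "card Q > 0" using Q by (simp add: card_gt_0_iff)
  have "\<forall>p\<in>Q. snd p = \<zero>"
  proof (rule vandermonde[OF Q(1) inj])
    show "\<And>p. p \<in> Q \<Longrightarrow> fst p \<in> carrier L" "\<And>p. p \<in> Q \<Longrightarrow> snd p \<in> carrier L" using Q(3) by auto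
    fix j :: nat assume "j < card Q"
    then have "inv (nat_elem (card Q)) \<otimes> (\<Oplus>p\<in>Q. snd p \<otimes> fst p [^] j) = \<zero>" using zero eqv cardQ by simp
    moreover have "inv (nat_elem (card Q)) \<noteq> \<zero>" using inv_nat(3)[OF pos] nat_carrier by auto
    moreover have "(\<Oplus>p\<in>Q. snd p \<otimes> fst p [^] j) \<in> carrier L" using Q(3) by (intro finsum_closed) auto
    ultimately show "(\<Oplus>p\<in>Q. snd p \<otimes> fst p [^] j) = \<zero>"
      using inv_nat(1)[OF pos] integral_iff by blast
  qed
  moreover have "(x, y) \<in> Q" unfolding Q_def using G(2) by (auto intro!: image_eqI[of _ _ "\<lambda>z. z"])
  ultimately show ?thesis by auto
qed

text \<open>Let \<open>H\<close> be the stabiliser of \<open>x\<close>, \<open>F\<close> its fixed field, \<open>N\<close> the integral elements of \<open>F\<close> and \<open>S\<close> the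
  saturation of \<open>N\<close>. The trace forms \<open>y \<mapsto> avg auts (y \<otimes> x\<^sup>j)\<close> show that \<open>S\<close> is finitely generated, so that
  the ring \<open>S\<close> consists of integral elements and is free over \<open>A\<close>. Its coordinate functions are extended
  to all integral elements by the \<open>H\<close>-average, which is a projection to \<open>S\<close> that fixes \<open>x\<close>.\<close>

theorem integral_elem_dual_basis:
  assumes x: "x \<in> integral_elems"
  shows "\<exists>B g. finite B \<and> B \<subseteq> integral_elems \<and>
     (\<forall>e\<in>B. (\<forall>y\<in>integral_elems. g e y \<in> A) \<and>
        (\<forall>y\<in>integral_elems. \<forall>z\<in>integral_elems. g e (y \<oplus> z) = g e y \<oplus> g e z) \<and>
        (\<forall>r\<in>A. \<forall>y\<in>integral_elems. g e (r \<otimes> y) = r \<otimes> g e y)) \<and>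
     x = (\<Oplus>e\<in>B. g e x \<otimes> e)"
proof -
  note PE = subringE[OF subring_integral_elems]
  have xL: "x \<in> carrier L" using x PE(1) by blast
  define H where "H = {\<tau> \<in> auts. \<tau> x = x}"
  have H: "group_like H" unfolding H_def by (rule group_like_stabilizer[OF xL])
  note G = group_likeD[OF H]
  have fixA: "\<tau> r = r" if "\<tau> \<in> H" "r \<in> A" for \<tau> r using autD(6)[OF G(1)[OF that(1)]] that(2) A_K by blast
  define F where "F = {y \<in> carrier L. \<forall>\<tau>\<in>H. \<tau> y = y}"
  define N where "N = integral_elems \<inter> F"
  let ?S = "saturation N"
  have F: "subring F L"
  proof (rule subringI)
    show "F \<subseteq> carrier L" unfolding F_def by blast
    show "\<one> \<in> F" unfolding F_def using fixA by auto
    show "\<ominus> h \<in> F" if h: "h \<in> F" for h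
    proof -
      have hL: "h \<in> carrier L" using h unfolding F_def by blast
      have "\<tau> (\<ominus> h) = \<ominus> h" if \<tau>: "\<tau> \<in> H" for \<tau>
      proof -
        have "\<tau> h = h" using h \<tau> unfolding F_def by blast
        then show ?thesis
          using ring_hom_cring.hom_a_inv[OF aut_ring_hom_cring[OF G(1)[OF \<tau>]] hL] by simp
      qed
      then show ?thesis using hL unfolding F_def by simp
    qed
    show "h \<otimes> k \<in> F" "h \<oplus> k \<in> F" if hk: "h \<in> F" "k \<in> F" for h k
    proof -
      have hkL: "h \<in> carrier L" "k \<in> carrier L" using hk unfolding F_def by auto
      have "\<tau> (h \<otimes> k) = h \<otimes> k \<and> \<tau> (h \<oplus> k) = h \<oplus> k" if \<tau>: "\<tau> \<in> H" for \<tau>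
      proof -
        have "\<tau> h = h" "\<tau> k = k" using hk \<tau> unfolding F_def by auto
        then show ?thesis using autD(2,3)[OF G(1)[OF \<tau>] hkL] by simp
      qed
      then show "h \<otimes> k \<in> F" "h \<oplus> k \<in> F" using hkL unfolding F_def by simp_all
    qed
  qed
  have AF: "A \<subseteq> F" unfolding F_def using fixA by auto
  have N: "subring N L" unfolding N_def by (rule subring_inter[OF subring_integral_elems F])
  have AN: "A \<subseteq> N" unfolding N_def using AF A_integral_elems by blast
  have lN: "lin_sub A N" by (rule lin_subI) (use subringE[OF N] AN in auto)
  note S = lin_sub_saturation[OF lN] and SR = subring_saturation[OF N AN]
  have SL: "y \<in> carrier L" if "y \<in> ?S" for y using that lin_subD(1)[OF S] by blast
  \<comment> \<open>The saturation does not leave the fixed field, since \<open>a\<close> is fixed and nonzero.\<close>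
  have SF: "\<tau> y = y" if y: "y \<in> ?S" and \<tau>: "\<tau> \<in> H" for \<tau> y
  proof -
    obtain k :: nat where k: "a [^] k \<otimes> y \<in> N" using y unfolding saturation_def by blast
    have ty: "\<tau> y \<in> carrier L" using autD(1)[OF G(1)[OF \<tau>] SL[OF y]] .
    have "a [^] k \<otimes> \<tau> y = \<tau> (a [^] k \<otimes> y)"
      using autD(3)[OF G(1)[OF \<tau>] _ SL[OF y], of "a [^] k"] fixA[OF \<tau>, of "a [^] k"] by simp
    also have "\<dots> = a [^] k \<otimes> y" using k \<tau> unfolding N_def F_def by blast
    finally show ?thesis using pow_nz[OF A_carrier[OF a_in] a_nz] ty SL[OF y] by (simp add: m_lcancel)
  qed
  have Ssat: "?S \<subseteq> saturation integral_elems" unfolding saturation_def N_def by blast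
  have satR: "subring (saturation integral_elems) L"
    by (rule subring_saturation[OF subring_integral_elems A_integral_elems])
  have PS: "integral_elems \<subseteq> saturation integral_elems" by (rule saturation_incl[OF PE(1)])
  have xj: "x [^] j \<in> integral_elems" for j :: nat by (induction j) (use PE x in auto)
  let ?m = "card (orbit auts x)"
  let ?\<Phi> = "(\<lambda>j y. avg auts (y \<otimes> x [^] (j::nat))) ` {..<?m}"
  have fg: "fin_gen A ?S"
  proof (rule fin_gen_by_functionals[OF subring_A noeth, of ?\<Phi>])
    show "lin_sub A ?S" by (rule S)
    fix f v assume f: "f \<in> ?\<Phi>" and v: "v \<in> ?S"
    then obtain j where j: "f = (\<lambda>y. avg auts (y \<otimes> x [^] (j::nat)))" by blast
    have "v \<otimes> x [^] j \<in> saturation integral_elems"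
      using subringE(6)[OF satR] v Ssat xj PS by blast
    then show "f v \<in> A" unfolding j by (rule trace_saturation)
    show "f (u \<oplus> v) = f u \<oplus> f v" if u: "u \<in> ?S" for u
      unfolding j using avg_add[OF group_like_auts, of "u \<otimes> x [^] j" "v \<otimes> x [^] j"] SL[OF u] SL[OF v] xL
      by (simp add: l_distr)
    show "f (r \<otimes> v) = r \<otimes> f v" if r: "r \<in> A" for r
      unfolding j using avg_smult[OF group_like_auts, of "v \<otimes> x [^] j" r] SL[OF v] xL r A_K autD(6)
      by (simp add: m_assoc subset_iff)
  next
    fix v assume v: "v \<in> ?S" and z: "\<And>f. f \<in> ?\<Phi> \<Longrightarrow> f v = \<zero>"
    show "v = \<zero>"
    proof (rule trace_form_nondegenerate[OF xL SL[OF v]])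
      show "\<tau> v = v" if "\<tau> \<in> auts" "\<tau> x = x" for \<tau> using SF[OF v] that unfolding H_def by blast
      show "avg auts (v \<otimes> x [^] j) = \<zero>" if "j < ?m" for j using z that by blast
    qed
  qed auto
  have SP: "?S \<subseteq> integral_elems"
  proof
    fix z assume z: "z \<in> ?S"
    obtain B where B: "B \<subseteq> ?S" "finite B" "?S = lin_span A B" using fg unfolding fin_gen_def by blast
    have "A \<subseteq> ?S" using AN saturation_incl[OF subringE(1)[OF N]] by blast
    moreover have "B \<subseteq> carrier L" using B(1) SL by blast
    ultimately show "z \<in> integral_elems"
      unfolding integral_elems_def
      using integral_of_finite_extension[OF subring_A noeth SR _ B(2)] B(3) z by blast
  qed
  have "\<exists>B\<subseteq>?S. finite B \<and> ?S = lin_span A B \<and>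
     (\<forall>c\<in>B \<rightarrow> A. lin_comb B c = \<zero> \<longrightarrow> (\<forall>x\<in>B. c x = \<zero>))"
    by (rule basis_of_regular[OF S fg saturation_regular[OF lN]])
  then obtain B where B: "B \<subseteq> ?S" "finite B" "?S = lin_span A B"
    and indep: "\<And>c. c \<in> B \<rightarrow> A \<Longrightarrow> lin_comb B c = \<zero> \<Longrightarrow> \<forall>x\<in>B. c x = \<zero>"
    by auto
  from coordinates_of_basis[OF S B indep] obtain f
    where ff: "(\<forall>e\<in>B. (\<forall>v\<in>?S. f e v \<in> A) \<and> (\<forall>u\<in>?S. \<forall>v\<in>?S. f e (u \<oplus> v) = f e u \<oplus> f e v) \<and>
      (\<forall>r\<in>A. \<forall>v\<in>?S. f e (r \<otimes> v) = r \<otimes> f e v)) \<and> (\<forall>v\<in>?S. v = (\<Oplus>e\<in>B. f e v \<otimes> e))"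
    by (rule exE)
  note f = conjunct1[OF ff] conjunct2[OF ff]
  have NS: "N \<subseteq> ?S" using saturation_incl[OF subringE(1)[OF N]] .
  have avgS: "avg H y \<in> ?S" if y: "y \<in> integral_elems" for y
  proof -
    have yL: "y \<in> carrier L" using y PE(1) by blast
    have "avg H y \<in> N" unfolding N_def F_def
      using avg_integral[OF H y] avg_closed[OF H yL] avg_invariant[OF H yL] by blast
    then show ?thesis using NS by blast
  qed
  have avgx: "avg H x = x" by (rule avg_fixed_elem[OF H xL]) (auto simp: H_def)
  have add: "avg H (y \<oplus> z) = avg H y \<oplus> avg H z" if "y \<in> integral_elems" "z \<in> integral_elems" for y z
    using avg_add[OF H] that PE(1) by blast
  have smult: "avg H (r \<otimes> y) = r \<otimes> avg H y" if ry: "r \<in> A" "y \<in> integral_elems" for r y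
  proof (rule avg_smult[OF H])
    show "y \<in> carrier L" "r \<in> carrier L" using ry PE(1) by auto
    show "\<tau> r = r" if "\<tau> \<in> H" for \<tau> using fixA[OF that ry(1)] .
  qed
  have xS: "x \<in> ?S" using avgS[OF x] avgx by simp
  show ?thesis
  proof (intro exI[of _ B] exI[of _ "\<lambda>e y. f e (avg H y)"] conjI ballI)
    show "finite B" by fact
    show "B \<subseteq> integral_elems" using B(1) SP by blast
    show "x = (\<Oplus>e\<in>B. f e (avg H x) \<otimes> e)" unfolding avgx using f(2) xS by blast
    fix e assume e: "e \<in> B"
    show "f e (avg H y) \<in> A" if "y \<in> integral_elems" for y using f(1) e avgS[OF that] by blast
    show "f e (avg H (y \<oplus> z)) = f e (avg H y) \<oplus> f e (avg H z)"
      if "y \<in> integral_elems" "z \<in> integral_elems" for y z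
      using f(1) e avgS that add[OF that] by simp
    show "f e (avg H (r \<otimes> y)) = r \<otimes> f e (avg H y)" if "r \<in> A" "y \<in> integral_elems" for r y
      using f(1) e avgS that smult[OF that] by simp
  qed
qed

end

lemma (in noetherian_ring) exists_maximalideal:
  assumes "ideal I R" "I \<noteq> carrier R"
  shows "\<exists>M. maximalideal M R \<and> I \<subseteq> M"
proof -
  let ?S = "{J. ideal J R \<and> I \<subseteq> J \<and> J \<noteq> carrier R}"
  have "\<exists>M\<in>?S. \<forall>J\<in>?S. M \<subseteq> J \<longrightarrow> J = M"
  proof (rule subset_Zorn_nonempty)
    show "?S \<noteq> {}" using assms by blast
    fix C assume C: "C \<noteq> {}" "subset.chain ?S C"
    then have "subset.chain {J. ideal J R} C" unfolding subset.chain_def by blast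
    then have "\<Union>C \<in> C" by (rule ideal_chain_is_trivial[OF C(1)])
    then show "\<Union>C \<in> ?S" using C(2) unfolding subset.chain_def by blast
  qed
  then obtain M where "M \<in> ?S" and max: "\<forall>J\<in>?S. M \<subseteq> J \<longrightarrow> J = M" by (rule bexE)
  then have M: "ideal M R" "I \<subseteq> M" "M \<noteq> carrier R" by auto
  have "maximalideal M R"
  proof (rule maximalidealI[OF M(1)])
    show "carrier R \<noteq> M" using M(3) by simp
    show "J = M \<or> J = carrier R" if "ideal J R" "M \<subseteq> J" "J \<subseteq> carrier R" for J
      using max that M(2) by blast
  qed
  then show ?thesis using M(2) by blast
qed

section \<open>Complete regular local domains of dimension two\<close>

text \<open>The translation from \<open>R\<close> to its image \<open>A\<close> in \<open>L\<close>, where the preceding sections apply.\<close>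

locale complete_regular_surface =
  fixes R :: "('a, 'r) ring_scheme" and m :: "'a set"
    and \<phi> :: "'a \<Rightarrow> 'l" and L :: "('l, 'k) ring_scheme"
  assumes dom: "domain R" and regular: "regular_local_ring R m" and complete: "adically_complete R m"
    and dim: "krull_dim R = 2" and rat: "contains_rationals R"
    and closure: "alg_closure_of_fractions R \<phi> L"
begin

abbreviation "A \<equiv> \<phi> ` carrier R"
abbreviation "K \<equiv> generate_field L A"

sublocale R: domain R by (rule dom)

sublocale L: algebraic_closure L K
  using closure unfolding alg_closure_of_fractions_def by blast

lemma phi_hom: "\<phi> \<in> ring_hom R L" and phi_inj: "inj_on \<phi> (carrier R)"
  using closure unfolding alg_closure_of_fractions_def by auto

sublocale \<phi>: ring_hom_cring R L \<phi>
  by (intro ring_hom_cring.intro ring_hom_cring_axioms.intro R.is_cring L.is_cring phi_hom)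

sublocale noeth: noetherian_ring R
  using regular unfolding regular_local_ring_def by blast

lemma m_max: "maximalideal m R" and m_unique: "maximalideal m' R \<Longrightarrow> m' = m"
  using regular unfolding regular_local_ring_def local_ring_def by auto

lemma subring_A: "subring A L"
proof (rule L.subringI)
  show "A \<subseteq> carrier L" by auto
  show "\<one>\<^bsub>L\<^esub> \<in> A" using \<phi>.hom_one R.one_closed by (metis image_eqI)
  show "\<ominus>\<^bsub>L\<^esub> h \<in> A" if "h \<in> A" for h
    using that by (auto simp: \<phi>.hom_a_inv[symmetric] simp del: \<phi>.hom_a_inv)
  show "h \<otimes>\<^bsub>L\<^esub> k \<in> A" if "h \<in> A" "k \<in> A" for h k
    using that by (auto simp: \<phi>.hom_mult[symmetric] simp del: \<phi>.hom_mult)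
  show "h \<oplus>\<^bsub>L\<^esub> k \<in> A" if "h \<in> A" "k \<in> A" for h k
    using that by (auto simp: \<phi>.hom_add[symmetric] simp del: \<phi>.hom_add)
qed

lemma ideal_preimage:
  assumes "L.lin_sub A V"
  shows "ideal {r \<in> carrier R. \<phi> r \<in> V} R"
proof (rule idealI[OF R.ring_axioms])
  note V = L.lin_subD[OF assms] and Vm = L.lin_sub_minus[OF subring_A assms]
  show "subgroup {r \<in> carrier R. \<phi> r \<in> V} (add_monoid R)"
  proof (rule R.add.subgroupI)
    show "{r \<in> carrier R. \<phi> r \<in> V} \<noteq> {}" using V(2) \<phi>.hom_zero R.zero_closed by fastforce
  qed (use V Vm in \<open>auto simp: a_inv_def[symmetric]\<close>)
  show "x \<otimes>\<^bsub>R\<^esub> r \<in> {r \<in> carrier R. \<phi> r \<in> V}" "r \<otimes>\<^bsub>R\<^esub> x \<in> {r \<in> carrier R. \<phi> r \<in> V}"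
    if "r \<in> {r \<in> carrier R. \<phi> r \<in> V}" "x \<in> carrier R" for r x
    using that V(4)[of "\<phi> x" "\<phi> r"] by (auto simp: L.m_comm[of "\<phi> r" "\<phi> x"])
qed

lemma noeth_A:
  assumes I: "L.lin_sub A I" "I \<subseteq> A"
  shows "L.fin_gen A I"
proof -
  let ?J = "{r \<in> carrier R. \<phi> r \<in> I}"
  obtain B where B: "B \<subseteq> carrier R" "finite B" "?J = genideal R B"
    using noeth.finetely_gen[OF ideal_preimage[OF I(1)]] by blast
  have BJ: "B \<subseteq> ?J" unfolding B(3) by (rule R.genideal_self[OF B(1)])
  have \<phi>B: "\<phi> ` B \<subseteq> carrier L" using B(1) by auto
  let ?J' = "{r \<in> carrier R. \<phi> r \<in> L.lin_span A (\<phi> ` B)}"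
  have "genideal R B \<subseteq> ?J'"
    by (rule R.genideal_minimal[OF ideal_preimage[OF L.lin_sub_lin_span[OF subring_A \<phi>B]]])
       (use B(1) L.lin_span_base[OF subring_A \<phi>B] in auto)
  then have "I \<subseteq> L.lin_span A (\<phi> ` B)" using I(2) B(3) by blast
  moreover have "L.lin_span A (\<phi> ` B) \<subseteq> I" by (rule L.lin_span_least[OF I(1)]) (use BJ in blast)
  ultimately have eq: "I = L.lin_span A (\<phi> ` B)" by blast
  show ?thesis unfolding L.fin_gen_def
    by (rule exI[of _ "\<phi> ` B"]) (use eq BJ B(2) in blast)
qed

text \<open>A two-element generating set contains a nonzero element, which is taken as the first generator.\<close>

lemma max_ideal_gens:
  obtains a b where "a \<in> carrier R" "b \<in> carrier R" "a \<noteq> \<zero>\<^bsub>R\<^esub>" "m = genideal R {a, b}"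
proof -
  obtain B where B: "B \<subseteq> carrier R" "finite B" "enat (card B) = 2" "m = genideal R B"
    using regular dim unfolding regular_local_ring_def by metis
  then have "card B = 2" by (simp add: numeral_eq_enat)
  then obtain a b where ab: "B = {a, b}" "a \<noteq> b" by (auto simp: card_2_iff)
  show thesis
  proof (cases "a = \<zero>\<^bsub>R\<^esub>")
    case False
    then show thesis using that[of a b] B ab by auto
  next
    case True
    then show thesis using that[of b a] B ab by (auto simp: insert_commute)
  qed
qed

lemma proper_ideal_le_m: "ideal I R \<Longrightarrow> I \<noteq> carrier R \<Longrightarrow> I \<subseteq> m"
  using noeth.exists_maximalideal m_unique by blast

lemma m_elem_form:
  assumes ab: "a \<in> carrier R" "b \<in> carrier R" "m = genideal R {a, b}" and r: "r \<in> m"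
  shows "\<exists>u\<in>carrier R. \<exists>v\<in>carrier R. r = a \<otimes>\<^bsub>R\<^esub> u \<oplus>\<^bsub>R\<^esub> b \<otimes>\<^bsub>R\<^esub> v"
proof -
  let ?J = "{a \<otimes>\<^bsub>R\<^esub> u \<oplus>\<^bsub>R\<^esub> b \<otimes>\<^bsub>R\<^esub> v | u v. u \<in> carrier R \<and> v \<in> carrier R}"
  have "ideal ?J R"
  proof (rule idealI[OF R.ring_axioms])
    show "subgroup ?J (add_monoid R)"
    proof (rule R.add.subgroupI)
      show "?J \<subseteq> carrier R" using ab by auto
      have "\<zero>\<^bsub>R\<^esub> = a \<otimes>\<^bsub>R\<^esub> \<zero>\<^bsub>R\<^esub> \<oplus>\<^bsub>R\<^esub> b \<otimes>\<^bsub>R\<^esub> \<zero>\<^bsub>R\<^esub>" using ab by simp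
      then show "?J \<noteq> {}" by blast
      fix x assume "x \<in> ?J"
      then obtain u v where x: "u \<in> carrier R" "v \<in> carrier R" "x = a \<otimes>\<^bsub>R\<^esub> u \<oplus>\<^bsub>R\<^esub> b \<otimes>\<^bsub>R\<^esub> v" by blast
      have "\<ominus>\<^bsub>R\<^esub> x = a \<otimes>\<^bsub>R\<^esub> (\<ominus>\<^bsub>R\<^esub> u) \<oplus>\<^bsub>R\<^esub> b \<otimes>\<^bsub>R\<^esub> (\<ominus>\<^bsub>R\<^esub> v)"
        unfolding x(3) using ab x(1,2) by (simp add: R.minus_add R.r_minus)
      then show "\<ominus>\<^bsub>R\<^esub> x \<in> ?J" using x(1,2) by blast
      fix y assume "y \<in> ?J"
      then obtain s t where y: "s \<in> carrier R" "t \<in> carrier R" "y = a \<otimes>\<^bsub>R\<^esub> s \<oplus>\<^bsub>R\<^esub> b \<otimes>\<^bsub>R\<^esub> t" by blast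
      have "x \<oplus>\<^bsub>R\<^esub> y = a \<otimes>\<^bsub>R\<^esub> (u \<oplus>\<^bsub>R\<^esub> s) \<oplus>\<^bsub>R\<^esub> b \<otimes>\<^bsub>R\<^esub> (v \<oplus>\<^bsub>R\<^esub> t)"
        unfolding x(3) y(3) using ab x(1,2) y(1,2) by (simp add: R.r_distr R.a_ac)
      moreover have "u \<oplus>\<^bsub>R\<^esub> s \<in> carrier R" "v \<oplus>\<^bsub>R\<^esub> t \<in> carrier R" using x y by auto
      ultimately show "x \<oplus>\<^bsub>R\<^esub> y \<in> ?J" by blast
    qed
    fix x z assume "x \<in> ?J" and z: "z \<in> carrier R"
    then obtain u v where x: "u \<in> carrier R" "v \<in> carrier R" "x = a \<otimes>\<^bsub>R\<^esub> u \<oplus>\<^bsub>R\<^esub> b \<otimes>\<^bsub>R\<^esub> v" by blast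
    have "z \<otimes>\<^bsub>R\<^esub> x = a \<otimes>\<^bsub>R\<^esub> (z \<otimes>\<^bsub>R\<^esub> u) \<oplus>\<^bsub>R\<^esub> b \<otimes>\<^bsub>R\<^esub> (z \<otimes>\<^bsub>R\<^esub> v)"
      "x \<otimes>\<^bsub>R\<^esub> z = z \<otimes>\<^bsub>R\<^esub> x"
      unfolding x(3) using ab x(1,2) z by (simp_all add: R.r_distr R.l_distr R.m_ac)
    moreover have "z \<otimes>\<^bsub>R\<^esub> u \<in> carrier R" "z \<otimes>\<^bsub>R\<^esub> v \<in> carrier R" using x z by auto
    ultimately show "z \<otimes>\<^bsub>R\<^esub> x \<in> ?J" "x \<otimes>\<^bsub>R\<^esub> z \<in> ?J" by auto
  qed
  moreover have "{a, b} \<subseteq> ?J"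
  proof -
    have "a = a \<otimes>\<^bsub>R\<^esub> \<one>\<^bsub>R\<^esub> \<oplus>\<^bsub>R\<^esub> b \<otimes>\<^bsub>R\<^esub> \<zero>\<^bsub>R\<^esub>" "b = a \<otimes>\<^bsub>R\<^esub> \<zero>\<^bsub>R\<^esub> \<oplus>\<^bsub>R\<^esub> b \<otimes>\<^bsub>R\<^esub> \<one>\<^bsub>R\<^esub>" using ab by simp_all
    then show ?thesis using R.one_closed R.zero_closed by blast
  qed
  ultimately have "m \<subseteq> ?J" unfolding ab(3) by (rule R.genideal_minimal)
  then show ?thesis using r by blast
qed

text \<open>Completeness provides a unique limit of the constant sequence zero, and both zero and \<open>r\<close> are limits of it.\<close>

lemma m_powers_separated:
  assumes r: "r \<in> carrier R" "\<And>n::nat. r \<in> m [^]\<^bsub>ideals_set R\<^esub> n"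
  shows "r = \<zero>\<^bsub>R\<^esub>"
proof -
  have zero_in: "\<zero>\<^bsub>R\<^esub> \<in> m [^]\<^bsub>ideals_set R\<^esub> n" for n :: nat
  proof -
    have mI: "ideal m R" using m_max maximalideal.axioms(1) by blast
    have "ideal (m [^]\<^bsub>ideals_set R\<^esub> n) R"
    proof (induction n)
      case 0
      then show ?case by (simp add: nat_pow_def ideals_set_def R.oneideal)
    next
      case (Suc n)
      then show ?case using R.ideal_prod_is_ideal[OF Suc mI] by (simp add: nat_pow_def ideals_set_def)
    qed
    then show ?thesis using additive_subgroup.zero_closed ideal.axioms(1) by blast
  qed
  have "\<exists>!y. y \<in> carrier R \<and> (\<forall>n. y \<ominus>\<^bsub>R\<^esub> \<zero>\<^bsub>R\<^esub> \<in> m [^]\<^bsub>ideals_set R\<^esub> (n::nat))"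
    using complete unfolding adically_complete_def
    by (elim allE[of _ "\<lambda>_. \<zero>\<^bsub>R\<^esub>"]) (use zero_in in \<open>simp add: R.minus_eq\<close>)
  moreover have "r \<ominus>\<^bsub>R\<^esub> \<zero>\<^bsub>R\<^esub> = r" "\<zero>\<^bsub>R\<^esub> \<ominus>\<^bsub>R\<^esub> \<zero>\<^bsub>R\<^esub> = \<zero>\<^bsub>R\<^esub>" using r(1) by (simp_all add: R.minus_eq)
  ultimately show ?thesis using r zero_in R.zero_closed by metis
qed

lemma two_gen_power_image:
  assumes ab: "a \<in> carrier R" "b \<in> carrier R" "m = genideal R {a, b}"
  shows "L.two_gen_power A (\<phi> a) (\<phi> b) n \<subseteq> \<phi> ` ((m [^]\<^bsub>ideals_set R\<^esub> n) \<inter> carrier R)"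
proof (induction n)
  case 0
  then show ?case by (simp add: nat_pow_def ideals_set_def)
next
  case (Suc n)
  have am: "a \<in> m" "b \<in> m" unfolding ab(3) using R.genideal_self[of "{a, b}"] ab by auto
  show ?case
  proof
    fix x assume "x \<in> L.two_gen_power A (\<phi> a) (\<phi> b) (Suc n)"
    then obtain u v where uv: "u \<in> L.two_gen_power A (\<phi> a) (\<phi> b) n" "v \<in> L.two_gen_power A (\<phi> a) (\<phi> b) n"
      "x = \<phi> a \<otimes>\<^bsub>L\<^esub> u \<oplus>\<^bsub>L\<^esub> \<phi> b \<otimes>\<^bsub>L\<^esub> v" by auto
    obtain s where s: "u = \<phi> s" "s \<in> m [^]\<^bsub>ideals_set R\<^esub> n" "s \<in> carrier R" using Suc uv(1) by blast
    obtain t where t: "v = \<phi> t" "t \<in> m [^]\<^bsub>ideals_set R\<^esub> n" "t \<in> carrier R" using Suc uv(2) by blast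
    have "s \<otimes>\<^bsub>R\<^esub> a \<oplus>\<^bsub>R\<^esub> t \<otimes>\<^bsub>R\<^esub> b \<in> (m [^]\<^bsub>ideals_set R\<^esub> n) \<cdot>\<^bsub>R\<^esub> m"
      using s(2) t(2) am by (intro ideal_prod.sum ideal_prod.prod)
    then have "s \<otimes>\<^bsub>R\<^esub> a \<oplus>\<^bsub>R\<^esub> t \<otimes>\<^bsub>R\<^esub> b \<in> m [^]\<^bsub>ideals_set R\<^esub> Suc n"
      by (simp add: nat_pow_def ideals_set_def)
    moreover have "x = \<phi> (s \<otimes>\<^bsub>R\<^esub> a \<oplus>\<^bsub>R\<^esub> t \<otimes>\<^bsub>R\<^esub> b)"
      unfolding uv(3) s(1) t(1) using s(3) t(3) ab by (simp add: L.m_comm)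
    ultimately show "x \<in> \<phi> ` ((m [^]\<^bsub>ideals_set R\<^esub> Suc n) \<inter> carrier R)" using s(3) t(3) ab by blast
  qed
qed

text \<open>As the dimension is two, there is a chain of at least three primes; its second member contains a nonzero
  element, and its third member is contained in the maximal ideal.\<close>

lemma intermediate_prime:
  "\<exists>P. primeideal P R \<and> (\<exists>c\<in>P. c \<noteq> \<zero>\<^bsub>R\<^esub>) \<and> P \<subset> m"
proof -
  let ?C = "{enat n | n. \<exists>P :: nat \<Rightarrow> 'a set.
     (\<forall>i\<le>n. primeideal (P i) R) \<and> (\<forall>i<n. P i \<subset> P (Suc i))}"
  have "\<exists>n\<ge>2. enat n \<in> ?C"
  proof (rule ccontr)
    assume no: "\<not> (\<exists>n\<ge>2. enat n \<in> ?C)"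
    have "x \<le> 1" if x: "x \<in> ?C" for x
    proof -
      obtain n where n: "x = enat n" using x by blast
      have "\<not> 2 \<le> n"
      proof
        assume "2 \<le> n"
        then have "\<exists>n\<ge>2. enat n \<in> ?C" using x unfolding n by (intro exI[of _ n] conjI)
        then show False using no by (rule notE[rotated])
      qed
      then have "n \<le> 1" by simp
      then show ?thesis unfolding n one_enat_def enat_ord_simps .
    qed
    then have "Sup ?C \<le> 1" by (rule Sup_least)
    then have "(2::enat) \<le> 1" using dim unfolding krull_dim_def by simp
    then show False by (simp add: one_enat_def numeral_eq_enat)
  qed
  then obtain n where n: "n \<ge> 2" and "enat n \<in> ?C" by (elim exE conjE)
  then obtain P where P: "\<forall>i\<le>n. primeideal (P i) R" "\<forall>i<n. P i \<subset> P (Suc i)" by auto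
  have p: "primeideal (P 0) R" "primeideal (P 1) R" "primeideal (P 2) R" using P(1) n by auto
  have "P 0 \<subset> P (Suc 0)" "P (Suc 0) \<subset> P (Suc (Suc 0))" using P(2) n by auto
  then have lt: "P 0 \<subset> P 1" "P 1 \<subset> P 2" by (simp_all add: numeral_2_eq_2)
  have id: "ideal (P 0) R" "ideal (P 2) R" using p primeideal.axioms(1) by auto
  have P2: "P 2 \<subseteq> m" by (rule proper_ideal_le_m[OF id(2)]) (use primeideal.I_notcarr[OF p(3)] in auto)
  have zero: "\<zero>\<^bsub>R\<^esub> \<in> P 0" by (rule additive_subgroup.zero_closed[OF ideal.axioms(1)[OF id(1)]])
  obtain c where c: "c \<in> P 1" "c \<notin> P 0" using lt(1) by (rule psubsetE) blast
  have "c \<noteq> \<zero>\<^bsub>R\<^esub>"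
  proof
    assume "c = \<zero>\<^bsub>R\<^esub>"
    then show False using c(2) zero by simp
  qed
  then have "\<exists>c\<in>P 1. c \<noteq> \<zero>\<^bsub>R\<^esub>" using c(1) by (rule bexI)
  moreover have "P 1 \<subset> m" using lt(2) P2 by (rule psubset_subset_trans)
  ultimately show ?thesis using p(2) by (intro exI[of _ "P 1"] conjI)
qed

lemma prime_in_A:
  assumes ab: "a \<in> carrier R" "b \<in> carrier R" "m = genideal R {a, b}"
  shows "\<exists>P. L.lin_sub A P \<and> P \<subseteq> A \<and> \<one>\<^bsub>L\<^esub> \<notin> P \<and>
          (\<forall>r\<in>A. \<forall>s\<in>A. r \<otimes>\<^bsub>L\<^esub> s \<in> P \<longrightarrow> r \<in> P \<or> s \<in> P) \<and>
          (\<exists>c\<in>P. c \<noteq> \<zero>\<^bsub>L\<^esub>) \<and> \<not> (\<phi> a \<in> P \<and> \<phi> b \<in> P)"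
proof -
  obtain P c where P: "primeideal P R" "c \<in> P" "c \<noteq> \<zero>\<^bsub>R\<^esub>" "P \<subset> m" using intermediate_prime by blast
  interpret P: primeideal P R by (rule P(1))
  have PR: "P \<subseteq> carrier R" by (rule subsetI) (rule P.Icarr)
  have in_iff: "\<phi> r \<in> \<phi> ` P \<longleftrightarrow> r \<in> P" if "r \<in> carrier R" for r
    by (rule inj_on_image_mem_iff[OF phi_inj that PR])
  have "L.lin_sub A (\<phi> ` P)"
  proof (rule L.lin_subI)
    show "\<phi> ` P \<subseteq> carrier L" using PR by auto
    show "\<zero>\<^bsub>L\<^esub> \<in> \<phi> ` P" using P.zero_closed \<phi>.hom_zero by (metis image_eqI)
    show "u \<oplus>\<^bsub>L\<^esub> v \<in> \<phi> ` P" if "u \<in> \<phi> ` P" "v \<in> \<phi> ` P" for u v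
      using that P.Icarr P.a_closed by (auto simp: \<phi>.hom_add[symmetric] simp del: \<phi>.hom_add)
    show "r \<otimes>\<^bsub>L\<^esub> v \<in> \<phi> ` P" if "r \<in> A" "v \<in> \<phi> ` P" for r v
      using that P.Icarr P.I_l_closed by (auto simp: \<phi>.hom_mult[symmetric] simp del: \<phi>.hom_mult)
  qed
  moreover have "\<phi> ` P \<subseteq> A" using PR by (rule image_mono)
  moreover have "\<one>\<^bsub>L\<^esub> \<notin> \<phi> ` P"
    using in_iff[OF R.one_closed] P.I_notcarr P.one_imp_carrier by auto
  moreover have "\<phi> r \<in> \<phi> ` P \<or> \<phi> s \<in> \<phi> ` P" if "r \<in> carrier R" "s \<in> carrier R" "\<phi> r \<otimes>\<^bsub>L\<^esub> \<phi> s \<in> \<phi> ` P" for r s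
  proof -
    have "\<phi> (r \<otimes>\<^bsub>R\<^esub> s) \<in> \<phi> ` P" using that by simp
    then have "r \<otimes>\<^bsub>R\<^esub> s \<in> P" using in_iff[of "r \<otimes>\<^bsub>R\<^esub> s"] that by simp
    then show ?thesis using P.I_prime that(1,2) by blast
  qed
  moreover have "\<phi> c \<noteq> \<zero>\<^bsub>L\<^esub>"
    using phi_inj P.Icarr[OF P(2)] P(3) \<phi>.hom_zero R.zero_closed by (metis inj_onD)
  moreover have "\<not> (\<phi> a \<in> \<phi> ` P \<and> \<phi> b \<in> \<phi> ` P)"
  proof
    assume "\<phi> a \<in> \<phi> ` P \<and> \<phi> b \<in> \<phi> ` P"
    then have "{a, b} \<subseteq> P" using in_iff ab by blast
    then have "m \<subseteq> P" unfolding ab(3) by (rule R.genideal_minimal[OF P.is_ideal])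
    then show False using P(4) by blast
  qed
  ultimately show ?thesis using P(2) by (intro exI[of _ "\<phi> ` P"] conjI) auto
qed

lemma two_dim_regular_A:
  assumes ab: "a \<in> carrier R" "b \<in> carrier R" "a \<noteq> \<zero>\<^bsub>R\<^esub>" "m = genideal R {a, b}"
  shows "two_dim_regular L A (\<phi> a) (\<phi> b)"
proof (intro two_dim_regular.intro two_dim_regular_axioms.intro)
  show "field L" by (rule L.field_axioms)
  have am: "a \<in> m" "b \<in> m" unfolding ab(4) using R.genideal_self[of "{a, b}"] ab by auto
  interpret m: maximalideal m R by (rule m_max)
  show "subring A L" by (rule subring_A)
  show "\<And>I. L.lin_sub A I \<Longrightarrow> I \<subseteq> A \<Longrightarrow> L.fin_gen A I" by (rule noeth_A)
  show "\<phi> a \<in> A" "\<phi> b \<in> A" using ab by auto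
  show "\<phi> a \<noteq> \<zero>\<^bsub>L\<^esub>" using phi_inj ab(1,3) \<phi>.hom_zero R.zero_closed by (metis inj_onD)
  show "(\<exists>s\<in>A. r \<otimes>\<^bsub>L\<^esub> s = \<one>\<^bsub>L\<^esub>) \<or> (\<exists>u\<in>A. \<exists>v\<in>A. r = \<phi> a \<otimes>\<^bsub>L\<^esub> u \<oplus>\<^bsub>L\<^esub> \<phi> b \<otimes>\<^bsub>L\<^esub> v)" if r: "r \<in> A" for r
  proof -
    obtain s where s: "s \<in> carrier R" "r = \<phi> s" using r by blast
    show ?thesis
    proof (cases "s \<in> m")
      case True
      then obtain u v where "u \<in> carrier R" "v \<in> carrier R" "s = a \<otimes>\<^bsub>R\<^esub> u \<oplus>\<^bsub>R\<^esub> b \<otimes>\<^bsub>R\<^esub> v"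
        using m_elem_form[OF ab(1,2,4)] by blast
      then have "r = \<phi> a \<otimes>\<^bsub>L\<^esub> \<phi> u \<oplus>\<^bsub>L\<^esub> \<phi> b \<otimes>\<^bsub>L\<^esub> \<phi> v" using s ab by simp
      then show ?thesis using \<open>u \<in> carrier R\<close> \<open>v \<in> carrier R\<close> by blast
    next
      case False
      have "PIdl\<^bsub>R\<^esub> s = carrier R"
        using proper_ideal_le_m[OF R.cgenideal_ideal[OF s(1)]] R.cgenideal_self[OF s(1)] False by blast
      then have "\<one>\<^bsub>R\<^esub> \<in> PIdl\<^bsub>R\<^esub> s" by simp
      then obtain t where t: "t \<in> carrier R" "\<one>\<^bsub>R\<^esub> = t \<otimes>\<^bsub>R\<^esub> s" unfolding cgenideal_def by blast
      then have "\<phi> s \<otimes>\<^bsub>L\<^esub> \<phi> t = \<one>\<^bsub>L\<^esub>" using s(1) by (metis \<phi>.hom_mult \<phi>.hom_one R.m_comm)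
      then show ?thesis using s(2) t(1) by blast
    qed
  qed
  show "\<phi> a \<otimes>\<^bsub>L\<^esub> u \<oplus>\<^bsub>L\<^esub> \<phi> b \<otimes>\<^bsub>L\<^esub> v \<noteq> \<one>\<^bsub>L\<^esub>" if uv: "u \<in> A" "v \<in> A" for u v
  proof
    assume eq: "\<phi> a \<otimes>\<^bsub>L\<^esub> u \<oplus>\<^bsub>L\<^esub> \<phi> b \<otimes>\<^bsub>L\<^esub> v = \<one>\<^bsub>L\<^esub>"
    obtain s t where st: "s \<in> carrier R" "t \<in> carrier R" "u = \<phi> s" "v = \<phi> t" using uv by blast
    let ?x = "a \<otimes>\<^bsub>R\<^esub> s \<oplus>\<^bsub>R\<^esub> b \<otimes>\<^bsub>R\<^esub> t"
    have "\<phi> ?x = \<phi> \<one>\<^bsub>R\<^esub>" using eq st ab by simp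
    then have "?x = \<one>\<^bsub>R\<^esub>" using phi_inj st ab by (simp add: inj_on_def)
    moreover have "?x \<in> m" using am st m.I_r_closed m.a_closed by simp
    ultimately show False using m.I_notcarr m.one_imp_carrier by simp
  qed
  show "r = \<zero>\<^bsub>L\<^esub>" if r: "\<And>n. r \<in> L.two_gen_power A (\<phi> a) (\<phi> b) n" for r
  proof -
    obtain s where s: "s \<in> carrier R" "r = \<phi> s" using r[of 0] by auto
    have "s \<in> m [^]\<^bsub>ideals_set R\<^esub> n" for n :: nat
    proof -
      obtain t where t: "r = \<phi> t" "t \<in> m [^]\<^bsub>ideals_set R\<^esub> n" "t \<in> carrier R"
        using r[of n] two_gen_power_image[OF ab(1,2,4), of n] by blast
      then have "t = s" using phi_inj s by (simp add: inj_on_def)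
      then show ?thesis using t(2) by simp
    qed
    then have "s = \<zero>\<^bsub>R\<^esub>" using m_powers_separated[OF s(1)] by blast
    then show ?thesis using s(2) by simp
  qed
  show "\<exists>P. L.lin_sub A P \<and> P \<subseteq> A \<and> \<one>\<^bsub>L\<^esub> \<notin> P \<and>
          (\<forall>r\<in>A. \<forall>s\<in>A. r \<otimes>\<^bsub>L\<^esub> s \<in> P \<longrightarrow> r \<in> P \<or> s \<in> P) \<and>
          (\<exists>c\<in>P. c \<noteq> \<zero>\<^bsub>L\<^esub>) \<and> \<not> (\<phi> a \<in> P \<and> \<phi> b \<in> P)"
    by (rule prime_in_A[OF ab(1,2,4)])
qed

lemma poly_ring_Cons: "set cs \<subseteq> carrier L \<Longrightarrow> \<one>\<^bsub>L\<^esub> # cs \<in> carrier (poly_ring L)"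
  by (simp add: univ_poly_def polynomial_def)

lemma rational_in_R:
  assumes "0 < (n::nat)"
  shows "L.nat_elem n \<noteq> \<zero>\<^bsub>L\<^esub>" "inv\<^bsub>L\<^esub> (L.nat_elem n) \<in> A"
proof -
  obtain \<psi> where \<psi>: "\<psi> \<in> ring_hom (ring_of_type_algebra :: rat ring) R"
    using rat unfolding contains_rationals_def by blast
  have add: "\<psi> (p + q) = \<psi> p \<oplus>\<^bsub>R\<^esub> \<psi> q" and mult: "\<psi> (p * q) = \<psi> p \<otimes>\<^bsub>R\<^esub> \<psi> q"
    and one: "\<psi> 1 = \<one>\<^bsub>R\<^esub>" and cl: "\<psi> p \<in> carrier R" for p q
    using \<psi> unfolding ring_hom_def ring_of_type_algebra_def by auto
  have nat: "L.nat_elem k = \<phi> (\<psi> (of_nat k))" for k :: nat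
  proof (induction k)
    case 0
    have "\<psi> 0 = \<psi> 0 \<oplus>\<^bsub>R\<^esub> \<psi> 0" using add[of 0 0] by simp
    then have "\<psi> 0 = \<zero>\<^bsub>R\<^esub>" using cl[of 0] by (metis R.add.r_cancel_one)
    then show ?case by simp
  next
    case (Suc k)
    have "\<phi> (\<psi> (of_nat (Suc k))) = \<phi> (\<psi> (of_nat k)) \<oplus>\<^bsub>L\<^esub> \<one>\<^bsub>L\<^esub>"
      using add[of "of_nat k" 1] one cl by (simp add: add.commute)
    then show ?case using Suc by simp
  qed
  let ?i = "\<phi> (\<psi> (1 / of_nat n))"
  have iL: "?i \<in> carrier L" using cl by simp
  have nL: "L.nat_elem n \<in> carrier L" unfolding nat using cl by simp
  have "of_nat n * (1 / of_nat n :: rat) = 1" using assms by simp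
  then have "\<psi> (of_nat n) \<otimes>\<^bsub>R\<^esub> \<psi> (1 / of_nat n) = \<one>\<^bsub>R\<^esub>" using mult one by metis
  then have eq: "L.nat_elem n \<otimes>\<^bsub>L\<^esub> ?i = \<one>\<^bsub>L\<^esub>" unfolding nat using cl by (metis \<phi>.hom_mult \<phi>.hom_one)
  then show "L.nat_elem n \<noteq> \<zero>\<^bsub>L\<^esub>" using iL by auto
  have "inv\<^bsub>L\<^esub> (L.nat_elem n) = ?i" by (rule L.comm_inv_char[OF nL iL eq])
  then show "inv\<^bsub>L\<^esub> (L.nat_elem n) \<in> A" using cl by blast
qed

lemma char0_alg_closed: "char0_alg_closed_over L K"
proof (intro char0_alg_closed_over.intro alg_closed_over.intro alg_closed_over_axioms.intro
    char0_alg_closed_over_axioms.intro)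
  show "field L" by (rule L.field_axioms)
  show "subfield K L" by (rule L.subfield_axioms)
  show "\<exists>z\<in>carrier L. L.eval (\<one>\<^bsub>L\<^esub> # cs) z = \<zero>\<^bsub>L\<^esub>" if cs: "set cs \<subseteq> carrier L" "cs \<noteq> []" for cs
  proof -
    note p = poly_ring_Cons[OF cs(1)]
    have "size (L.roots (\<one>\<^bsub>L\<^esub> # cs)) = length cs"
      using L.roots_over_carrier[OF p] unfolding L.splitted_def by simp
    then have "L.roots (\<one>\<^bsub>L\<^esub> # cs) \<noteq> {#}" using cs(2) by auto
    then obtain z where "z \<in># L.roots (\<one>\<^bsub>L\<^esub> # cs)" by blast
    then have "L.is_root (\<one>\<^bsub>L\<^esub> # cs) z" using L.roots_mem_iff_is_root[OF p] by blast
    then show ?thesis unfolding L.is_root_def by blast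
  qed
  show "finite {z \<in> carrier L. L.eval (\<one>\<^bsub>L\<^esub> # cs) z = \<zero>\<^bsub>L\<^esub>}" if cs: "set cs \<subseteq> carrier L" for cs
    using L.finite_number_of_roots[OF poly_ring_Cons[OF cs]] unfolding L.is_root_def by simp
  show "L.integral_elem K z" if z: "z \<in> carrier L" for z
  proof -
    have KL: "K \<subseteq> carrier L" and Ks: "subring K L"
      using subfieldE(1,3)[OF L.subfield_axioms] by auto
    obtain p where p: "p \<in> carrier (K[X]\<^bsub>L\<^esub>)" "p \<noteq> []" "L.eval p z = \<zero>\<^bsub>L\<^esub>"
      using L.algebraicE[OF Ks z L.algebraic_extension[OF z]] by blast
    then obtain c cs where ccs: "p = c # cs" by (cases p) auto
    have c: "c \<in> K - {\<zero>\<^bsub>L\<^esub>}" "set cs \<subseteq> K" using p(1) unfolding ccs by (auto simp: univ_poly_def polynomial_def)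
    note ic = L.subfield_m_inv[OF L.subfield_axioms c(1)]
    have cL: "c \<in> carrier L" "inv\<^bsub>L\<^esub> c \<in> carrier L" "set cs \<subseteq> carrier L" using c ic(1) KL by auto
    have eL: "L.eval cs z \<in> carrier L" using L.eval_in_carrier[OF cL(3) z] .
    let ?n = "length cs"
    have "c \<otimes>\<^bsub>L\<^esub> z [^]\<^bsub>L\<^esub> ?n \<oplus>\<^bsub>L\<^esub> L.eval cs z = \<zero>\<^bsub>L\<^esub>" using p(3) unfolding ccs by (simp add: L.eval_Cons)
    then have "c \<otimes>\<^bsub>L\<^esub> z [^]\<^bsub>L\<^esub> ?n = \<ominus>\<^bsub>L\<^esub> L.eval cs z" using L.sum_zero_eq_neg cL z eL by simp
    then have "inv\<^bsub>L\<^esub> c \<otimes>\<^bsub>L\<^esub> (c \<otimes>\<^bsub>L\<^esub> z [^]\<^bsub>L\<^esub> ?n) = inv\<^bsub>L\<^esub> c \<otimes>\<^bsub>L\<^esub> (\<ominus>\<^bsub>L\<^esub> L.eval cs z)" by simp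
    then have zn: "z [^]\<^bsub>L\<^esub> ?n = \<ominus>\<^bsub>L\<^esub> (inv\<^bsub>L\<^esub> c) \<otimes>\<^bsub>L\<^esub> L.eval cs z"
      using ic(3) cL z eL by (simp add: L.m_assoc[symmetric] L.l_minus L.r_minus)
    have "z [^]\<^bsub>L\<^esub> ?n \<in> L.lin_span K (L.powers_below z ?n)"
      unfolding zn
      using L.lin_subD(4)[OF L.lin_sub_lin_span[OF Ks L.powers_below_carrier[OF z]] _ L.eval_mem_span[OF Ks z c(2)]]
        subringE(5)[OF Ks] ic(1) by blast
    moreover have "0 < ?n"
    proof (rule ccontr)
      assume "\<not> 0 < ?n"
      then have "\<one>\<^bsub>L\<^esub> = \<zero>\<^bsub>L\<^esub>" using zn cL(2) by simp
      then show False using L.one_not_zero by blast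
    qed
    ultimately show ?thesis unfolding L.integral_elem_def using z by blast
  qed
  show "\<And>n::nat. 0 < n \<Longrightarrow> L.nat_elem n \<noteq> \<zero>\<^bsub>L\<^esub>" by (rule rational_in_R(1))
qed

text \<open>The fraction field is generated inductively from \<open>A\<close>, and the elements with a denominator in \<open>A\<close> are
  closed under the field operations.\<close>

lemma fraction_form:
  assumes "k \<in> K"
  shows "\<exists>q\<in>A. q \<noteq> \<zero>\<^bsub>L\<^esub> \<and> q \<otimes>\<^bsub>L\<^esub> k \<in> A"
proof -
  note AE = subringE[OF subring_A]
  have KL: "x \<in> carrier L" if "x \<in> K" for x using that subfieldE(3)[OF L.subfield_axioms] by blast
  have AL: "x \<in> carrier L" if "x \<in> A" for x using that AE(1) by blast
  show ?thesis using assms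
  proof induction
    case one
    then show ?case using AE(3) L.one_not_zero by (intro bexI[of _ "\<one>\<^bsub>L\<^esub>"]) auto
  next
    case (incl h)
    then show ?case using AE(3) L.one_not_zero AL by (intro bexI[of _ "\<one>\<^bsub>L\<^esub>"]) auto
  next
    case (a_inv h)
    then obtain q where q: "q \<in> A" "q \<noteq> \<zero>\<^bsub>L\<^esub>" "q \<otimes>\<^bsub>L\<^esub> h \<in> A" by blast
    have "q \<otimes>\<^bsub>L\<^esub> (\<ominus>\<^bsub>L\<^esub> h) = \<ominus>\<^bsub>L\<^esub> (q \<otimes>\<^bsub>L\<^esub> h)" using AL[OF q(1)] KL[OF a_inv(1)] by (rule L.r_minus)
    then show ?case using q AE(5) by metis
  next
    case (m_inv h)
    then obtain q where q: "q \<in> A" "q \<noteq> \<zero>\<^bsub>L\<^esub>" "q \<otimes>\<^bsub>L\<^esub> h \<in> A" by blast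
    have h: "h \<in> carrier L" "inv\<^bsub>L\<^esub> h \<in> carrier L" "h \<otimes>\<^bsub>L\<^esub> inv\<^bsub>L\<^esub> h = \<one>\<^bsub>L\<^esub>"
      using KL[OF m_inv(1)] m_inv(2) by (simp_all add: L.field_Units)
    have "q \<otimes>\<^bsub>L\<^esub> h \<otimes>\<^bsub>L\<^esub> inv\<^bsub>L\<^esub> h = q" using h AL[OF q(1)] by (simp add: L.m_assoc)
    moreover have "q \<otimes>\<^bsub>L\<^esub> h \<noteq> \<zero>\<^bsub>L\<^esub>" using q(2) m_inv(2) AL[OF q(1)] h(1) L.integral by blast
    ultimately show ?case using q by metis
  next
    case (eng_add h1 h2)
    then obtain q1 q2 where q: "q1 \<in> A" "q1 \<noteq> \<zero>\<^bsub>L\<^esub>" "q1 \<otimes>\<^bsub>L\<^esub> h1 \<in> A" "q2 \<in> A" "q2 \<noteq> \<zero>\<^bsub>L\<^esub>" "q2 \<otimes>\<^bsub>L\<^esub> h2 \<in> A" by blast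
    have "(q1 \<otimes>\<^bsub>L\<^esub> q2) \<otimes>\<^bsub>L\<^esub> (h1 \<oplus>\<^bsub>L\<^esub> h2) = q2 \<otimes>\<^bsub>L\<^esub> (q1 \<otimes>\<^bsub>L\<^esub> h1) \<oplus>\<^bsub>L\<^esub> q1 \<otimes>\<^bsub>L\<^esub> (q2 \<otimes>\<^bsub>L\<^esub> h2)"
      using AL[OF q(1)] AL[OF q(4)] KL[OF eng_add(1)] KL[OF eng_add(2)] by (simp add: L.r_distr L.m_ac)
    moreover have "q1 \<otimes>\<^bsub>L\<^esub> q2 \<noteq> \<zero>\<^bsub>L\<^esub>" using q AL L.integral by blast
    ultimately show ?case using q AE(6,7) by (intro bexI[of _ "q1 \<otimes>\<^bsub>L\<^esub> q2"]) simp_all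
  next
    case (eng_mult h1 h2)
    then obtain q1 q2 where q: "q1 \<in> A" "q1 \<noteq> \<zero>\<^bsub>L\<^esub>" "q1 \<otimes>\<^bsub>L\<^esub> h1 \<in> A" "q2 \<in> A" "q2 \<noteq> \<zero>\<^bsub>L\<^esub>" "q2 \<otimes>\<^bsub>L\<^esub> h2 \<in> A" by blast
    have "(q1 \<otimes>\<^bsub>L\<^esub> q2) \<otimes>\<^bsub>L\<^esub> (h1 \<otimes>\<^bsub>L\<^esub> h2) = (q1 \<otimes>\<^bsub>L\<^esub> h1) \<otimes>\<^bsub>L\<^esub> (q2 \<otimes>\<^bsub>L\<^esub> h2)"
      using AL[OF q(1)] AL[OF q(4)] KL[OF eng_mult(1)] KL[OF eng_mult(2)] by (simp add: L.m_ac)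
    moreover have "q1 \<otimes>\<^bsub>L\<^esub> q2 \<noteq> \<zero>\<^bsub>L\<^esub>" using q AL L.integral by blast
    ultimately show ?case using q AE(6,7) by (intro bexI[of _ "q1 \<otimes>\<^bsub>L\<^esub> q2"]) simp_all
  qed
qed

lemma regular_surface_closure_A:
  assumes "a \<in> carrier R" "b \<in> carrier R" "a \<noteq> \<zero>\<^bsub>R\<^esub>" "m = genideal R {a, b}"
  shows "regular_surface_closure L A (\<phi> a) (\<phi> b) K"
proof -
  show ?thesis
  proof (intro regular_surface_closure.intro regular_surface_closure_axioms.intro)
    show "two_dim_regular L A (\<phi> a) (\<phi> b)" by (rule two_dim_regular_A[OF assms])
    show "char0_alg_closed_over L K" by (rule char0_alg_closed)
    show "A \<subseteq> K" by (rule subsetI) (rule generate_field.incl)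
    show "\<And>k. k \<in> K \<Longrightarrow> \<exists>q\<in>A. q \<noteq> \<zero>\<^bsub>L\<^esub> \<and> q \<otimes>\<^bsub>L\<^esub> k \<in> A" by (rule fraction_form)
    show "\<And>n::nat. 0 < n \<Longrightarrow> inv\<^bsub>L\<^esub> (L.nat_elem n) \<in> A" by (rule rational_in_R(2))
  qed
qed

abbreviation "S \<equiv> integral_closure_module R \<phi> L"

lemma carrier_S: "carrier S = {z. L.integral_elem A z}"
proof -
  note AE = subringE[OF subring_A]
  have "L.integral_elem A x" if x: "x \<in> integral_closure L A" for x
  proof -
    obtain p where p: "x \<in> carrier L" "p \<in> carrier (A[X]\<^bsub>L\<^esub>)" "p \<noteq> []" "hd p = \<one>\<^bsub>L\<^esub>" "L.eval p x = \<zero>\<^bsub>L\<^esub>"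
      using x unfolding integral_closure_def by blast
    then obtain cs where ccs: "p = \<one>\<^bsub>L\<^esub> # cs" by (cases p) auto
    have cs: "set cs \<subseteq> A" using p(2) unfolding ccs by (simp add: univ_poly_def polynomial_def)
    then have eL: "L.eval cs x \<in> carrier L" using L.eval_in_carrier[OF _ p(1)] AE(1) by blast
    have "x [^]\<^bsub>L\<^esub> length cs \<oplus>\<^bsub>L\<^esub> L.eval cs x = \<zero>\<^bsub>L\<^esub>" using p(1,5) unfolding ccs by (simp add: L.eval_Cons)
    then have xn: "x [^]\<^bsub>L\<^esub> length cs = \<ominus>\<^bsub>L\<^esub> L.eval cs x" using L.sum_zero_eq_neg p(1) eL by simp
    then have "x [^]\<^bsub>L\<^esub> length cs \<in> L.lin_span A (L.powers_below x (length cs))"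
      using L.lin_sub_minus(1)[OF subring_A L.lin_sub_lin_span[OF subring_A L.powers_below_carrier[OF p(1)]]
          L.eval_mem_span[OF subring_A p(1) cs]] by simp
    moreover have "0 < length cs"
    proof (rule ccontr)
      assume "\<not> 0 < length cs"
      then have "\<one>\<^bsub>L\<^esub> = \<zero>\<^bsub>L\<^esub>" using xn by simp
      then show False using L.one_not_zero by blast
    qed
    ultimately show ?thesis unfolding L.integral_elem_def using p(1) by blast
  qed
  moreover have "x \<in> integral_closure L A" if x: "L.integral_elem A x" for x
  proof -
    obtain n :: nat where n: "0 < n" "x [^]\<^bsub>L\<^esub> n \<in> L.lin_span A (L.powers_below x n)" and xL: "x \<in> carrier L"
      using x unfolding L.integral_elem_def by blast
    obtain cs where cs: "length cs = n" "set cs \<subseteq> A" "x [^]\<^bsub>L\<^esub> n = L.eval cs x"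
      using L.mem_span_eval[OF subring_A xL n(2)] by blast
    let ?p = "\<one>\<^bsub>L\<^esub> # map (\<lambda>c. \<ominus>\<^bsub>L\<^esub> c) cs"
    have csL: "set cs \<subseteq> carrier L" using cs(2) AE(1) by blast
    interpret char0_alg_closed_over L K by (rule char0_alg_closed)
    have "L.eval ?p x = \<zero>\<^bsub>L\<^esub>" using monic_root_iff[OF csL xL] cs by simp
    moreover have "?p \<in> carrier (A[X]\<^bsub>L\<^esub>)"
      using cs(2) AE(3,5) by (auto simp: univ_poly_def polynomial_def)
    ultimately show ?thesis unfolding integral_closure_def using xL by (intro CollectI conjI bexI[of _ ?p]) auto
  qed
  ultimately show ?thesis unfolding integral_closure_module_def by auto
qed

lemma S_simps: "\<zero>\<^bsub>S\<^esub> = \<zero>\<^bsub>L\<^esub>" "x \<oplus>\<^bsub>S\<^esub> y = x \<oplus>\<^bsub>L\<^esub> y" "r \<odot>\<^bsub>S\<^esub> x = \<phi> r \<otimes>\<^bsub>L\<^esub> x"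
  by (simp_all add: integral_closure_module_def)

lemma module_S: "module R S"
proof -
  have sub: "subring (carrier S) L"
    unfolding carrier_S by (rule L.subring_integral[OF subring_A noeth_A])
  note E = subringE[OF sub]
  have SL: "x \<in> carrier L" if "x \<in> carrier S" for x using that E(1) by blast
  have AS: "\<phi> r \<in> carrier S" if "r \<in> carrier R" for r
    unfolding carrier_S using L.integral_elem_in[OF _ subring_A] that by blast
  show ?thesis
  proof (rule moduleI)
    show "cring R" by (rule R.is_cring)
    show "abelian_group S"
    proof (rule abelian_groupI)
      show "x \<oplus>\<^bsub>S\<^esub> y \<in> carrier S" if "x \<in> carrier S" "y \<in> carrier S" for x y
        unfolding S_simps by (rule E(7)[OF that])
      show "\<zero>\<^bsub>S\<^esub> \<in> carrier S" unfolding S_simps by (rule E(2))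
      show "x \<oplus>\<^bsub>S\<^esub> y \<oplus>\<^bsub>S\<^esub> z = x \<oplus>\<^bsub>S\<^esub> (y \<oplus>\<^bsub>S\<^esub> z)"
        if "x \<in> carrier S" "y \<in> carrier S" "z \<in> carrier S" for x y z
        unfolding S_simps by (rule L.a_assoc) (rule SL, rule that)+
      show "x \<oplus>\<^bsub>S\<^esub> y = y \<oplus>\<^bsub>S\<^esub> x" if "x \<in> carrier S" "y \<in> carrier S" for x y
        unfolding S_simps by (rule L.a_comm) (rule SL, rule that)+
      show "\<zero>\<^bsub>S\<^esub> \<oplus>\<^bsub>S\<^esub> x = x" if "x \<in> carrier S" for x
        unfolding S_simps by (rule L.l_zero[OF SL[OF that]])
      show "\<exists>y\<in>carrier S. y \<oplus>\<^bsub>S\<^esub> x = \<zero>\<^bsub>S\<^esub>" if "x \<in> carrier S" for x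
        unfolding S_simps by (rule bexI[of _ "\<ominus>\<^bsub>L\<^esub> x"]) (rule L.l_neg[OF SL[OF that]], rule E(5)[OF that])
    qed
    show "r \<odot>\<^bsub>S\<^esub> x \<in> carrier S" if "r \<in> carrier R" "x \<in> carrier S" for r x
      unfolding S_simps by (rule E(6)[OF AS[OF that(1)] that(2)])
    show "(r \<oplus>\<^bsub>R\<^esub> s) \<odot>\<^bsub>S\<^esub> x = r \<odot>\<^bsub>S\<^esub> x \<oplus>\<^bsub>S\<^esub> s \<odot>\<^bsub>S\<^esub> x"
      if "r \<in> carrier R" "s \<in> carrier R" "x \<in> carrier S" for r s x
      unfolding S_simps using that(1,2) SL[OF that(3)] by (simp add: L.l_distr)
    show "r \<odot>\<^bsub>S\<^esub> (x \<oplus>\<^bsub>S\<^esub> y) = r \<odot>\<^bsub>S\<^esub> x \<oplus>\<^bsub>S\<^esub> r \<odot>\<^bsub>S\<^esub> y"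
      if "r \<in> carrier R" "x \<in> carrier S" "y \<in> carrier S" for r x y
      unfolding S_simps using that(1) SL[OF that(2)] SL[OF that(3)] by (simp add: L.r_distr)
    show "(r \<otimes>\<^bsub>R\<^esub> s) \<odot>\<^bsub>S\<^esub> x = r \<odot>\<^bsub>S\<^esub> (s \<odot>\<^bsub>S\<^esub> x)"
      if "r \<in> carrier R" "s \<in> carrier R" "x \<in> carrier S" for r s x
      unfolding S_simps using that(1,2) SL[OF that(3)] by (simp add: L.m_assoc)
    show "\<one>\<^bsub>R\<^esub> \<odot>\<^bsub>S\<^esub> x = x" if "x \<in> carrier S" for x
      unfolding S_simps using SL[OF that] by simp
  qed
qed

text \<open>The forms on the integral elements take values in \<open>A\<close>, so that the inverse of \<open>\<phi>\<close> turns them into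
  \<open>R\<close>-linear forms.\<close>

theorem locally_projective_S: "locally_projective R S"
  unfolding locally_projective_def
proof (intro conjI ballI)
  show "module R S" by (rule module_S)
  interpret S: module R S by (rule module_S)
  obtain a b where ab: "a \<in> carrier R" "b \<in> carrier R" "a \<noteq> \<zero>\<^bsub>R\<^esub>" "m = genideal R {a, b}"
    by (rule max_ideal_gens)
  interpret C: regular_surface_closure L A "\<phi> a" "\<phi> b" K by (rule regular_surface_closure_A[OF ab])
  have carS: "carrier S = C.integral_elems" unfolding carrier_S C.integral_elems_def ..
  fix x assume "x \<in> carrier S"
  then have x: "x \<in> C.integral_elems" using carS by simp
  from C.integral_elem_dual_basis[OF x] obtain B
    where "\<exists>g. finite B \<and> B \<subseteq> C.integral_elems \<and>
     (\<forall>e\<in>B. (\<forall>y\<in>C.integral_elems. g e y \<in> A) \<and>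
        (\<forall>y\<in>C.integral_elems. \<forall>z\<in>C.integral_elems. g e (y \<oplus>\<^bsub>L\<^esub> z) = g e y \<oplus>\<^bsub>L\<^esub> g e z) \<and>
        (\<forall>r\<in>A. \<forall>y\<in>C.integral_elems. g e (r \<otimes>\<^bsub>L\<^esub> y) = r \<otimes>\<^bsub>L\<^esub> g e y)) \<and>
     x = (\<Oplus>\<^bsub>L\<^esub>e\<in>B. g e x \<otimes>\<^bsub>L\<^esub> e)" by (rule exE)
  then obtain g where dual: "finite B \<and> B \<subseteq> carrier S \<and>
     (\<forall>e\<in>B. (\<forall>y\<in>carrier S. g e y \<in> A) \<and>
        (\<forall>y\<in>carrier S. \<forall>z\<in>carrier S. g e (y \<oplus>\<^bsub>L\<^esub> z) = g e y \<oplus>\<^bsub>L\<^esub> g e z) \<and>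
        (\<forall>r\<in>A. \<forall>y\<in>carrier S. g e (r \<otimes>\<^bsub>L\<^esub> y) = r \<otimes>\<^bsub>L\<^esub> g e y)) \<and>
     x = (\<Oplus>\<^bsub>L\<^esub>e\<in>B. g e x \<otimes>\<^bsub>L\<^esub> e)" unfolding carS[symmetric] by (rule exE)
  then have B: "finite B" "B \<subseteq> carrier S" and xsum: "x = (\<Oplus>\<^bsub>L\<^esub>e\<in>B. g e x \<otimes>\<^bsub>L\<^esub> e)" by blast+
  have g: "g e y \<in> A" "z \<in> carrier S \<Longrightarrow> g e (y \<oplus>\<^bsub>L\<^esub> z) = g e y \<oplus>\<^bsub>L\<^esub> g e z"
    "r \<in> A \<Longrightarrow> g e (r \<otimes>\<^bsub>L\<^esub> y) = r \<otimes>\<^bsub>L\<^esub> g e y" if "e \<in> B" "y \<in> carrier S" for e y z r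
    using dual that by blast+
  let ?i = "inv_into (carrier R) \<phi>"
  have i: "?i y \<in> carrier R" "\<phi> (?i y) = y" if "y \<in> A" for y
    using inv_into_into[of y \<phi> "carrier R"] f_inv_into_f[of y \<phi> "carrier R"] that by auto
  have ieq: "?i y = r" if "r \<in> carrier R" "\<phi> r = y" for r y
    using inv_into_f_f[OF phi_inj that(1)] that(2) by simp
  have form: "linear_form R S (\<lambda>y. ?i (g e y))" if e: "e \<in> B" for e
    unfolding linear_form_def
  proof (intro conjI ballI funcsetI)
    show "?i (g e y) \<in> carrier R" if "y \<in> carrier S" for y using i(1)[OF g(1)[OF e that]] .
    show "?i (g e (y \<oplus>\<^bsub>S\<^esub> z)) = ?i (g e y) \<oplus>\<^bsub>R\<^esub> ?i (g e z)" if "y \<in> carrier S" "z \<in> carrier S" for y z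
      using i[OF g(1)[OF e that(1)]] i[OF g(1)[OF e that(2)]] g(2)[OF e that]
      by (intro ieq) (simp_all add: S_simps)
    show "?i (g e (r \<odot>\<^bsub>S\<^esub> y)) = r \<otimes>\<^bsub>R\<^esub> ?i (g e y)" if "r \<in> carrier R" "y \<in> carrier S" for r y
      using i[OF g(1)[OF e that(2)]] g(3)[OF e that(2), of "\<phi> r"] that(1)
      by (intro ieq) (simp_all add: S_simps)
  qed
  have SL: "y \<in> carrier L" if "y \<in> carrier S" for y using that unfolding carrier_S L.integral_elem_def by blast
  have "finite_rank R S (\<lambda>y. \<Oplus>\<^bsub>L\<^esub>e\<in>C. g e y \<otimes>\<^bsub>L\<^esub> e)" if "C \<subseteq> B" for C
    using finite_subset[OF that B(1)] that
  proof (induction C rule: finite_induct)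
    case empty
    show ?case by (rule finite_rank.zero) (simp add: S_simps)
  next
    case (insert e C)
    then have e: "e \<in> B" "e \<in> carrier S" and C: "C \<subseteq> B" using B(2) by auto
    show ?case
    proof (rule finite_rank.step[OF insert.IH[OF C] form[OF e(1)] e(2)])
      fix y assume y: "y \<in> carrier S"
      have gL: "g e' y \<otimes>\<^bsub>L\<^esub> e' \<in> carrier L" if "e' \<in> B" for e'
        using subsetD[OF subringE(1)[OF subring_A] g(1)[OF that y]] SL B(2) that by auto
      have "(\<Oplus>\<^bsub>L\<^esub>e\<in>insert e C. g e y \<otimes>\<^bsub>L\<^esub> e) = g e y \<otimes>\<^bsub>L\<^esub> e \<oplus>\<^bsub>L\<^esub> (\<Oplus>\<^bsub>L\<^esub>e\<in>C. g e y \<otimes>\<^bsub>L\<^esub> e)"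
        using insert.hyps gL e(1) C by (intro L.finsum_insert) auto
      also have "\<dots> = (\<Oplus>\<^bsub>L\<^esub>e\<in>C. g e y \<otimes>\<^bsub>L\<^esub> e) \<oplus>\<^bsub>L\<^esub> g e y \<otimes>\<^bsub>L\<^esub> e"
        using gL e(1) C by (intro L.a_comm L.finsum_closed) auto
      finally show "(\<Oplus>\<^bsub>L\<^esub>e\<in>insert e C. g e y \<otimes>\<^bsub>L\<^esub> e) =
         (\<Oplus>\<^bsub>L\<^esub>e\<in>C. g e y \<otimes>\<^bsub>L\<^esub> e) \<oplus>\<^bsub>S\<^esub> ?i (g e y) \<odot>\<^bsub>S\<^esub> e"
        using i(2)[OF g(1)[OF e(1) y]] by (simp add: S_simps)
    qed
  qed
  from this[OF order_refl] xsum[symmetric] show "\<exists>p. finite_rank R S p \<and> p x = x"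
    by (intro exI[of _ "\<lambda>y. \<Oplus>\<^bsub>L\<^esub>e\<in>B. g e y \<otimes>\<^bsub>L\<^esub> e"] conjI)
qed

end

theorem theorem3p10:
  fixes R :: "('a, 'r) ring_scheme"
    and m :: "'a set"
    and \<phi> :: "'a \<Rightarrow> 'l"
    and L :: "('l, 'k) ring_scheme"
  assumes "domain R"
    and "regular_local_ring R m"
    and "adically_complete R m"
    and "krull_dim R = 2"
    and "contains_rationals R"
    and "alg_closure_of_fractions R \<phi> L"
  shows "intersection_flat TYPE('m) R (integral_closure_module R \<phi> L)
       \<and> ohm_rush R (integral_closure_module R \<phi> L)"
proof -
  interpret complete_regular_surface R m \<phi> L by (rule complete_regular_surface.intro[OF assms])
  show ?thesis
    using locally_projective_imp_intersection_flat[OF locally_projective_S]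
      locally_projective_imp_ohm_rush[OF locally_projective_S] by blast
qed

end
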